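(* Let $G$ be a pro-oligomorphic group, let $k$ be a commutative ring, and let $\mu$ be a $k$-valued measure for $G$. Then $\underline{\mathrm{Perm}}_k(G;\mu)$ is a rigid tensor category.
   Context: A pro-oligomorphic group is a topological group $G$ that is Hausdorff, non-archimedean (its open subgroups form a neighborhood basis of the identity), and Roelcke precompact (in the presence of the previous condition: $U\backslash G/V$ is finite for all open subgroups $U,V$). A $G$-set is a set with a smooth action of $G$, i.e. every stabilizer is open (same convention for open subgroups). A set with a group action is finitary if it has finitely many orbits. A $\hat G$-set is a set $X$ with a smooth action of some open subgroup $U$ of $G$ (a group of definition), where shrinking $U$ does not change the $\hat G$-set; it is finitary if $U$ has finitely many orbits on $X$ (independent of $U$). Maps of $\hat G$-sets are functions equivariant for some common open group of definition. For $g\in G$, $X^g$ is the same set with action $h\bullet x=(g^{-1}hg)\cdot x$. A measure for $G$ with values in a commutative ring $k$ is a rule $\mu$ assigning to each finitary $\hat G$-set $X$ an element $\mu(X)\in k$ such that: (a) $\mu(X)=\mu(Y)$ if $X\cong Y$; (b) $\mu$ of a one-point set is $1$; (c) $\mu(X\amalg Y)=\mu(X)+\mu(Y)$; (d) $\mu(X^g)=\mu(X)$; (e) if $U$ is an open subgroup and $X\to Y$ is a map of transitive $U$-sets with fiber $F$ over some point, then $\mu(X)=\mu(F)\mu(Y)$. A Schwartz function on a $\hat G$-set $X$ is a function $\phi\colon X\to k$ invariant under some group of definition of $X$ and with finitary support; it takes finitely many non-zero values $c_1,\dots,c_n$, and $\int_X\phi(x)\,dx=\sum_i c_i\,\mu(\phi^{-1}(c_i))$.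 The $k$-linear category $\underline{\mathrm{Perm}}_k(G;\mu)$: for each finitary $G$-set $X$ there is an object $\mathrm{Vec}_X$; $\mathrm{Hom}(\mathrm{Vec}_X,\mathrm{Vec}_Y)$ is the set of $G$-invariant functions $Y\times X\to k$ ("matrices"); the composition of $A\colon\mathrm{Vec}_X\to\mathrm{Vec}_Y$ and $B\colon\mathrm{Vec}_Y\to\mathrm{Vec}_Z$ is $(BA)(z,x)=\int_Y B(z,y)A(y,x)\,dy$; identities are indicator functions of diagonals. The monoidal product is $\mathrm{Vec}_X\underline\otimes\mathrm{Vec}_Y=\mathrm{Vec}_{X\times Y}$ on objects and $(A_1\underline\otimes A_2)(y_1,y_2,x_1,x_2)=A_1(y_1,x_1)A_2(y_2,x_2)$ on morphisms, with unit $\mathrm{Vec}$ of a one-point set and associativity, commutativity and unit constraints induced from those of the cartesian product of $G$-sets. A tensor category is a $k$-linear additive symmetric monoidal category whose monoidal product is $k$-bilinear; it is rigid if every object has a dual. *)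

theory Defs
  imports "HOL-Algebra.Group_Action" "HOL-Algebra.Module" "HOL-Analysis.T1_Spaces"
begin

section \<open>Pro-oligomorphic groups\<close>

locale pro_oligomorphic_group = group G for G :: "'g monoid" (structure) +
  fixes T :: "'g topology"
  assumes topspace_eq: "topspace T = carrier G"
    and continuous_mult: "continuous_map (prod_topology T T) T (\<lambda>(x, y). x \<otimes> y)"
    and continuous_inv: "continuous_map T T (\<lambda>x. inv x)"
    and Hausdorff: "Hausdorff_space T"
    and non_archimedean:
      "\<lbrakk>openin T W; \<one> \<in> W\<rbrakk> \<Longrightarrow> \<exists>U. subgroup U G \<and> openin T U \<and> U \<subseteq> W"
    and roelcke_precompact:
      "\<lbrakk>subgroup U G; openin T U; subgroup V G; openin T V\<rbrakk> \<Longrightarrow>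
        finite ((\<lambda>g. (U #> g) <#> V) ` carrier G)"

definition open_subgroup :: "'g monoid \<Rightarrow> 'g topology \<Rightarrow> 'g set \<Rightarrow> bool" where
  "open_subgroup G T U \<longleftrightarrow> subgroup U G \<and> openin T U"


section \<open>Sets with an action of an open subgroup\<close>

text \<open>
  A \<open>gset\<close> carries its point set, a chosen group of definition and the action.
  A set with a smooth action of some open subgroup, considered up to shrinking that
  subgroup, is handled through such representatives. Morphisms (\<open>hat_map\<close>) only see
  a common open subgroup, so the identity map is an isomorphism between a representative
  and its restriction to a smaller open subgroup. Values of \<open>act X g\<close> for \<open>g\<close> outside
  \<open>grp X\<close> are irrelevant.
\<close>

record ('g, 'x) gset =
  pts :: "'x set"
  grp :: "'g set"
  act :: "'g \<Rightarrow> 'x \<Rightarrow> 'x"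

abbreviation grp_of :: "'g monoid \<Rightarrow> ('g, 'x) gset \<Rightarrow> 'g monoid" where
  "grp_of G X \<equiv> G\<lparr>carrier := grp X\<rparr>"

definition hat_set :: "'g monoid \<Rightarrow> 'g topology \<Rightarrow> ('g, 'x) gset \<Rightarrow> bool" where
  "hat_set G T X \<longleftrightarrow>
    open_subgroup G T (grp X) \<and>
    group_action (grp_of G X) (pts X) (act X) \<and>
    (\<forall>x\<in>pts X. openin T (stabilizer (grp_of G X) (act X) x))"

definition finitary :: "'g monoid \<Rightarrow> ('g, 'x) gset \<Rightarrow> bool" where
  "finitary G X \<longleftrightarrow> finite (orbits (grp_of G X) (pts X) (act X))"

definition transitive :: "'g monoid \<Rightarrow> ('g, 'x) gset \<Rightarrow> bool" where
  "transitive G X \<longleftrightarrow> pts X \<noteq> {} \<and> transitive_action (grp_of G X) (pts X) (act X)"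

definition equivariant_on ::
  "'g set \<Rightarrow> ('g, 'x) gset \<Rightarrow> ('g, 'y) gset \<Rightarrow> ('x \<Rightarrow> 'y) \<Rightarrow> bool" where
  "equivariant_on U X Y f \<longleftrightarrow>
    f \<in> pts X \<rightarrow> pts Y \<and> (\<forall>g\<in>U. \<forall>x\<in>pts X. f (act X g x) = act Y g (f x))"

definition hat_map ::
  "'g monoid \<Rightarrow> 'g topology \<Rightarrow> ('g, 'x) gset \<Rightarrow> ('g, 'y) gset \<Rightarrow> ('x \<Rightarrow> 'y) \<Rightarrow> bool" where
  "hat_map G T X Y f \<longleftrightarrow>
    (\<exists>U. open_subgroup G T U \<and> U \<subseteq> grp X \<inter> grp Y \<and> equivariant_on U X Y f)"

definition hat_iso ::
  "'g monoid \<Rightarrow> 'g topology \<Rightarrow> ('g, 'x) gset \<Rightarrow> ('g, 'y) gset \<Rightarrow> bool" where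
  "hat_iso G T X Y \<longleftrightarrow> (\<exists>f. hat_map G T X Y f \<and> bij_betw f (pts X) (pts Y))"

definition subset_gset :: "('g, 'x) gset \<Rightarrow> 'x set \<Rightarrow> 'g set \<Rightarrow> ('g, 'x) gset" where
  "subset_gset X S V = \<lparr>pts = S, grp = V, act = (\<lambda>g. restrict (act X g) S)\<rparr>"

definition conj_gset :: "'g monoid \<Rightarrow> 'g \<Rightarrow> ('g, 'x) gset \<Rightarrow> ('g, 'x) gset" where
  "conj_gset G g X =
    \<lparr>pts = pts X,
     grp = (\<lambda>u. g \<otimes>\<^bsub>G\<^esub> u \<otimes>\<^bsub>G\<^esub> inv\<^bsub>G\<^esub> g) ` grp X,
     act = (\<lambda>h. act X (inv\<^bsub>G\<^esub> g \<otimes>\<^bsub>G\<^esub> h \<otimes>\<^bsub>G\<^esub> g))\<rparr>"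

definition fiber_gset ::
  "'g monoid \<Rightarrow> ('g, 'x) gset \<Rightarrow> ('g, 'y) gset \<Rightarrow> ('x \<Rightarrow> 'y) \<Rightarrow> 'y \<Rightarrow> ('g, 'x) gset" where
  "fiber_gset G X Y f y =
    subset_gset X {x \<in> pts X. f x = y} (stabilizer (grp_of G Y) (act Y) y)"


section \<open>A universe of points\<close>

text \<open>
  A measure is defined on all finitary sets with an action, and the objects of the
  permutation category are closed under products and coproducts, so the points have to be
  taken from one type with formal pairs and tagged copies. The leaves contain all subsets of
  the group, so every coset space \<open>U/V\<close>, and hence (up to isomorphism) every finitary
  set with an action of an open subgroup, occurs in the type \<open>('g, 'a) univ\<close>. The
  parameter \<open>'a\<close> is arbitrary, so that actions on subsets of any given type occur
  as well.
\<close>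

datatype 'b point = Star | Atom 'b | Pair "'b point" "'b point" | InL "'b point" | InR "'b point"

type_synonym ('g, 'a) univ = "('g set + 'a) point"

definition point_gset :: "'g monoid \<Rightarrow> ('g, 'b point) gset" where
  "point_gset G = \<lparr>pts = {Star}, grp = carrier G, act = (\<lambda>g. restrict id {Star})\<rparr>"

definition sum_gset :: "('g, 'b point) gset \<Rightarrow> ('g, 'b point) gset \<Rightarrow> ('g, 'b point) gset" where
  "sum_gset X Y =
    \<lparr>pts = InL ` pts X \<union> InR ` pts Y,
     grp = grp X \<inter> grp Y,
     act = (\<lambda>g. restrict
       (\<lambda>p. case p of InL x \<Rightarrow> InL (act X g x) | InR y \<Rightarrow> InR (act Y g y) | _ \<Rightarrow> p)
       (InL ` pts X \<union> InR ` pts Y))\<rparr>"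

definition prod_pts :: "'b point set \<Rightarrow> 'b point set \<Rightarrow> 'b point set" where
  "prod_pts A B = {Pair x y | x y. x \<in> A \<and> y \<in> B}"

definition prod_gset :: "('g, 'b point) gset \<Rightarrow> ('g, 'b point) gset \<Rightarrow> ('g, 'b point) gset" where
  "prod_gset X Y =
    \<lparr>pts = prod_pts (pts X) (pts Y),
     grp = grp X \<inter> grp Y,
     act = (\<lambda>g. restrict
       (\<lambda>p. case p of Pair x y \<Rightarrow> Pair (act X g x) (act Y g y) | _ \<Rightarrow> p)
       (prod_pts (pts X) (pts Y)))\<rparr>"


section \<open>Measures and integration\<close>

text \<open>
  The sort \<open>{comm_ring, comm_monoid_mult}\<close> is that of commutative rings with unit; unlike
  \<open>comm_ring_1\<close> it includes the zero ring.
\<close>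

locale group_measure =
  fixes G :: "'g monoid" and T :: "'g topology"
    and \<mu> :: "('g, ('g, 'a) univ) gset \<Rightarrow> 'k::{comm_ring, comm_monoid_mult}"
  assumes iso:
      "\<lbrakk>hat_set G T X; finitary G X; hat_set G T Y; finitary G Y; hat_iso G T X Y\<rbrakk> \<Longrightarrow>
        \<mu> X = \<mu> Y"
    and one_point: "\<lbrakk>hat_set G T X; pts X = {x}\<rbrakk> \<Longrightarrow> \<mu> X = 1"
    and additive:
      "\<lbrakk>hat_set G T X; finitary G X; hat_set G T Y; finitary G Y\<rbrakk> \<Longrightarrow>
        \<mu> (sum_gset X Y) = \<mu> X + \<mu> Y"
    and conjugate:
      "\<lbrakk>hat_set G T X; finitary G X; g \<in> carrier G\<rbrakk> \<Longrightarrow> \<mu> (conj_gset G g X) = \<mu> X"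
    and fibration:
      "\<lbrakk>open_subgroup G T U; hat_set G T X; hat_set G T Y; grp X = U; grp Y = U;
        transitive G X; transitive G Y; equivariant_on U X Y f; y \<in> pts Y\<rbrakk> \<Longrightarrow>
        \<mu> X = \<mu> (fiber_gset G X Y f y) * \<mu> Y"

text \<open>
  For a Schwartz function \<open>\<phi>\<close>, which is invariant under some open subgroup of \<open>grp X\<close>,
  \<open>invariance_group X \<phi>\<close> is the largest group of definition inside \<open>grp X\<close> leaving
  \<open>\<phi>\<close> invariant. It serves as group of definition of the level sets of \<open>\<phi>\<close>; the
  choice does not matter by the isomorphism invariance of measures. The integral is only
  meaningful for Schwartz functions.
\<close>

definition schwartz ::
  "'g monoid \<Rightarrow> 'g topology \<Rightarrow> ('g, 'x) gset \<Rightarrow> ('x \<Rightarrow> 'k::zero) \<Rightarrow> bool" where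
  "schwartz G T X \<phi> \<longleftrightarrow>
    (\<exists>U. open_subgroup G T U \<and> U \<subseteq> grp X \<and>
      (\<forall>g\<in>U. \<forall>x\<in>pts X. \<phi> (act X g x) = \<phi> x) \<and>
      finitary G (subset_gset X {x \<in> pts X. \<phi> x \<noteq> 0} U))"

definition invariance_group :: "('g, 'x) gset \<Rightarrow> ('x \<Rightarrow> 'k) \<Rightarrow> 'g set" where
  "invariance_group X \<phi> = {g \<in> grp X. \<forall>x\<in>pts X. \<phi> (act X g x) = \<phi> x}"

definition integral ::
  "(('g, 'x) gset \<Rightarrow> 'k) \<Rightarrow> ('g, 'x) gset \<Rightarrow> ('x \<Rightarrow> 'k) \<Rightarrow> 'k::{comm_ring, comm_monoid_mult}" where
  "integral \<mu> X \<phi> =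
    (\<Sum>c \<in> \<phi> ` pts X - {0}.
      c * \<mu> (subset_gset X {x \<in> pts X. \<phi> x = c} (invariance_group X \<phi>)))"


section \<open>Rigid tensor categories\<close>

record ('o, 'm) cat =
  Obj :: "'o set"
  Hom :: "'o \<Rightarrow> 'o \<Rightarrow> 'm set"
  Comp :: "'m \<Rightarrow> 'm \<Rightarrow> 'm"  (infixr \<open>\<cdot>\<index>\<close> 70)
  Ident :: "'o \<Rightarrow> 'm"

record ('o, 'm, 'k) linear_cat = "('o, 'm) cat" +
  ZeroMor :: "'o \<Rightarrow> 'o \<Rightarrow> 'm"
  AddMor :: "'m \<Rightarrow> 'm \<Rightarrow> 'm"
  ScaleMor :: "'k \<Rightarrow> 'm \<Rightarrow> 'm"

text \<open>
  \<open>Lunit X\<close>, \<open>Runit X\<close>, \<open>Assoc X Y Z\<close> and \<open>Braid X Y\<close> are the constraints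
  \<open>1 \<otimes> X \<rightarrow> X\<close>, \<open>X \<otimes> 1 \<rightarrow> X\<close>, \<open>(X \<otimes> Y) \<otimes> Z \<rightarrow> X \<otimes> (Y \<otimes> Z)\<close> and \<open>X \<otimes> Y \<rightarrow> Y \<otimes> X\<close>.
\<close>

record ('o, 'm, 'k) monoidal_cat = "('o, 'm, 'k) linear_cat" +
  TensorObj :: "'o \<Rightarrow> 'o \<Rightarrow> 'o"  (infixr \<open>\<otimes>\<^sub>O\<index>\<close> 75)
  TensorMor :: "'m \<Rightarrow> 'm \<Rightarrow> 'm"  (infixr \<open>\<otimes>\<^sub>M\<index>\<close> 75)
  UnitObj :: "'o"
  Lunit :: "'o \<Rightarrow> 'm"
  Runit :: "'o \<Rightarrow> 'm"
  Assoc :: "'o \<Rightarrow> 'o \<Rightarrow> 'o \<Rightarrow> 'm"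
  Braid :: "'o \<Rightarrow> 'o \<Rightarrow> 'm"

locale category =
  fixes C :: "('o, 'm, 'z) cat_scheme" (structure)
  assumes ident_closed: "X \<in> Obj C \<Longrightarrow> Ident C X \<in> Hom C X X"
    and comp_closed:
      "\<lbrakk>X \<in> Obj C; Y \<in> Obj C; Z \<in> Obj C; f \<in> Hom C X Y; g \<in> Hom C Y Z\<rbrakk> \<Longrightarrow> g \<cdot> f \<in> Hom C X Z"
    and comp_ident_left:
      "\<lbrakk>X \<in> Obj C; Y \<in> Obj C; f \<in> Hom C X Y\<rbrakk> \<Longrightarrow> Ident C Y \<cdot> f = f"
    and comp_ident_right:
      "\<lbrakk>X \<in> Obj C; Y \<in> Obj C; f \<in> Hom C X Y\<rbrakk> \<Longrightarrow> f \<cdot> Ident C X = f"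
    and comp_assoc:
      "\<lbrakk>W \<in> Obj C; X \<in> Obj C; Y \<in> Obj C; Z \<in> Obj C;
        f \<in> Hom C W X; g \<in> Hom C X Y; h \<in> Hom C Y Z\<rbrakk> \<Longrightarrow> (h \<cdot> g) \<cdot> f = h \<cdot> (g \<cdot> f)"

definition inverse_arrows ::
  "('o, 'm, 'z) cat_scheme \<Rightarrow> 'o \<Rightarrow> 'o \<Rightarrow> 'm \<Rightarrow> 'm \<Rightarrow> bool" where
  "inverse_arrows C X Y f g \<longleftrightarrow>
    f \<in> Hom C X Y \<and> g \<in> Hom C Y X \<and> g \<cdot>\<^bsub>C\<^esub> f = Ident C X \<and> f \<cdot>\<^bsub>C\<^esub> g = Ident C Y"

definition iso_arrow :: "('o, 'm, 'z) cat_scheme \<Rightarrow> 'o \<Rightarrow> 'o \<Rightarrow> 'm \<Rightarrow> bool" where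
  "iso_arrow C X Y f \<longleftrightarrow> (\<exists>g. inverse_arrows C X Y f g)"

text \<open>The ring structure of a type and the module of morphisms, as records of HOL-Algebra.\<close>

definition scalar_ring :: "'k::{comm_ring, comm_monoid_mult} ring" where
  "scalar_ring = \<lparr>carrier = UNIV, mult = (*), one = 1, zero = 0, add = (+)\<rparr>"

definition hom_module ::
  "('o, 'm, 'k, 'z) linear_cat_scheme \<Rightarrow> 'o \<Rightarrow> 'o \<Rightarrow> ('k, 'm) module" where
  "hom_module C X Y =
    \<lparr>carrier = Hom C X Y, mult = undefined, one = undefined,
     zero = ZeroMor C X Y, add = AddMor C, smult = ScaleMor C\<rparr>"

locale linear_category = category C
  for C :: "('o, 'm, 'k::{comm_ring, comm_monoid_mult}, 'z) linear_cat_scheme" (structure) +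
  assumes hom_module:
      "\<lbrakk>X \<in> Obj C; Y \<in> Obj C\<rbrakk> \<Longrightarrow> Module.module (scalar_ring :: 'k ring) (hom_module C X Y)"
    and comp_add_left:
      "\<lbrakk>X \<in> Obj C; Y \<in> Obj C; Z \<in> Obj C; f \<in> Hom C X Y; g \<in> Hom C Y Z; g' \<in> Hom C Y Z\<rbrakk> \<Longrightarrow>
        AddMor C g g' \<cdot> f = AddMor C (g \<cdot> f) (g' \<cdot> f)"
    and comp_add_right:
      "\<lbrakk>X \<in> Obj C; Y \<in> Obj C; Z \<in> Obj C; f \<in> Hom C X Y; f' \<in> Hom C X Y; g \<in> Hom C Y Z\<rbrakk> \<Longrightarrow>
        g \<cdot> AddMor C f f' = AddMor C (g \<cdot> f) (g \<cdot> f')"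
    and comp_scale_left:
      "\<lbrakk>X \<in> Obj C; Y \<in> Obj C; Z \<in> Obj C; f \<in> Hom C X Y; g \<in> Hom C Y Z\<rbrakk> \<Longrightarrow>
        ScaleMor C a g \<cdot> f = ScaleMor C a (g \<cdot> f)"
    and comp_scale_right:
      "\<lbrakk>X \<in> Obj C; Y \<in> Obj C; Z \<in> Obj C; f \<in> Hom C X Y; g \<in> Hom C Y Z\<rbrakk> \<Longrightarrow>
        g \<cdot> ScaleMor C a f = ScaleMor C a (g \<cdot> f)"

definition zero_object :: "('o, 'm, 'z) cat_scheme \<Rightarrow> 'o \<Rightarrow> bool" where
  "zero_object C Z \<longleftrightarrow> Z \<in> Obj C \<and>
    (\<forall>X\<in>Obj C. (\<exists>!f. f \<in> Hom C Z X) \<and> (\<exists>!f. f \<in> Hom C X Z))"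

definition is_biproduct ::
  "('o, 'm, 'k, 'z) linear_cat_scheme \<Rightarrow> 'o \<Rightarrow> 'o \<Rightarrow> 'o \<Rightarrow> 'm \<Rightarrow> 'm \<Rightarrow> 'm \<Rightarrow> 'm \<Rightarrow> bool" where
  "is_biproduct C X Y S i j p q \<longleftrightarrow>
    S \<in> Obj C \<and> i \<in> Hom C X S \<and> j \<in> Hom C Y S \<and> p \<in> Hom C S X \<and> q \<in> Hom C S Y \<and>
    p \<cdot>\<^bsub>C\<^esub> i = Ident C X \<and> q \<cdot>\<^bsub>C\<^esub> j = Ident C Y \<and>
    p \<cdot>\<^bsub>C\<^esub> j = ZeroMor C Y X \<and> q \<cdot>\<^bsub>C\<^esub> i = ZeroMor C X Y \<and>
    AddMor C (i \<cdot>\<^bsub>C\<^esub> p) (j \<cdot>\<^bsub>C\<^esub> q) = Ident C S"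

locale additive_linear_category = linear_category +
  assumes has_zero_object: "\<exists>Z. zero_object C Z"
    and has_biproducts:
      "\<lbrakk>X \<in> Obj C; Y \<in> Obj C\<rbrakk> \<Longrightarrow> \<exists>S i j p q. is_biproduct C X Y S i j p q"

locale symmetric_monoidal_category = category C
  for C :: "('o, 'm, 'k, 'z) monoidal_cat_scheme" (structure) +
  assumes tensor_obj_closed: "\<lbrakk>X \<in> Obj C; Y \<in> Obj C\<rbrakk> \<Longrightarrow> X \<otimes>\<^sub>O Y \<in> Obj C"
    and unit_obj_closed: "UnitObj C \<in> Obj C"
    and tensor_mor_closed:
      "\<lbrakk>X \<in> Obj C; Y \<in> Obj C; X' \<in> Obj C; Y' \<in> Obj C; f \<in> Hom C X Y; f' \<in> Hom C X' Y'\<rbrakk> \<Longrightarrow>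
        f \<otimes>\<^sub>M f' \<in> Hom C (X \<otimes>\<^sub>O X') (Y \<otimes>\<^sub>O Y')"
    and tensor_ident:
      "\<lbrakk>X \<in> Obj C; Y \<in> Obj C\<rbrakk> \<Longrightarrow> Ident C X \<otimes>\<^sub>M Ident C Y = Ident C (X \<otimes>\<^sub>O Y)"
    and tensor_comp:
      "\<lbrakk>X \<in> Obj C; Y \<in> Obj C; Z \<in> Obj C; X' \<in> Obj C; Y' \<in> Obj C; Z' \<in> Obj C;
        f \<in> Hom C X Y; g \<in> Hom C Y Z; f' \<in> Hom C X' Y'; g' \<in> Hom C Y' Z'\<rbrakk> \<Longrightarrow>
        (g \<cdot> f) \<otimes>\<^sub>M (g' \<cdot> f') = (g \<otimes>\<^sub>M g') \<cdot> (f \<otimes>\<^sub>M f')"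
    and lunit_iso: "X \<in> Obj C \<Longrightarrow> iso_arrow C (UnitObj C \<otimes>\<^sub>O X) X (Lunit C X)"
    and runit_iso: "X \<in> Obj C \<Longrightarrow> iso_arrow C (X \<otimes>\<^sub>O UnitObj C) X (Runit C X)"
    and assoc_iso:
      "\<lbrakk>X \<in> Obj C; Y \<in> Obj C; Z \<in> Obj C\<rbrakk> \<Longrightarrow>
        iso_arrow C ((X \<otimes>\<^sub>O Y) \<otimes>\<^sub>O Z) (X \<otimes>\<^sub>O (Y \<otimes>\<^sub>O Z)) (Assoc C X Y Z)"
    and braid_iso:
      "\<lbrakk>X \<in> Obj C; Y \<in> Obj C\<rbrakk> \<Longrightarrow> iso_arrow C (X \<otimes>\<^sub>O Y) (Y \<otimes>\<^sub>O X) (Braid C X Y)"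
    and lunit_natural:
      "\<lbrakk>X \<in> Obj C; Y \<in> Obj C; f \<in> Hom C X Y\<rbrakk> \<Longrightarrow>
        Lunit C Y \<cdot> (Ident C (UnitObj C) \<otimes>\<^sub>M f) = f \<cdot> Lunit C X"
    and runit_natural:
      "\<lbrakk>X \<in> Obj C; Y \<in> Obj C; f \<in> Hom C X Y\<rbrakk> \<Longrightarrow>
        Runit C Y \<cdot> (f \<otimes>\<^sub>M Ident C (UnitObj C)) = f \<cdot> Runit C X"
    and assoc_natural:
      "\<lbrakk>X \<in> Obj C; Y \<in> Obj C; Z \<in> Obj C; X' \<in> Obj C; Y' \<in> Obj C; Z' \<in> Obj C;
        f \<in> Hom C X X'; g \<in> Hom C Y Y'; h \<in> Hom C Z Z'\<rbrakk> \<Longrightarrow>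
        Assoc C X' Y' Z' \<cdot> ((f \<otimes>\<^sub>M g) \<otimes>\<^sub>M h) = (f \<otimes>\<^sub>M (g \<otimes>\<^sub>M h)) \<cdot> Assoc C X Y Z"
    and braid_natural:
      "\<lbrakk>X \<in> Obj C; Y \<in> Obj C; X' \<in> Obj C; Y' \<in> Obj C; f \<in> Hom C X X'; g \<in> Hom C Y Y'\<rbrakk> \<Longrightarrow>
        Braid C X' Y' \<cdot> (f \<otimes>\<^sub>M g) = (g \<otimes>\<^sub>M f) \<cdot> Braid C X Y"
    and triangle:
      "\<lbrakk>X \<in> Obj C; Y \<in> Obj C\<rbrakk> \<Longrightarrow>
        (Ident C X \<otimes>\<^sub>M Lunit C Y) \<cdot> Assoc C X (UnitObj C) Y = Runit C X \<otimes>\<^sub>M Ident C Y"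
    and pentagon:
      "\<lbrakk>W \<in> Obj C; X \<in> Obj C; Y \<in> Obj C; Z \<in> Obj C\<rbrakk> \<Longrightarrow>
        Assoc C W X (Y \<otimes>\<^sub>O Z) \<cdot> Assoc C (W \<otimes>\<^sub>O X) Y Z =
        (Ident C W \<otimes>\<^sub>M Assoc C X Y Z) \<cdot> Assoc C W (X \<otimes>\<^sub>O Y) Z \<cdot>
          (Assoc C W X Y \<otimes>\<^sub>M Ident C Z)"
    and hexagon:
      "\<lbrakk>X \<in> Obj C; Y \<in> Obj C; Z \<in> Obj C\<rbrakk> \<Longrightarrow>
        Assoc C Y Z X \<cdot> Braid C X (Y \<otimes>\<^sub>O Z) \<cdot> Assoc C X Y Z =
        (Ident C Y \<otimes>\<^sub>M Braid C X Z) \<cdot> Assoc C Y X Z \<cdot> (Braid C X Y \<otimes>\<^sub>M Ident C Z)"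
    and symmetry:
      "\<lbrakk>X \<in> Obj C; Y \<in> Obj C\<rbrakk> \<Longrightarrow> Braid C Y X \<cdot> Braid C X Y = Ident C (X \<otimes>\<^sub>O Y)"

locale tensor_category =
  additive_linear_category C + symmetric_monoidal_category C
  for C :: "('o, 'm, 'k::{comm_ring, comm_monoid_mult}, 'z) monoidal_cat_scheme" (structure) +
  assumes tensor_add_left:
      "\<lbrakk>X \<in> Obj C; Y \<in> Obj C; X' \<in> Obj C; Y' \<in> Obj C;
        f \<in> Hom C X Y; g \<in> Hom C X Y; h \<in> Hom C X' Y'\<rbrakk> \<Longrightarrow>
        AddMor C f g \<otimes>\<^sub>M h = AddMor C (f \<otimes>\<^sub>M h) (g \<otimes>\<^sub>M h)"
    and tensor_add_right:
      "\<lbrakk>X \<in> Obj C; Y \<in> Obj C; X' \<in> Obj C; Y' \<in> Obj C;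
        f \<in> Hom C X Y; g \<in> Hom C X' Y'; h \<in> Hom C X' Y'\<rbrakk> \<Longrightarrow>
        f \<otimes>\<^sub>M AddMor C g h = AddMor C (f \<otimes>\<^sub>M g) (f \<otimes>\<^sub>M h)"
    and tensor_scale_left:
      "\<lbrakk>X \<in> Obj C; Y \<in> Obj C; X' \<in> Obj C; Y' \<in> Obj C; f \<in> Hom C X Y; h \<in> Hom C X' Y'\<rbrakk> \<Longrightarrow>
        ScaleMor C a f \<otimes>\<^sub>M h = ScaleMor C a (f \<otimes>\<^sub>M h)"
    and tensor_scale_right:
      "\<lbrakk>X \<in> Obj C; Y \<in> Obj C; X' \<in> Obj C; Y' \<in> Obj C; f \<in> Hom C X Y; h \<in> Hom C X' Y'\<rbrakk> \<Longrightarrow>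
        f \<otimes>\<^sub>M ScaleMor C a h = ScaleMor C a (f \<otimes>\<^sub>M h)"

text \<open>
  The two zigzag identities, with the inverses of the unit constraints moved to the other
  side; \<open>b\<close> is the inverse of the associator.
\<close>

definition is_dual ::
  "('o, 'm, 'k, 'z) monoidal_cat_scheme \<Rightarrow> 'o \<Rightarrow> 'o \<Rightarrow> 'm \<Rightarrow> 'm \<Rightarrow> bool" where
  "is_dual C X Y ev coev \<longleftrightarrow>
    Y \<in> Obj C \<and>
    ev \<in> Hom C (Y \<otimes>\<^sub>O\<^bsub>C\<^esub> X) (UnitObj C) \<and>
    coev \<in> Hom C (UnitObj C) (X \<otimes>\<^sub>O\<^bsub>C\<^esub> Y) \<and>
    Runit C X \<cdot>\<^bsub>C\<^esub> (Ident C X \<otimes>\<^sub>M\<^bsub>C\<^esub> ev) \<cdot>\<^bsub>C\<^esub> Assoc C X Y X \<cdot>\<^bsub>C\<^esub>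
      (coev \<otimes>\<^sub>M\<^bsub>C\<^esub> Ident C X) = Lunit C X \<and>
    (\<exists>b. inverse_arrows C ((Y \<otimes>\<^sub>O\<^bsub>C\<^esub> X) \<otimes>\<^sub>O\<^bsub>C\<^esub> Y) (Y \<otimes>\<^sub>O\<^bsub>C\<^esub> (X \<otimes>\<^sub>O\<^bsub>C\<^esub> Y)) (Assoc C Y X Y) b \<and>
      Lunit C Y \<cdot>\<^bsub>C\<^esub> (ev \<otimes>\<^sub>M\<^bsub>C\<^esub> Ident C Y) \<cdot>\<^bsub>C\<^esub> b \<cdot>\<^bsub>C\<^esub>
        (Ident C Y \<otimes>\<^sub>M\<^bsub>C\<^esub> coev) = Runit C Y)"

locale rigid_tensor_category = tensor_category +
  assumes has_duals: "X \<in> Obj C \<Longrightarrow> \<exists>Y ev coev. is_dual C X Y ev coev"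


section \<open>The category of permutation modules\<close>

text \<open>
  The object attached to a finitary set with a smooth action of the whole group is that set
  itself. A morphism records source and target; its entry function is normalized to vanish off
  \<open>pts target \<times> pts source\<close>, so that it is determined by the matrix.
\<close>

record ('g, 'x, 'k) mat =
  source :: "('g, 'x) gset"
  target :: "('g, 'x) gset"
  entry :: "'x \<Rightarrow> 'x \<Rightarrow> 'k"

definition perm_obj :: "'g monoid \<Rightarrow> 'g topology \<Rightarrow> ('g, 'x) gset set" where
  "perm_obj G T = {X. hat_set G T X \<and> grp X = carrier G \<and> finitary G X}"

definition perm_hom ::
  "'g monoid \<Rightarrow> ('g, 'x) gset \<Rightarrow> ('g, 'x) gset \<Rightarrow> ('g, 'x, 'k::zero) mat set" where
  "perm_hom G X Y =
    {A. source A = X \<and> target A = Y \<and>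
      (\<forall>y x. y \<notin> pts Y \<or> x \<notin> pts X \<longrightarrow> entry A y x = 0) \<and>
      (\<forall>g\<in>carrier G. \<forall>y\<in>pts Y. \<forall>x\<in>pts X. entry A (act Y g y) (act X g x) = entry A y x)}"

definition mat_comp ::
  "(('g, 'x) gset \<Rightarrow> 'k) \<Rightarrow> ('g, 'x, 'k) mat \<Rightarrow> ('g, 'x, 'k) mat
    \<Rightarrow> ('g, 'x, 'k::{comm_ring, comm_monoid_mult}) mat" where
  "mat_comp \<mu> B A =
    \<lparr>source = source A, target = target B,
     entry = (\<lambda>z x. integral \<mu> (target A) (\<lambda>y. entry B z y * entry A y x))\<rparr>"

definition mat_tensor ::
  "('g, 'b point, 'k) mat \<Rightarrow> ('g, 'b point, 'k) mat
    \<Rightarrow> ('g, 'b point, 'k::{comm_ring, comm_monoid_mult}) mat" where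
  "mat_tensor A\<^sub>1 A\<^sub>2 =
    \<lparr>source = prod_gset (source A\<^sub>1) (source A\<^sub>2),
     target = prod_gset (target A\<^sub>1) (target A\<^sub>2),
     entry = (\<lambda>y x. case (y, x) of
       (Pair y\<^sub>1 y\<^sub>2, Pair x\<^sub>1 x\<^sub>2) \<Rightarrow> entry A\<^sub>1 y\<^sub>1 x\<^sub>1 * entry A\<^sub>2 y\<^sub>2 x\<^sub>2 | _ \<Rightarrow> 0)\<rparr>"

text \<open>The matrix induced by a map \<open>f\<close> of sets with an action.\<close>

definition mat_of_map ::
  "('g, 'x) gset \<Rightarrow> ('g, 'x) gset \<Rightarrow> ('x \<Rightarrow> 'x)
    \<Rightarrow> ('g, 'x, 'k::{comm_ring, comm_monoid_mult}) mat" where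
  "mat_of_map X Y f =
    \<lparr>source = X, target = Y,
     entry = (\<lambda>y x. if x \<in> pts X \<and> y \<in> pts Y \<and> y = f x then 1 else 0)\<rparr>"

fun drop_left :: "'b point \<Rightarrow> 'b point" where
  "drop_left (Pair p x) = x" | "drop_left p = p"

fun drop_right :: "'b point \<Rightarrow> 'b point" where
  "drop_right (Pair x p) = x" | "drop_right p = p"

fun reassoc :: "'b point \<Rightarrow> 'b point" where
  "reassoc (Pair (Pair x y) z) = Pair x (Pair y z)" | "reassoc p = p"

fun swap_pair :: "'b point \<Rightarrow> 'b point" where
  "swap_pair (Pair x y) = Pair y x" | "swap_pair p = p"

definition Perm ::
  "'g monoid \<Rightarrow> 'g topology
    \<Rightarrow> (('g, ('g, 'a) univ) gset \<Rightarrow> 'k::{comm_ring, comm_monoid_mult})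
    \<Rightarrow> (('g, ('g, 'a) univ) gset, ('g, ('g, 'a) univ, 'k) mat, 'k) monoidal_cat" where
  "Perm G T \<mu> =
    \<lparr>Obj = perm_obj G T,
     Hom = perm_hom G,
     Comp = mat_comp \<mu>,
     Ident = (\<lambda>X. mat_of_map X X id),
     ZeroMor = (\<lambda>X Y. \<lparr>source = X, target = Y, entry = (\<lambda>y x. 0)\<rparr>),
     AddMor = (\<lambda>A B. A\<lparr>entry := (\<lambda>y x. entry A y x + entry B y x)\<rparr>),
     ScaleMor = (\<lambda>c A. A\<lparr>entry := (\<lambda>y x. c * entry A y x)\<rparr>),
     TensorObj = prod_gset,
     TensorMor = mat_tensor,
     UnitObj = point_gset G,
     Lunit = (\<lambda>X. mat_of_map (prod_gset (point_gset G) X) X drop_left),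
     Runit = (\<lambda>X. mat_of_map (prod_gset X (point_gset G)) X drop_right),
     Assoc = (\<lambda>X Y Z. mat_of_map (prod_gset (prod_gset X Y) Z) (prod_gset X (prod_gset Y Z)) reassoc),
     Braid = (\<lambda>X Y. mat_of_map (prod_gset X Y) (prod_gset Y X) swap_pair)\<rparr>"

end

theory Submission
  imports Defs
begin

text \<open>
  The product of two matrices is an integral, so each axiom of a rigid tensor category becomes a
  statement about integrals over finitary \<open>G\<close>-sets. These integrals are finite sums: by
  Roelcke precompactness an open subgroup \<open>U\<close> has finitely many orbits on a finitary
  \<open>G\<close>-set, and a \<open>U\<close>-invariant function \<open>\<phi>\<close> is constant on each of them, so
  \<open>\<integral>\<phi>\<close> is the sum of \<open>\<phi>(Q) \<mu>(Q)\<close> over the \<open>U\<close>-orbits \<open>Q\<close>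
  (\<open>integral_orbits\<close>). This is independent of \<open>U\<close>, and passing to a common \<open>U\<close> for
  several functions makes linearity evident. Four properties of the integral then carry the theorem.

  \<^item> It is unchanged when the integrand is translated by an element of \<open>G\<close>, because measures are
    invariant under conjugation (\<open>integral_translate\<close>). Hence products of invariant matrices are
    invariant.

  \<^item> A function that vanishes away from one point integrates to its value there
    (\<open>integral_point\<close>). Multiplication by the matrix of an injective equivariant map therefore
    only relabels rows or columns (\<open>comp_map_left\<close>, \<open>comp_map_right\<close>). All structure
    morphisms are matrices of bijections that rearrange tuples, so the coherence axioms reduce to
    identities between rearrangements.

  \<^item> It can be computed along the fibers of an equivariant map \<open>f: Z \<rightarrow> X\<close>
    (\<open>integral_fibration\<close>). Indeed \<open>f\<close> sends a \<open>U\<close>-orbit \<open>Q\<close> of \<open>Z\<close> onto a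
    \<open>U\<close>-orbit of \<open>X\<close>, and the axiom \<open>fibration\<close> says that \<open>\<mu>(Q)\<close> is the product of
    \<open>\<mu>(f(Q))\<close> and the measure of a fiber of \<open>Q \<rightarrow> f(Q)\<close>.

  \<^item> It is compatible with injective maps that are equivariant for an open subgroup
    (\<open>integral_pushforward\<close>), so the integral over the fiber \<open>{x} \<times> Y\<close> of
    \<open>X \<times> Y \<rightarrow> X\<close> is an integral over \<open>Y\<close>.

  The last two properties, for both projections of \<open>X \<times> Y\<close>, give Fubini's theorem
  (\<open>integral_prod\<close>). Exchanging two integrals is associativity of composition
  (\<open>comp_assoc_mat\<close>), and integrating a product of functions of separate variables is the
  interchange law for composition and tensor product (\<open>tensor_comp_mat\<close>).

  Biproducts come from disjoint unions, with transposed inclusions as projections. Every object is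
  its own dual, with the indicator function of the diagonal as evaluation and as coevaluation; in the
  zigzag identities the integrand is again supported at one point
  (\<open>zigzag_left\<close>, \<open>zigzag_right\<close>).
\<close>

section \<open>Open subgroups and their orbits\<close>

lemma group_actionI:
  assumes "group H"
    and ext: "\<And>g. g \<in> carrier H \<Longrightarrow> \<phi> g \<in> extensional E"
    and closed: "\<And>g x. \<lbrakk>g \<in> carrier H; x \<in> E\<rbrakk> \<Longrightarrow> \<phi> g x \<in> E"
    and one: "\<And>x. x \<in> E \<Longrightarrow> \<phi> \<one>\<^bsub>H\<^esub> x = x"
    and mult: "\<And>g h x. \<lbrakk>g \<in> carrier H; h \<in> carrier H; x \<in> E\<rbrakk> \<Longrightarrow>
      \<phi> (g \<otimes>\<^bsub>H\<^esub> h) x = \<phi> g (\<phi> h x)"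
  shows "group_action H E \<phi>"
proof -
  interpret H: group H by fact
  have bij: "\<phi> g \<in> Bij E" if g: "g \<in> carrier H" for g
  proof -
    have "\<phi> (inv\<^bsub>H\<^esub> g) (\<phi> g x) = x" "\<phi> g (\<phi> (inv\<^bsub>H\<^esub> g) x) = x" if "x \<in> E" for x
      using mult[of "inv\<^bsub>H\<^esub> g" g x] mult[of g "inv\<^bsub>H\<^esub> g" x] g that one by auto
    then have "bij_betw (\<phi> g) E E"
      using g closed by (intro bij_betw_byWitness[where f' = "\<phi> (inv\<^bsub>H\<^esub> g)"]) auto
    then show ?thesis using ext g by (simp add: Bij_def)
  qed
  have "\<phi> (g \<otimes>\<^bsub>H\<^esub> h) = compose E (\<phi> g) (\<phi> h)" if "g \<in> carrier H" "h \<in> carrier H" for g h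
  proof (rule extensionalityI)
    show "\<phi> (g \<otimes>\<^bsub>H\<^esub> h) \<in> extensional E" using ext that by simp
  qed (use mult that in \<open>auto simp: compose_def\<close>)
  then have "\<phi> \<in> hom H (BijGroup E)"
    using bij by (auto intro!: homI simp: BijGroup_def)
  then show ?thesis
    unfolding group_action_def group_hom_def group_hom_axioms_def
    using group_BijGroup \<open>group H\<close> by blast
qed

definition orb :: "'g set \<Rightarrow> ('g, 'x) gset \<Rightarrow> 'x \<Rightarrow> 'x set" where
  "orb U X x = (\<lambda>g. act X g x) ` U"

definition stable :: "'g set \<Rightarrow> ('g, 'x) gset \<Rightarrow> 'x set \<Rightarrow> bool" where
  "stable U X S \<longleftrightarrow> S \<subseteq> pts X \<and> (\<forall>g\<in>U. \<forall>x\<in>S. act X g x \<in> S)"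

definition invariant :: "'g set \<Rightarrow> ('g, 'x) gset \<Rightarrow> ('x \<Rightarrow> 'c) \<Rightarrow> bool" where
  "invariant U X \<phi> \<longleftrightarrow> (\<forall>g\<in>U. \<forall>x\<in>pts X. \<phi> (act X g x) = \<phi> x)"

lemma invariantD: "\<lbrakk>invariant U X \<phi>; g \<in> U; x \<in> pts X\<rbrakk> \<Longrightarrow> \<phi> (act X g x) = \<phi> x"
  by (simp add: invariant_def)

lemma invariant_mono: "\<lbrakk>invariant U X \<phi>; V \<subseteq> U\<rbrakk> \<Longrightarrow> invariant V X \<phi>"
  by (auto simp: invariant_def)

context pro_oligomorphic_group
begin

lemma subset_carrier: "open_subgroup G T U \<Longrightarrow> U \<subseteq> carrier G"
  by (simp add: open_subgroup_def subgroup.subset)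

lemma open_subgroup_carrier: "open_subgroup G T (carrier G)"
  using openin_topspace[of T] by (simp add: open_subgroup_def topspace_eq subgroup_self)

lemma open_subgroup_Int:
  "\<lbrakk>open_subgroup G T U; open_subgroup G T V\<rbrakk> \<Longrightarrow> open_subgroup G T (U \<inter> V)"
  by (simp add: open_subgroup_def subgroups_Inter_pair openin_Int)

lemma continuous_translate:
  assumes "a \<in> carrier G"
  shows "continuous_map T T (\<lambda>x. a \<otimes> x)" "continuous_map T T (\<lambda>x. x \<otimes> a)"
proof -
  have "continuous_map T (prod_topology T T) (\<lambda>x. (a, x))"
       "continuous_map T (prod_topology T T) (\<lambda>x. (x, a))"
    using assms by (auto simp: continuous_map_pairwise o_def topspace_eq)
  from this[THEN continuous_map_compose[OF _ continuous_mult]]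
  show "continuous_map T T (\<lambda>x. a \<otimes> x)" "continuous_map T T (\<lambda>x. x \<otimes> a)"
    by (simp_all add: o_def)
qed

text \<open>
  A subgroup that contains an open subgroup is a union of its cosets. Hence the largest group
  leaving a function invariant is open as soon as some open group leaves it invariant.
\<close>
lemma open_subgroup_superset:
  assumes U: "open_subgroup G T U" and H: "subgroup H G" and "U \<subseteq> H"
  shows "open_subgroup G T H"
proof -
  interpret H: subgroup H G by fact
  have "\<exists>W. openin T W \<and> h \<in> W \<and> W \<subseteq> H" if h: "h \<in> H" for h
  proof (intro exI conjI)
    let ?W = "{x \<in> topspace T. inv h \<otimes> x \<in> U}"
    show "openin T ?W"
      using U h by (intro openin_continuous_map_preimage[OF continuous_translate(1)])
        (auto simp: open_subgroup_def)
    show "h \<in> ?W"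
      using U h by (simp add: topspace_eq open_subgroup_def subgroup.one_closed)
    show "?W \<subseteq> H"
    proof
      fix x assume x: "x \<in> ?W"
      then have "h \<otimes> (inv h \<otimes> x) \<in> H" using h \<open>U \<subseteq> H\<close> by blast
      then show "x \<in> H" using x h by (simp add: topspace_eq m_assoc[symmetric])
    qed
  qed
  then have "openin T H" by (subst openin_subopen) blast
  then show ?thesis using H by (simp add: open_subgroup_def)
qed

text \<open>
  The conjugate is the preimage of \<open>U\<close> under the continuous map \<open>x \<mapsto> inv g \<otimes> x \<otimes> g\<close>.
\<close>
lemma conj_open_subgroup:
  assumes U: "open_subgroup G T U" and g: "g \<in> carrier G"
  shows "open_subgroup G T ((\<lambda>u. g \<otimes> u \<otimes> inv g) ` U)"
proof -
  interpret U: subgroup U G using U by (simp add: open_subgroup_def)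
  have eq: "(\<lambda>u. g \<otimes> u \<otimes> inv g) ` U = {x \<in> topspace T. inv g \<otimes> x \<otimes> g \<in> U}"
  proof (intro equalityI subsetI)
    fix x assume "x \<in> {x \<in> topspace T. inv g \<otimes> x \<otimes> g \<in> U}"
    moreover from this have "x = g \<otimes> (inv g \<otimes> x \<otimes> g) \<otimes> inv g"
      using g by (simp add: topspace_eq m_assoc) (simp add: m_assoc[symmetric])
    ultimately show "x \<in> (\<lambda>u. g \<otimes> u \<otimes> inv g) ` U" by blast
  next
    fix x assume "x \<in> (\<lambda>u. g \<otimes> u \<otimes> inv g) ` U"
    then obtain u where u: "u \<in> U" "x = g \<otimes> u \<otimes> inv g" by blast
    then have "inv g \<otimes> x \<otimes> g = u"
      using g by (simp add: m_assoc) (simp add: m_assoc[symmetric])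
    then show "x \<in> {x \<in> topspace T. inv g \<otimes> x \<otimes> g \<in> U}"
      using u g by (simp add: topspace_eq)
  qed
  have "continuous_map T T (\<lambda>x. inv g \<otimes> x \<otimes> g)"
    using continuous_map_compose[OF continuous_translate(1)[of "inv g"] continuous_translate(2)[of g]] g
    by (simp add: o_def)
  then have "openin T {x \<in> topspace T. inv g \<otimes> x \<otimes> g \<in> U}"
    using U by (intro openin_continuous_map_preimage) (auto simp: open_subgroup_def)
  moreover have "subgroup ((\<lambda>u. g \<otimes> u \<otimes> inv g) ` U) G"
  proof (rule subgroupI)
    show "(\<lambda>u. g \<otimes> u \<otimes> inv g) ` U \<subseteq> carrier G" using g by auto
    show "(\<lambda>u. g \<otimes> u \<otimes> inv g) ` U \<noteq> {}" using U.one_closed by blast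
  next
    fix a assume "a \<in> (\<lambda>u. g \<otimes> u \<otimes> inv g) ` U"
    then obtain u where u: "u \<in> U" "a = g \<otimes> u \<otimes> inv g" by blast
    then have "inv a = g \<otimes> inv u \<otimes> inv g"
      using g by (simp add: inv_mult_group m_assoc)
    then show "inv a \<in> (\<lambda>u. g \<otimes> u \<otimes> inv g) ` U" using u by blast
  next
    fix a b assume "a \<in> (\<lambda>u. g \<otimes> u \<otimes> inv g) ` U" "b \<in> (\<lambda>u. g \<otimes> u \<otimes> inv g) ` U"
    then obtain u v where u: "u \<in> U" "a = g \<otimes> u \<otimes> inv g" "v \<in> U" "b = g \<otimes> v \<otimes> inv g" by blast
    have "inv g \<otimes> (g \<otimes> (v \<otimes> inv g)) = v \<otimes> inv g"
      using g u by (simp add: m_assoc[symmetric])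
    then have "a \<otimes> b = g \<otimes> (u \<otimes> v) \<otimes> inv g"
      using u g by (simp add: m_assoc)
    then show "a \<otimes> b \<in> (\<lambda>u. g \<otimes> u \<otimes> inv g) ` U" using u by blast
  qed
  ultimately show ?thesis by (simp add: open_subgroup_def eq)
qed

section \<open>Finitary sets with an action of the whole group\<close>

context
  fixes X :: "('g, 'x) gset"
  assumes X: "X \<in> perm_obj G T"
begin

lemma grp_eq: "grp X = carrier G"
  using X by (simp add: perm_obj_def)

lemma grp_of_eq: "grp_of G X = G"
  by (simp add: grp_eq)

lemma perm_obj_action: "group_action G (pts X) (act X)"
  using X grp_of_eq by (simp add: perm_obj_def hat_set_def)

lemma act_closed: "\<lbrakk>g \<in> carrier G; x \<in> pts X\<rbrakk> \<Longrightarrow> act X g x \<in> pts X"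
  using group_action.element_image[OF perm_obj_action] by blast

lemma act_mult:
  "\<lbrakk>g \<in> carrier G; h \<in> carrier G; x \<in> pts X\<rbrakk> \<Longrightarrow> act X (g \<otimes> h) x = act X g (act X h x)"
  using group_action.composition_rule[OF perm_obj_action] by blast

lemma act_one: "x \<in> pts X \<Longrightarrow> act X \<one> x = x"
  using group_action.id_eq_one[OF perm_obj_action] by (metis restrict_apply')

lemma act_inv:
  assumes "g \<in> carrier G" "x \<in> pts X"
  shows "act X (inv g) (act X g x) = x" "act X g (act X (inv g) x) = x"
  using act_mult[of "inv g" g x] act_mult[of g "inv g" x] assms act_one by auto

lemma act_inj: "g \<in> carrier G \<Longrightarrow> inj_on (act X g) (pts X)"
  by (rule inj_on_inverseI[of _ "act X (inv g)"]) (rule act_inv)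

lemma act_eq_iff:
  "\<lbrakk>g \<in> carrier G; x \<in> pts X; y \<in> pts X\<rbrakk> \<Longrightarrow> act X g x = act X g y \<longleftrightarrow> x = y"
  by (rule inj_on_eq_iff[OF act_inj])

lemma stabilizer_open:
  assumes x: "x \<in> pts X"
  shows "open_subgroup G T {g \<in> carrier G. act X g x = x}"
proof -
  have "openin T {g \<in> carrier G. act X g x = x}"
    using X x grp_eq by (auto simp: perm_obj_def hat_set_def stabilizer_def)
  moreover have "subgroup {g \<in> carrier G. act X g x = x} G"
    using group_action.stabilizer_subgroup[OF perm_obj_action x] by (simp add: stabilizer_def)
  ultimately show ?thesis by (simp add: open_subgroup_def)
qed

lemma orb_self: "\<lbrakk>open_subgroup G T U; x \<in> pts X\<rbrakk> \<Longrightarrow> x \<in> orb U X x"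
  unfolding orb_def open_subgroup_def by (metis act_one image_eqI subgroup.one_closed)

lemma orb_subset: "\<lbrakk>open_subgroup G T U; x \<in> pts X\<rbrakk> \<Longrightarrow> orb U X x \<subseteq> pts X"
  using subset_carrier act_closed by (auto simp: orb_def)

lemma orb_act:
  assumes U: "open_subgroup G T U" and x: "x \<in> pts X" and g: "g \<in> U"
  shows "orb U X (act X g x) = orb U X x"
proof -
  interpret U: subgroup U G using U by (simp add: open_subgroup_def)
  have "act X h (act X g x) \<in> orb U X x" if "h \<in> U" for h
    using that g x by (auto simp: orb_def act_mult[symmetric])
  moreover have "act X h x \<in> orb U X (act X g x)" if "h \<in> U" for h
  proof -
    have "act X h x = act X (h \<otimes> inv g) (act X g x)"
      using that g x by (simp add: act_mult act_closed act_inv)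
    then show ?thesis using that g by (auto simp: orb_def)
  qed
  ultimately show ?thesis by (auto simp: orb_def)
qed

lemma orb_eq: "\<lbrakk>open_subgroup G T U; x \<in> pts X; y \<in> orb U X x\<rbrakk> \<Longrightarrow> orb U X y = orb U X x"
  using orb_act by (auto simp: orb_def[of _ _ x])

lemma orb_stable: "\<lbrakk>open_subgroup G T U; x \<in> pts X\<rbrakk> \<Longrightarrow> stable U X (orb U X x)"
  unfolding stable_def using orb_subset orb_eq by (metis image_eqI orb_def subsetD)

lemma orbs_disjoint:
  assumes "open_subgroup G T U"
  shows "disjoint_family_on (\<lambda>Q. Q) (orb U X ` pts X)"
proof -
  have "orb U X x = orb U X y" if "x \<in> pts X" "y \<in> pts X" "z \<in> orb U X x" "z \<in> orb U X y" for x y z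
    using orb_eq[OF assms] that by metis
  then show ?thesis by (fastforce simp: disjoint_family_on_def)
qed

lemma orbs_cover: "open_subgroup G T U \<Longrightarrow> (\<Union>Q \<in> orb U X ` pts X. Q) = pts X"
  using orb_self orb_subset by blast

lemma stable_iff:
  assumes U: "open_subgroup G T U" and S: "stable U X S" and g: "g \<in> U" and x: "x \<in> pts X"
  shows "act X g x \<in> S \<longleftrightarrow> x \<in> S"
proof
  assume "act X g x \<in> S"
  moreover have "inv g \<in> U" using U g by (simp add: open_subgroup_def subgroup.m_inv_closed)
  ultimately have "act X (inv g) (act X g x) \<in> S" using S by (auto simp: stable_def)
  then show "x \<in> S" using act_inv(1) subset_carrier[OF U] g x by auto
qed (use S g in \<open>auto simp: stable_def\<close>)

text \<open>
  This is where Roelcke precompactness enters: the \<open>U\<close>-orbits on the \<open>G\<close>-orbit of \<open>x\<close>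
  are the images of the double cosets of \<open>U\<close> and the stabilizer of \<open>x\<close>.
\<close>
lemma finite_orbs:
  assumes U: "open_subgroup G T U"
  shows "finite (orb U X ` pts X)"
proof -
  have fin: "finite (orb U X ` orb (carrier G) X x)" if x: "x \<in> pts X" for x
  proof -
    define V where "V = {g \<in> carrier G. act X g x = x}"
    have V: "open_subgroup G T V" unfolding V_def by (rule stabilizer_open[OF x])
    have "orb U X (act X g x) = (\<lambda>d. act X d x) ` ((U #> g) <#> V)" if g: "g \<in> carrier G" for g
    proof -
      have "act X (u \<otimes> g \<otimes> v) x = act X u (act X g x)" if "u \<in> U" "v \<in> V" for u v
        using that g x subset_carrier[OF U] by (auto simp: V_def act_mult act_closed)
      moreover have "(U #> g) <#> V = (\<Union>u\<in>U. \<Union>v\<in>V. {u \<otimes> g \<otimes> v})"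
        by (auto simp: r_coset_def set_mult_def)
      moreover have "\<one> \<in> V" using V by (simp add: open_subgroup_def subgroup.one_closed)
      ultimately show ?thesis by (auto simp: orb_def image_UN)
    qed
    then have "orb U X ` orb (carrier G) X x =
        (\<lambda>D. (\<lambda>d. act X d x) ` D) ` (\<lambda>g. (U #> g) <#> V) ` carrier G"
      unfolding orb_def[of "carrier G"] image_image by (intro image_cong) auto
    then show ?thesis
      using roelcke_precompact[of U V] U V by (simp add: open_subgroup_def)
  qed
  have "orbits G (pts X) (act X) = orb (carrier G) X ` pts X"
    by (auto simp: orbits_def orbit_def orb_def)
  then have "finite (orb (carrier G) X ` pts X)"
    using X grp_of_eq by (simp add: perm_obj_def finitary_def)
  then have "finite (\<Union>Q \<in> orb (carrier G) X ` pts X. orb U X ` Q)"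
    by (rule finite_UN_I) (use fin in auto)
  moreover have "orb U X ` pts X = (\<Union>Q \<in> orb (carrier G) X ` pts X. orb U X ` Q)"
    using orbs_cover[OF open_subgroup_carrier] by blast
  ultimately show ?thesis by simp
qed

end

lemma perm_objI:
  assumes grp: "grp X = carrier G"
    and ext: "\<And>g. g \<in> carrier G \<Longrightarrow> act X g \<in> extensional (pts X)"
    and closed: "\<And>g x. \<lbrakk>g \<in> carrier G; x \<in> pts X\<rbrakk> \<Longrightarrow> act X g x \<in> pts X"
    and one: "\<And>x. x \<in> pts X \<Longrightarrow> act X \<one> x = x"
    and mult: "\<And>g h x. \<lbrakk>g \<in> carrier G; h \<in> carrier G; x \<in> pts X\<rbrakk> \<Longrightarrow>
      act X (g \<otimes> h) x = act X g (act X h x)"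
    and stab: "\<And>x. x \<in> pts X \<Longrightarrow> openin T {g \<in> carrier G. act X g x = x}"
    and fin: "finite (orb (carrier G) X ` pts X)"
  shows "X \<in> perm_obj G T"
proof -
  have "group_action G (pts X) (act X)"
    by (rule group_actionI) (use ext closed one mult is_group in auto)
  moreover have "orbits G (pts X) (act X) = orb (carrier G) X ` pts X"
    by (auto simp: orbits_def orbit_def orb_def)
  ultimately show ?thesis
    using grp stab fin open_subgroup_carrier
    by (simp add: perm_obj_def hat_set_def finitary_def stabilizer_def)
qed

lemma subset_gset_hat_set:
  assumes X: "X \<in> perm_obj G T" and U: "open_subgroup G T U" and S: "stable U X S"
  shows "hat_set G T (subset_gset X S U)" and "finitary G (subset_gset X S U)"
proof -
  interpret U: subgroup U G using U by (simp add: open_subgroup_def)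
  have sub: "S \<subseteq> pts X" and cl: "\<And>g x. g \<in> U \<Longrightarrow> x \<in> S \<Longrightarrow> act X g x \<in> S"
    using S by (auto simp: stable_def)
  have "group_action (G\<lparr>carrier := U\<rparr>) S (\<lambda>g. restrict (act X g) S)"
    by (rule group_actionI)
      (use cl sub in \<open>auto simp: U.subgroup_is_group[OF is_group] act_one[OF X] act_mult[OF X]\<close>)
  moreover have "openin T (stabilizer (G\<lparr>carrier := U\<rparr>) (\<lambda>g. restrict (act X g) S) x)"
    if x: "x \<in> S" for x
  proof -
    have "stabilizer (G\<lparr>carrier := U\<rparr>) (\<lambda>g. restrict (act X g) S) x =
        U \<inter> {g \<in> carrier G. act X g x = x}"
      using x by (auto simp: stabilizer_def)
    then show ?thesis
      using open_subgroup_Int[OF U stabilizer_open[OF X, of x]] x sub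
      by (auto simp: open_subgroup_def)
  qed
  ultimately show "hat_set G T (subset_gset X S U)"
    using U by (simp add: hat_set_def subset_gset_def)
  have "orbits (G\<lparr>carrier := U\<rparr>) S (\<lambda>g. restrict (act X g) S) \<subseteq> orb U X ` pts X"
    using sub by (force simp: orbits_def orbit_def orb_def)
  then show "finitary G (subset_gset X S U)"
    using finite_subset[OF _ finite_orbs[OF X U]] by (simp add: finitary_def subset_gset_def)
qed

end

section \<open>The volume of a stable subset\<close>

locale measured_group = pro_oligomorphic_group G T + group_measure G T \<mu>
  for G :: "'g monoid" (structure) and T
    and \<mu> :: "('g, ('g, 'a) univ) gset \<Rightarrow> 'k::{comm_ring, comm_monoid_mult}"
begin

text \<open>
  The measure of \<open>S\<close>, with the largest possible group of definition. Any other open group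
  stabilizing \<open>S\<close> gives the same value (\<open>mu_eq_vol\<close>), so that groups of definition need not be
  tracked any further.
\<close>
definition vol :: "('g, ('g, 'a) univ) gset \<Rightarrow> ('g, 'a) univ set \<Rightarrow> 'k" where
  "vol X S = \<mu> (subset_gset X S (invariance_group X (\<lambda>x. x \<in> S)))"

lemma subgroup_invariance:
  assumes X: "X \<in> perm_obj G T"
  shows "subgroup (invariance_group X \<phi>) G"
proof (rule subgroupI)
  show "invariance_group X \<phi> \<subseteq> carrier G"
    by (auto simp: invariance_group_def grp_eq[OF X])
  have "\<one> \<in> invariance_group X \<phi>"
    by (auto simp: invariance_group_def grp_eq[OF X] act_one[OF X])
  then show "invariance_group X \<phi> \<noteq> {}" by blast
next
  fix a assume a: "a \<in> invariance_group X \<phi>"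
  then have ac: "a \<in> carrier G" by (auto simp: invariance_group_def grp_eq[OF X])
  have "\<phi> (act X (inv a) x) = \<phi> x" if x: "x \<in> pts X" for x
  proof -
    have "\<phi> (act X a (act X (inv a) x)) = \<phi> (act X (inv a) x)"
      using a ac x act_closed[OF X] by (auto simp: invariance_group_def)
    then show ?thesis using ac x act_inv[OF X] by simp
  qed
  then show "inv a \<in> invariance_group X \<phi>"
    using ac by (auto simp: invariance_group_def grp_eq[OF X])
next
  fix a b assume "a \<in> invariance_group X \<phi>" "b \<in> invariance_group X \<phi>"
  then show "a \<otimes> b \<in> invariance_group X \<phi>"
    by (auto simp: invariance_group_def grp_eq[OF X] act_mult[OF X] act_closed[OF X])
qed

lemma invariance_group_open:
  assumes X: "X \<in> perm_obj G T" and U: "open_subgroup G T U" and inv: "invariant U X \<phi>"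
  shows "open_subgroup G T (invariance_group X \<phi>)" and "U \<subseteq> invariance_group X \<phi>"
proof -
  show "U \<subseteq> invariance_group X \<phi>"
    using inv subset_carrier[OF U] by (auto simp: invariance_group_def invariant_def grp_eq[OF X])
  then show "open_subgroup G T (invariance_group X \<phi>)"
    using open_subgroup_superset[OF U subgroup_invariance[OF X]] by blast
qed

text \<open>
  Isomorphism invariance, in the form in which it is used: the two groups of definition may differ,
  and the bijection is only equivariant for a smaller group \<open>W\<close>.
\<close>
lemma mu_transport:
  assumes X: "X \<in> perm_obj G T" and Y: "Y \<in> perm_obj G T"
    and U: "open_subgroup G T U" "stable U X S" and V: "open_subgroup G T V" "stable V Y R"
    and W: "open_subgroup G T W" "W \<subseteq> U \<inter> V"
    and j: "bij_betw j S R" "\<And>g x. \<lbrakk>g \<in> W; x \<in> S\<rbrakk> \<Longrightarrow> j (act X g x) = act Y g (j x)"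
  shows "\<mu> (subset_gset X S U) = \<mu> (subset_gset Y R V)"
proof (rule iso)
  have "equivariant_on W (subset_gset X S U) (subset_gset Y R V) j"
    using j W(2) U(2) bij_betwE[OF j(1)] by (auto simp: equivariant_on_def subset_gset_def stable_def)
  then show "hat_iso G T (subset_gset X S U) (subset_gset Y R V)"
    using W j(1) unfolding hat_iso_def hat_map_def by (auto simp: subset_gset_def)
qed (use assms subset_gset_hat_set in auto)

lemma mu_eq_vol:
  assumes X: "X \<in> perm_obj G T" and U: "open_subgroup G T U" and S: "stable U X S"
  shows "\<mu> (subset_gset X S U) = vol X S"
proof -
  let ?V = "invariance_group X (\<lambda>x. x \<in> S)"
  have "invariant U X (\<lambda>x. x \<in> S)"
    using stable_iff[OF X U S] by (simp add: invariant_def)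
  note V = invariance_group_open[OF X U this]
  have "S \<subseteq> pts X" using S by (simp add: stable_def)
  then have "stable ?V X S"
    by (auto simp: stable_def invariance_group_def)
  then show ?thesis
    unfolding vol_def using V U by (intro mu_transport[OF X X U S V(1) _ U, where j = id])
      (auto simp: bij_betw_def)
qed

lemma vol_transport:
  assumes X: "X \<in> perm_obj G T" and Y: "Y \<in> perm_obj G T"
    and U: "open_subgroup G T U" "stable U X S"
    and j: "inj_on j S" "j ` S \<subseteq> pts Y" "\<And>g x. \<lbrakk>g \<in> U; x \<in> S\<rbrakk> \<Longrightarrow> j (act X g x) = act Y g (j x)"
  shows "stable U Y (j ` S)" and "vol Y (j ` S) = vol X S"
proof -
  show st: "stable U Y (j ` S)"
    unfolding stable_def using j U(2) by (auto simp: stable_def j(3)[symmetric])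
  have "\<mu> (subset_gset X S U) = \<mu> (subset_gset Y (j ` S) U)"
    by (rule mu_transport[OF X Y U U(1) st U(1)]) (use j in \<open>auto simp: bij_betw_def\<close>)
  then show "vol Y (j ` S) = vol X S"
    using mu_eq_vol[OF X U] mu_eq_vol[OF Y U(1) st] by simp
qed

text \<open>
  The axiom \<open>additive\<close> speaks of the formal disjoint union, whose points are tagged copies;
  removing the tags identifies it with the union inside \<open>X\<close>.
\<close>
lemma vol_Un:
  assumes X: "X \<in> perm_obj G T" and U: "open_subgroup G T U"
    and S: "stable U X S" and R: "stable U X R" and disj: "S \<inter> R = {}"
  shows "vol X (S \<union> R) = vol X S + vol X R"
proof -
  let ?S = "subset_gset X S U" and ?R = "subset_gset X R U" and ?SR = "subset_gset X (S \<union> R) U"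
  note hS = subset_gset_hat_set[OF X U S] and hR = subset_gset_hat_set[OF X U R]
  have SR: "stable U X (S \<union> R)" using S R by (auto simp: stable_def)
  note hSR = subset_gset_hat_set[OF X U SR]
  interpret U: subgroup U G using U by (simp add: open_subgroup_def)
  have cl: "act X g x \<in> S" if "g \<in> U" "x \<in> S" for g x
    using that S by (auto simp: stable_def)
  have cl': "act X g x \<in> R" if "g \<in> U" "x \<in> R" for g x
    using that R by (auto simp: stable_def)
  have sub: "x \<in> pts X" if "x \<in> S \<or> x \<in> R" for x
    using that S R by (auto simp: stable_def)
  define j where "j = (\<lambda>p :: ('g, 'a) univ. case p of InL x \<Rightarrow> x | InR x \<Rightarrow> x | _ \<Rightarrow> p)"
  have act: "group_action (G\<lparr>carrier := U\<rparr>) (pts (sum_gset ?S ?R)) (act (sum_gset ?S ?R))"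
    by (rule group_actionI)
      (auto simp: U.subgroup_is_group[OF is_group] sum_gset_def subset_gset_def cl cl' sub
        act_one[OF X] act_mult[OF X] split: point.splits)
  have stab: "openin T (stabilizer (G\<lparr>carrier := U\<rparr>) (act (sum_gset ?S ?R)) p)"
    if p: "p \<in> pts (sum_gset ?S ?R)" for p
  proof -
    have "j p \<in> pts X" using p sub
      by (auto simp: sum_gset_def subset_gset_def j_def)
    then have "openin T (U \<inter> {g \<in> carrier G. act X g (j p) = j p})"
      using open_subgroup_Int[OF U stabilizer_open[OF X]] by (simp add: open_subgroup_def)
    also have "U \<inter> {g \<in> carrier G. act X g (j p) = j p} =
        stabilizer (G\<lparr>carrier := U\<rparr>) (act (sum_gset ?S ?R)) p"
      using p by (auto simp: stabilizer_def sum_gset_def subset_gset_def j_def)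
    finally show ?thesis .
  qed
  have fin: "finitary G (sum_gset ?S ?R)"
  proof -
    have "orbits (G\<lparr>carrier := U\<rparr>) (pts (sum_gset ?S ?R)) (act (sum_gset ?S ?R))
      \<subseteq> (\<lambda>Q. InL ` Q) ` orb U X ` pts X \<union> (\<lambda>Q. InR ` Q) ` orb U X ` pts X"
    proof
      fix O' assume "O' \<in> orbits (G\<lparr>carrier := U\<rparr>) (pts (sum_gset ?S ?R)) (act (sum_gset ?S ?R))"
      then consider x where "x \<in> S" "O' = InL ` orb U X x" | x where "x \<in> R" "O' = InR ` orb U X x"
        by (force simp: orbits_def orbit_def sum_gset_def subset_gset_def orb_def)
      then show "O' \<in> (\<lambda>Q. InL ` Q) ` orb U X ` pts X \<union> (\<lambda>Q. InR ` Q) ` orb U X ` pts X"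
        using S R by cases (auto simp: stable_def)
    qed
    from finite_subset[OF this] show ?thesis
      using finite_orbs[OF X U] by (simp add: finitary_def sum_gset_def subset_gset_def)
  qed
  have hat: "hat_set G T (sum_gset ?S ?R)"
    using act stab U by (simp add: hat_set_def) (simp add: sum_gset_def subset_gset_def)
  have "hat_iso G T (sum_gset ?S ?R) ?SR"
    unfolding hat_iso_def hat_map_def
  proof (intro exI conjI)
    show "open_subgroup G T U" by (rule U)
    show "U \<subseteq> grp (sum_gset ?S ?R) \<inter> grp ?SR" by (simp add: sum_gset_def subset_gset_def)
    show "equivariant_on U (sum_gset ?S ?R) ?SR j"
      by (auto simp: equivariant_on_def sum_gset_def subset_gset_def j_def)
    show "bij_betw j (pts (sum_gset ?S ?R)) (pts ?SR)"
      using disj by (auto simp: bij_betw_def inj_on_def sum_gset_def subset_gset_def j_def image_Un image_image)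
  qed
  then have "\<mu> ?SR = \<mu> ?S + \<mu> ?R"
    using iso[OF hat fin hSR] additive[OF hS hR] by simp
  then show ?thesis
    using mu_eq_vol[OF X U] S R SR by simp
qed

text \<open>
  The empty set is the disjoint union of two empty sets, so its volume equals twice itself.
\<close>
lemma vol_empty:
  assumes X: "X \<in> perm_obj G T"
  shows "vol X {} = 0"
  using vol_Un[OF X open_subgroup_carrier, of "{}" "{}"] by (simp add: stable_def)

lemma vol_UN:
  assumes X: "X \<in> perm_obj G T" and U: "open_subgroup G T U"
    and "finite I" and S: "\<And>i. i \<in> I \<Longrightarrow> stable U X (S i)" and disj: "disjoint_family_on S I"
  shows "vol X (\<Union>i\<in>I. S i) = (\<Sum>i\<in>I. vol X (S i))"
  using \<open>finite I\<close> S disj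
proof (induction I rule: finite_induct)
  case empty
  then show ?case using vol_empty[OF X] by simp
next
  case (insert i I)
  have "vol X (S i \<union> (\<Union>i\<in>I. S i)) = vol X (S i) + vol X (\<Union>i\<in>I. S i)"
  proof (rule vol_Un[OF X U])
    show "stable U X (\<Union>i\<in>I. S i)" using insert.prems(1) by (fastforce simp: stable_def)
    show "S i \<inter> (\<Union>i\<in>I. S i) = {}"
      using insert.prems(2) insert.hyps(2) by (fastforce simp: disjoint_family_on_def)
  qed (use insert.prems(1) in simp)
  then show ?case
    using insert by (simp add: disjoint_family_on_mono[OF subset_insertI])
qed

lemma vol_singleton:
  assumes X: "X \<in> perm_obj G T" and x: "x \<in> pts X"
  shows "vol X {x} = 1"
proof -
  let ?U = "{g \<in> carrier G. act X g x = x}"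
  have "stable ?U X {x}" using x by (auto simp: stable_def)
  note * = stabilizer_open[OF X x] this
  show ?thesis
    using mu_eq_vol[OF X *] one_point[OF subset_gset_hat_set(1)[OF X *], of x]
    by (simp add: subset_gset_def)
qed

text \<open>
  The translate \<open>g S\<close> is stable under the conjugate of \<open>U\<close>, and acting by \<open>g\<close> is an
  isomorphism onto it from the conjugate of the \<open>U\<close>-set \<open>S\<close>, to which \<open>conjugate\<close> applies.
\<close>
lemma vol_translate:
  assumes X: "X \<in> perm_obj G T" and U: "open_subgroup G T U" and S: "stable U X S"
    and g: "g \<in> carrier G"
  shows "stable ((\<lambda>u. g \<otimes> u \<otimes> inv g) ` U) X (act X g ` S)"
    and "vol X (act X g ` S) = vol X S"
proof -
  let ?V = "(\<lambda>u. g \<otimes> u \<otimes> inv g) ` U" and ?S = "subset_gset X S U"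
  interpret U: subgroup U G using U by (simp add: open_subgroup_def)
  have V: "open_subgroup G T ?V" by (rule conj_open_subgroup[OF U g])
  interpret V: subgroup ?V G using V by (simp add: open_subgroup_def)
  have sub: "S \<subseteq> pts X" and cl: "\<And>g x. g \<in> U \<Longrightarrow> x \<in> S \<Longrightarrow> act X g x \<in> S"
    using S by (auto simp: stable_def)
  have uu: "inv g \<otimes> (g \<otimes> u \<otimes> inv g) \<otimes> g = u" if "u \<in> U" for u
    using that g by (simp add: m_assoc) (simp add: m_assoc[symmetric])
  have move: "act X (g \<otimes> u \<otimes> inv g) (act X g x) = act X g (act X u x)"
    if "u \<in> U" "x \<in> S" for u x
    using that g sub by (simp add: act_mult[OF X] act_closed[OF X] act_inv[OF X] subset_iff)
  show st: "stable ?V X (act X g ` S)"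
    unfolding stable_def using sub cl move act_closed[OF X g] by auto
  have unconj: "inv g \<otimes> v \<otimes> g \<in> U" if "v \<in> ?V" for v using that uu by auto
  have act: "group_action (G\<lparr>carrier := ?V\<rparr>) (pts (conj_gset G g ?S)) (act (conj_gset G g ?S))"
  proof (rule group_actionI)
    fix v w x assume "v \<in> carrier (G\<lparr>carrier := ?V\<rparr>)" "w \<in> carrier (G\<lparr>carrier := ?V\<rparr>)"
      "x \<in> pts (conj_gset G g ?S)"
    then have vw: "v \<in> ?V" "w \<in> ?V" and x: "x \<in> S" by (simp_all add: conj_gset_def subset_gset_def)
    have "g \<otimes> (inv g \<otimes> (w \<otimes> g)) = w \<otimes> g"
      using g V.mem_carrier[OF vw(2)] by (simp add: m_assoc[symmetric])
    then have "inv g \<otimes> (v \<otimes> w) \<otimes> g = (inv g \<otimes> v \<otimes> g) \<otimes> (inv g \<otimes> w \<otimes> g)"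
      using g V.mem_carrier[OF vw(1)] V.mem_carrier[OF vw(2)] by (simp add: m_assoc)
    then show "act (conj_gset G g ?S) (v \<otimes>\<^bsub>G\<lparr>carrier := ?V\<rparr>\<^esub> w) x =
        act (conj_gset G g ?S) v (act (conj_gset G g ?S) w x)"
      using x vw unconj cl sub by (simp add: conj_gset_def subset_gset_def act_mult[OF X] subset_iff)
  qed (use unconj cl sub V.subgroup_is_group[OF is_group] g in
      \<open>auto simp: conj_gset_def subset_gset_def act_one[OF X] subset_iff\<close>)
  have stab: "openin T (stabilizer (G\<lparr>carrier := ?V\<rparr>) (act (conj_gset G g ?S)) x)"
    if x: "x \<in> S" for x
  proof -
    have "stabilizer (G\<lparr>carrier := ?V\<rparr>) (act (conj_gset G g ?S)) x =
        ?V \<inter> {h \<in> carrier G. act X h (act X g x) = act X g x}"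
    proof -
      have "act X u x = x \<longleftrightarrow> act X g (act X u x) = act X g x" if "u \<in> U" for u
        using act_inj[OF X g] cl[OF that x] x sub by (auto simp: inj_on_def)
      then show ?thesis
        using x sub g uu move by (auto simp: stabilizer_def conj_gset_def subset_gset_def)
    qed
    moreover have "act X g x \<in> pts X" using x sub act_closed[OF X g] by blast
    ultimately show ?thesis
      using open_subgroup_Int[OF V stabilizer_open[OF X]] by (simp add: open_subgroup_def)
  qed
  have hat: "hat_set G T (conj_gset G g ?S)"
    using act stab V by (simp add: hat_set_def) (simp add: conj_gset_def subset_gset_def)
  have fin: "finitary G (conj_gset G g ?S)"
  proof -
    have "orbit (G\<lparr>carrier := ?V\<rparr>) (act (conj_gset G g ?S)) x = orb U X x" if "x \<in> S" for x
    proof -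
      have "orbit (G\<lparr>carrier := ?V\<rparr>) (act (conj_gset G g ?S)) x
          = (\<lambda>v. act (conj_gset G g ?S) v x) ` ?V" by (auto simp: orbit_def)
      also have "\<dots> = orb U X x"
        unfolding image_image orb_def using uu that
        by (intro image_cong) (simp_all add: conj_gset_def subset_gset_def)
      finally show ?thesis .
    qed
    then have "orbits (G\<lparr>carrier := ?V\<rparr>) S (act (conj_gset G g ?S)) \<subseteq> orb U X ` pts X"
      using sub by (auto simp: orbits_def)
    from finite_subset[OF this finite_orbs[OF X U]] show ?thesis
      unfolding finitary_def by (simp add: conj_gset_def subset_gset_def)
  qed
  have "hat_iso G T (conj_gset G g ?S) (subset_gset X (act X g ` S) ?V)"
    unfolding hat_iso_def hat_map_def
  proof (intro exI conjI)
    show "open_subgroup G T ?V" by (rule V)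
    show "?V \<subseteq> grp (conj_gset G g ?S) \<inter> grp (subset_gset X (act X g ` S) ?V)"
      by (simp add: conj_gset_def subset_gset_def)
    show "equivariant_on ?V (conj_gset G g ?S) (subset_gset X (act X g ` S) ?V) (act X g)"
      using uu move by (auto simp: equivariant_on_def conj_gset_def subset_gset_def)
    show "bij_betw (act X g) (pts (conj_gset G g ?S)) (pts (subset_gset X (act X g ` S) ?V))"
      using inj_on_subset[OF act_inj[OF X g] sub]
      by (simp add: bij_betw_def conj_gset_def subset_gset_def)
  qed
  then have "\<mu> (conj_gset G g ?S) = \<mu> (subset_gset X (act X g ` S) ?V)"
    using iso[OF hat fin subset_gset_hat_set[OF X V st]] by blast
  then show "vol X (act X g ` S) = vol X S"
    using conjugate[OF subset_gset_hat_set[OF X U S] g] mu_eq_vol[OF X U S] mu_eq_vol[OF X V st]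
    by simp
qed

text \<open>
  The axiom \<open>fibration\<close> for \<open>f: Q \<rightarrow> f(Q)\<close>, a map of transitive \<open>U\<close>-sets.
\<close>
lemma vol_fibration:
  assumes Z: "Z \<in> perm_obj G T" and X: "X \<in> perm_obj G T"
    and f: "equivariant_on (carrier G) Z X f"
    and U: "open_subgroup G T U" and z: "z \<in> pts Z"
  defines "Q \<equiv> orb U Z z"
  assumes x: "x \<in> f ` Q"
  shows "vol Z Q = vol Z {q \<in> Q. f q = x} * vol X (f ` Q)"
proof -
  interpret U: subgroup U G using U by (simp add: open_subgroup_def)
  have fcl: "f p \<in> pts X" if "p \<in> pts Z" for p
    using f that by (auto simp: equivariant_on_def)
  have fact: "f (act Z g p) = act X g (f p)" if "g \<in> U" "p \<in> pts Z" for g p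
    using f that U.subset by (auto simp: equivariant_on_def)
  have Q: "stable U Z Q" unfolding Q_def by (rule orb_stable[OF Z U z])
  have fQ: "f ` Q = orb U X (f z)"
    unfolding Q_def orb_def image_image using fact z by simp
  have st: "stable U X (f ` Q)" unfolding fQ by (rule orb_stable[OF X U fcl[OF z]])
  let ?Z = "subset_gset Z Q U" and ?X = "subset_gset X (f ` Q) U"
  have trans: "transitive G (subset_gset Y (orb U Y y) U)" if Y: "Y \<in> perm_obj G T" and y: "y \<in> pts Y"
    for Y :: "('g, ('g, 'a) univ) gset" and y
  proof -
    have "stable U Y (orb U Y y)" by (rule orb_stable[OF Y U y])
    from subset_gset_hat_set(1)[OF Y U this]
    have "group_action (G\<lparr>carrier := U\<rparr>) (orb U Y y) (\<lambda>g. restrict (act Y g) (orb U Y y))"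
      by (simp add: hat_set_def subset_gset_def)
    moreover have "\<exists>g\<in>U. act Y g p = q" if pq: "p \<in> orb U Y y" "q \<in> orb U Y y" for p q
    proof -
      have "q \<in> orb U Y p" using orb_eq[OF Y U y pq(1)] pq(2) by simp
      then show ?thesis by (auto simp: orb_def)
    qed
    ultimately show ?thesis
      using orb_self[OF Y U y]
      by (auto simp: transitive_def transitive_action_def transitive_action_axioms_def subset_gset_def)
  qed
  have sub: "Q \<subseteq> pts Z" "f ` Q \<subseteq> pts X" using Q st by (auto simp: stable_def)
  have "equivariant_on U ?Z ?X f"
    using fact sub by (auto simp: equivariant_on_def subset_gset_def)
  then have "\<mu> ?Z = \<mu> (fiber_gset G ?Z ?X f x) * \<mu> ?X"
    using U x trans[OF Z z] trans[OF X fcl[OF z]] subset_gset_hat_set(1)[OF Z U Q]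
      subset_gset_hat_set(1)[OF X U st]
    by (intro fibration) (simp_all add: Q_def[symmetric] fQ[symmetric], simp_all add: subset_gset_def)
  moreover have "\<mu> (fiber_gset G ?Z ?X f x) = vol Z {q \<in> Q. f q = x}"
  proof -
    let ?W = "U \<inter> {g \<in> carrier G. act X g x = x}"
    have "fiber_gset G ?Z ?X f x = subset_gset Z {q \<in> Q. f q = x} ?W"
      using x by (auto simp: fiber_gset_def subset_gset_def stabilizer_def fun_eq_iff restrict_def)
    moreover have "open_subgroup G T ?W"
      using open_subgroup_Int[OF U stabilizer_open[OF X]] x sub by blast
    moreover have "stable ?W Z {q \<in> Q. f q = x}"
      using Q fact by (auto simp: stable_def)
    ultimately show ?thesis using mu_eq_vol[OF Z] by simp
  qed
  ultimately show ?thesis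
    using mu_eq_vol[OF Z U Q] mu_eq_vol[OF X U st] by simp
qed

section \<open>Integration\<close>

definition smooth :: "('g, 'x) gset \<Rightarrow> ('x \<Rightarrow> 'c) \<Rightarrow> bool" where
  "smooth X \<phi> \<longleftrightarrow> (\<exists>U. open_subgroup G T U \<and> invariant U X \<phi>)"

lemma smoothI: "\<lbrakk>open_subgroup G T U; invariant U X \<phi>\<rbrakk> \<Longrightarrow> smooth X \<phi>"
  by (auto simp: smooth_def)

lemma smooth_common:
  assumes "smooth X \<phi>" "smooth Y \<psi>"
  obtains U where "open_subgroup G T U" "invariant U X \<phi>" "invariant U Y \<psi>"
proof -
  obtain U V where "open_subgroup G T U" "invariant U X \<phi>" "open_subgroup G T V" "invariant V Y \<psi>"
    using assms by (auto simp: smooth_def)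
  then show thesis
    using that[of "U \<inter> V"] open_subgroup_Int invariant_mono[of U X \<phi> "U \<inter> V"]
      invariant_mono[of V Y \<psi> "U \<inter> V"] by simp
qed

lemma integral_cong:
  assumes X: "X \<in> perm_obj G T" and eq: "\<And>x. x \<in> pts X \<Longrightarrow> \<phi> x = \<psi> x"
  shows "integral \<mu> X \<phi> = integral \<mu> X \<psi>"
proof -
  have "\<phi> ` pts X = \<psi> ` pts X" using eq by (rule image_cong[OF refl])
  moreover have "{x \<in> pts X. \<phi> x = c} = {x \<in> pts X. \<psi> x = c}" for c using eq by auto
  moreover have "invariance_group X \<phi> = invariance_group X \<psi>"
    using eq act_closed[OF X] by (auto simp: invariance_group_def grp_eq[OF X])
  ultimately show ?thesis by (simp add: integral_def)
qed

text \<open>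
  The definition of the integral uses the coarsest partition of the support, that into level sets.
  By additivity of the volume every finer partition into stable sets yields the same sum; parts that
  happen to be empty contribute nothing, whatever value is attached to them.
\<close>
lemma integral_partition:
  assumes X: "X \<in> perm_obj G T" and U: "open_subgroup G T U" and I: "finite I"
    and S: "\<And>i. i \<in> I \<Longrightarrow> stable U X (S i)" and disj: "disjoint_family_on S I"
    and val: "\<And>i x. \<lbrakk>i \<in> I; x \<in> S i\<rbrakk> \<Longrightarrow> \<phi> x = c i"
    and off: "\<And>x. \<lbrakk>x \<in> pts X; \<And>i. i \<in> I \<Longrightarrow> x \<notin> S i\<rbrakk> \<Longrightarrow> \<phi> x = 0"
  shows "integral \<mu> X \<phi> = (\<Sum>i\<in>I. c i * vol X (S i))"
proof -
  \<comment> \<open>the parts on which a nonzero value is attained\<close>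
  define J where "J = {i \<in> I. S i \<noteq> {} \<and> c i \<noteq> 0}"
  have J: "finite J" "J \<subseteq> I" using I by (auto simp: J_def)
  have sub: "S i \<subseteq> pts X" if "i \<in> I" for i using S[OF that] by (simp add: stable_def)
  have img: "\<phi> ` pts X - {0} = c ` J"
  proof (intro equalityI subsetI)
    fix v assume "v \<in> \<phi> ` pts X - {0}"
    then obtain x where x: "x \<in> pts X" "\<phi> x = v" "v \<noteq> 0" by blast
    then obtain i where "i \<in> I" "x \<in> S i" using off by blast
    moreover from this have "c i = v" using val x(2) by simp
    ultimately have "i \<in> J" using x(3) by (auto simp: J_def)
    then show "v \<in> c ` J" using \<open>c i = v\<close> by blast
  next
    fix v assume "v \<in> c ` J"
    then obtain i x where i: "i \<in> I" "x \<in> S i" "v = c i" "v \<noteq> 0" by (auto simp: J_def)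
    then have "\<phi> x = v" "x \<in> pts X" using val sub by auto
    then show "v \<in> \<phi> ` pts X - {0}" using i(4) by blast
  qed
  have level: "\<mu> (subset_gset X {x \<in> pts X. \<phi> x = v} (invariance_group X \<phi>)) =
      (\<Sum>i | i \<in> J \<and> c i = v. vol X (S i))" if v: "v \<noteq> 0" for v
  proof -
    have "invariant U X \<phi>"
      unfolding invariant_def
    proof (intro ballI)
      fix g x assume g: "g \<in> U" and x: "x \<in> pts X"
      show "\<phi> (act X g x) = \<phi> x"
      proof (cases "\<exists>i\<in>I. x \<in> S i")
        case True
        then obtain i where i: "i \<in> I" "x \<in> S i" by blast
        then have "act X g x \<in> S i" using S[OF i(1)] g by (simp add: stable_def)
        then show ?thesis using val i by simp
      next
        case False
        then have "act X g x \<notin> S i" if "i \<in> I" for i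
          using stable_iff[OF X U S[OF that] g x] that by blast
        moreover have "act X g x \<in> pts X" using act_closed[OF X _ x] subset_carrier[OF U] g by blast
        ultimately have "\<phi> (act X g x) = 0" using off by blast
        then show ?thesis using off[OF x] False by simp
      qed
    qed
    note V = invariance_group_open[OF X U this]
    have "stable (invariance_group X \<phi>) X {x \<in> pts X. \<phi> x = v}"
      using act_closed[OF X] by (auto simp: stable_def invariance_group_def grp_eq[OF X])
    then have "\<mu> (subset_gset X {x \<in> pts X. \<phi> x = v} (invariance_group X \<phi>)) =
        vol X {x \<in> pts X. \<phi> x = v}"
      using mu_eq_vol[OF X V(1)] by simp
    moreover have "{x \<in> pts X. \<phi> x = v} = (\<Union>i\<in>{i \<in> J. c i = v}. S i)"
    proof (intro equalityI subsetI)
      fix x assume x: "x \<in> {x \<in> pts X. \<phi> x = v}"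
      then obtain i where i: "i \<in> I" "x \<in> S i" using off v by blast
      then show "x \<in> (\<Union>i\<in>{i \<in> J. c i = v}. S i)" using x v val[OF i] by (auto simp: J_def)
    next
      fix x assume "x \<in> (\<Union>i\<in>{i \<in> J. c i = v}. S i)"
      then obtain i where i: "i \<in> I" "x \<in> S i" "c i = v" by (auto simp: J_def)
      then show "x \<in> {x \<in> pts X. \<phi> x = v}" using val sub by auto
    qed
    moreover have "vol X (\<Union>i\<in>{i \<in> J. c i = v}. S i) = (\<Sum>i | i \<in> J \<and> c i = v. vol X (S i))"
      using J S disjoint_family_on_mono[OF _ disj, of "{i \<in> J. c i = v}"]
      by (intro vol_UN[OF X U]) auto
    ultimately show ?thesis by simp
  qed
  have "integral \<mu> X \<phi> = (\<Sum>v\<in>c ` J. v * (\<Sum>i | i \<in> J \<and> c i = v. vol X (S i)))"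
    unfolding integral_def img
  proof (rule sum.cong[OF refl])
    fix v assume "v \<in> c ` J"
    then have "v \<noteq> 0" using img by blast
    then show "v * \<mu> (subset_gset X {x \<in> pts X. \<phi> x = v} (invariance_group X \<phi>)) =
        v * (\<Sum>i | i \<in> J \<and> c i = v. vol X (S i))" by (simp add: level)
  qed
  also have "\<dots> = (\<Sum>v\<in>c ` J. \<Sum>i | i \<in> J \<and> c i = v. c i * vol X (S i))"
    by (auto simp: sum_distrib_left intro!: sum.cong)
  also have "\<dots> = (\<Sum>i\<in>J. c i * vol X (S i))"
    using J by (intro sum.group) auto
  also have "\<dots> = (\<Sum>i\<in>I. c i * vol X (S i))"
    using I J vol_empty[OF X] by (intro sum.mono_neutral_left) (auto simp: J_def)
  finally show ?thesis .
qed

definition pick :: "'x set \<Rightarrow> 'x" where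
  "pick Q = (SOME x. x \<in> Q)"

lemma pick_in: "x \<in> Q \<Longrightarrow> pick Q \<in> Q"
  unfolding pick_def by (rule someI)

lemma pick_orb:
  assumes X: "X \<in> perm_obj G T" and U: "open_subgroup G T U" and Q: "Q \<in> orb U X ` pts X"
  shows "pick Q \<in> Q" and "pick Q \<in> pts X" and "Q = orb U X (pick Q)"
proof -
  obtain x where x: "x \<in> pts X" "Q = orb U X x" using Q by blast
  show p: "pick Q \<in> Q" using pick_in[of x Q] orb_self[OF X U x(1)] x(2) by simp
  show "pick Q \<in> pts X" using p x orb_subset[OF X U] by blast
  have "pick Q \<in> orb U X x" using p x(2) by simp
  from x(2) orb_eq[OF X U x(1) this, symmetric] show "Q = orb U X (pick Q)" by (rule trans)
qed

lemma orb_pick: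
  assumes X: "X \<in> perm_obj G T" and U: "open_subgroup G T U" and x: "x \<in> pts X"
  shows "x \<in> orb U X (pick (orb U X x))"
  using orb_self[OF X U x] by (rule subst[OF pick_orb(3)[OF X U imageI[OF x]], of "\<lambda>Q. x \<in> Q"])

lemma orbs_disjointD:
  assumes "X \<in> perm_obj G T" "open_subgroup G T U"
    and "Q \<in> orb U X ` pts X" "R \<in> orb U X ` pts X" "Q \<noteq> R"
  shows "Q \<inter> R = {}"
  using disjoint_family_onD[OF orbs_disjoint[OF assms(1,2)] assms(3-5)] .

lemma invariant_orb:
  assumes X: "X \<in> perm_obj G T" and U: "open_subgroup G T U" and inv: "invariant U X \<phi>"
    and Q: "Q \<in> orb U X ` pts X" and x: "x \<in> Q"
  shows "\<phi> x = \<phi> (pick Q)"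
proof -
  have "x \<in> orb U X (pick Q)" using pick_orb[OF X U Q] x by simp
  then obtain g where "g \<in> U" "x = act X g (pick Q)" by (auto simp: orb_def)
  then show ?thesis using invariantD[OF inv] pick_orb(2)[OF X U Q] by simp
qed

lemma integral_orbits:
  assumes X: "X \<in> perm_obj G T" and U: "open_subgroup G T U" and inv: "invariant U X \<phi>"
  shows "integral \<mu> X \<phi> = (\<Sum>Q \<in> orb U X ` pts X. \<phi> (pick Q) * vol X Q)"
proof (rule integral_partition[OF X U finite_orbs[OF X U]])
  show "disjoint_family_on (\<lambda>Q. Q) (orb U X ` pts X)" by (rule orbs_disjoint[OF X U])
  show "\<phi> x = \<phi> (pick Q)" if "Q \<in> orb U X ` pts X" "x \<in> Q" for Q x
    by (rule invariant_orb[OF X U inv that])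
  show "\<phi> x = 0" if "x \<in> pts X" "\<And>Q. Q \<in> orb U X ` pts X \<Longrightarrow> x \<notin> Q" for x
    using that orb_self[OF X U] by blast
qed (use orb_stable[OF X U] in auto)

lemma integral_add:
  assumes X: "X \<in> perm_obj G T" and "smooth X \<phi>" "smooth X \<psi>"
  shows "integral \<mu> X (\<lambda>x. \<phi> x + \<psi> x) = integral \<mu> X \<phi> + integral \<mu> X \<psi>"
proof -
  obtain U where U: "open_subgroup G T U" and inv: "invariant U X \<phi>" "invariant U X \<psi>"
    using smooth_common[OF assms(2,3)] .
  then have "invariant U X (\<lambda>x. \<phi> x + \<psi> x)" by (simp add: invariant_def)
  then show ?thesis
    using inv by (simp add: integral_orbits[OF X U] distrib_right sum.distrib)
qed

lemma integral_scale:
  assumes X: "X \<in> perm_obj G T" and "smooth X \<phi>"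
  shows "integral \<mu> X (\<lambda>x. c * \<phi> x) = c * integral \<mu> X \<phi>"
proof -
  obtain U where U: "open_subgroup G T U" and inv: "invariant U X \<phi>"
    using assms(2) by (auto simp: smooth_def)
  then have "invariant U X (\<lambda>x. c * \<phi> x)" by (simp add: invariant_def)
  then show ?thesis
    using inv by (simp add: integral_orbits[OF X U] sum_distrib_left mult.assoc)
qed

lemma integral_zero: "integral \<mu> X (\<lambda>x. 0) = 0"
proof -
  have "(\<lambda>x. 0) ` pts X - {0 :: 'k} = {}" by auto
  then show ?thesis unfolding integral_def by (simp only: sum.empty)
qed

text \<open>
  The point is stable under its stabilizer, and its volume is \<open>1\<close>.
\<close>
lemma integral_point:
  assumes X: "X \<in> perm_obj G T" and x: "x \<in> pts X"
    and off: "\<And>y. \<lbrakk>y \<in> pts X; y \<noteq> x\<rbrakk> \<Longrightarrow> \<phi> y = 0"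
  shows "integral \<mu> X \<phi> = \<phi> x"
proof -
  have "integral \<mu> X \<phi> = (\<Sum>i\<in>{x}. \<phi> i * vol X {i})"
    by (rule integral_partition[OF X stabilizer_open[OF X x]])
      (use x off in \<open>auto simp: stable_def disjoint_family_on_def\<close>)
  then show ?thesis using vol_singleton[OF X x] by simp
qed

text \<open>
  The map \<open>j\<close> carries the \<open>U\<close>-orbits of \<open>Y\<close> to stable sets of the same volume that
  partition a set containing the support of \<open>\<phi>\<close>. Equivariance under a small group \<open>U\<close>
  suffices; this matters for \<open>y \<mapsto> (x, y)\<close>, which is only equivariant for the stabilizer of \<open>x\<close>.
\<close>
lemma integral_pushforward:
  assumes Y: "Y \<in> perm_obj G T" and Z: "Z \<in> perm_obj G T"
    and U: "open_subgroup G T U" and inv: "invariant U Z \<phi>"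
    and j: "inj_on j (pts Y)" "equivariant_on U Y Z j"
    and off: "\<And>z. \<lbrakk>z \<in> pts Z; z \<notin> j ` pts Y\<rbrakk> \<Longrightarrow> \<phi> z = 0"
  shows "integral \<mu> Z \<phi> = integral \<mu> Y (\<lambda>y. \<phi> (j y))"
proof -
  have jcl: "j y \<in> pts Z" if "y \<in> pts Y" for y
    using j(2) that by (auto simp: equivariant_on_def)
  have jact: "j (act Y g y) = act Z g (j y)" if "g \<in> U" "y \<in> pts Y" for g y
    using j(2) that by (auto simp: equivariant_on_def)
  have inv': "invariant U Y (\<lambda>y. \<phi> (j y))"
    using invariantD[OF inv] by (simp add: invariant_def jact jcl)
  have sub: "Q \<subseteq> pts Y" if "Q \<in> orb U Y ` pts Y" for Q
    using that orb_subset[OF Y U] by blast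
  have tr: "stable U Z (j ` Q)" "vol Z (j ` Q) = vol Y Q" if Q: "Q \<in> orb U Y ` pts Y" for Q
  proof -
    have st: "stable U Y Q" using Q orb_stable[OF Y U] by blast
    show "stable U Z (j ` Q)" "vol Z (j ` Q) = vol Y Q"
      using vol_transport[OF Y Z U st, of j] inj_on_subset[OF j(1) sub[OF Q]] sub[OF Q] jcl jact
      by (auto simp: subset_iff)
  qed
  have "integral \<mu> Z \<phi> = (\<Sum>Q \<in> orb U Y ` pts Y. \<phi> (j (pick Q)) * vol Z (j ` Q))"
  proof (rule integral_partition[OF Z U finite_orbs[OF Y U]])
    have "j ` Q \<inter> j ` R = {}" if "Q \<in> orb U Y ` pts Y" "R \<in> orb U Y ` pts Y" "Q \<noteq> R" for Q R
      using orbs_disjointD[OF Y U that] that sub inj_on_image_Int[OF j(1), of Q R] by simp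
    then show "disjoint_family_on ((`) j) (orb U Y ` pts Y)"
      unfolding disjoint_family_on_def by blast
    show "\<phi> z = \<phi> (j (pick Q))" if "Q \<in> orb U Y ` pts Y" "z \<in> j ` Q" for Q z
      using that invariant_orb[OF Y U inv'] by blast
    show "\<phi> z = 0" if "z \<in> pts Z" "\<And>Q. Q \<in> orb U Y ` pts Y \<Longrightarrow> z \<notin> j ` Q" for z
      using off that orb_self[OF Y U] by blast
  qed (rule tr(1))
  also have "\<dots> = integral \<mu> Y (\<lambda>y. \<phi> (j y))"
    by (simp add: integral_orbits[OF Y U inv'] tr(2))
  finally show ?thesis .
qed

text \<open>
  Translation by \<open>g\<close> carries the \<open>U\<close>-orbits to sets of the same volume, stable under the
  conjugate of \<open>U\<close>.
\<close>
lemma integral_translate: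
  assumes X: "X \<in> perm_obj G T" and "smooth X \<phi>" and g: "g \<in> carrier G"
  shows "integral \<mu> X (\<lambda>x. \<phi> (act X (inv g) x)) = integral \<mu> X \<phi>"
proof -
  obtain U where U: "open_subgroup G T U" and inv: "invariant U X \<phi>"
    using assms(2) by (auto simp: smooth_def)
  have sub: "Q \<subseteq> pts X" if "Q \<in> orb U X ` pts X" for Q
    using that orb_subset[OF X U] by blast
  have tr: "stable ((\<lambda>u. g \<otimes> u \<otimes> inv g) ` U) X (act X g ` Q)" "vol X (act X g ` Q) = vol X Q"
    if Q: "Q \<in> orb U X ` pts X" for Q
  proof -
    have "stable U X Q" using Q orb_stable[OF X U] by blast
    from vol_translate[OF X U this g]
    show "stable ((\<lambda>u. g \<otimes> u \<otimes> inv g) ` U) X (act X g ` Q)" "vol X (act X g ` Q) = vol X Q" .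
  qed
  have "integral \<mu> X (\<lambda>x. \<phi> (act X (inv g) x)) =
      (\<Sum>Q \<in> orb U X ` pts X. \<phi> (pick Q) * vol X (act X g ` Q))"
  proof (rule integral_partition[OF X conj_open_subgroup[OF U g] finite_orbs[OF X U] tr(1)])
    have "act X g ` Q \<inter> act X g ` R = {}"
      if "Q \<in> orb U X ` pts X" "R \<in> orb U X ` pts X" "Q \<noteq> R" for Q R
      using orbs_disjointD[OF X U that] that sub inj_on_image_Int[OF act_inj[OF X g], of Q R]
      by simp
    then show "disjoint_family_on ((`) (act X g)) (orb U X ` pts X)"
      unfolding disjoint_family_on_def by blast
    show "\<phi> (act X (inv g) x) = \<phi> (pick Q)"
      if "Q \<in> orb U X ` pts X" "x \<in> act X g ` Q" for Q x
      using that invariant_orb[OF X U inv] sub act_inv(1)[OF X g] by fastforce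
    show "\<phi> (act X (inv g) x) = 0"
      if x: "x \<in> pts X" and no: "\<And>Q. Q \<in> orb U X ` pts X \<Longrightarrow> x \<notin> act X g ` Q" for x
    proof -
      have p: "act X (inv g) x \<in> pts X" using act_closed[OF X] x g by simp
      then have "act X g (act X (inv g) x) \<in> act X g ` orb U X (act X (inv g) x)"
        using orb_self[OF X U] by blast
      then show ?thesis using no p act_inv(2)[OF X g x] by simp
    qed
  qed
  then show ?thesis using integral_orbits[OF X U inv] tr(2) by simp
qed

text \<open>
  For a function of two variables that is invariant under \<open>g\<close> acting on both, this compares the
  integrals over one variable at two values of the other; \<open>\<phi>\<close> and \<open>\<psi>\<close> are the function
  with its other variable fixed at a point and at the translate of that point.
\<close>
lemma integral_param_invariant:
  assumes X: "X \<in> perm_obj G T" and "smooth X \<phi>" and g: "g \<in> carrier G"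
    and eq: "\<And>x. x \<in> pts X \<Longrightarrow> \<psi> (act X g x) = \<phi> x"
  shows "integral \<mu> X \<psi> = integral \<mu> X \<phi>"
proof -
  have "integral \<mu> X \<psi> = integral \<mu> X (\<lambda>x. \<phi> (act X (inv g) x))"
  proof (rule integral_cong[OF X])
    fix x assume x: "x \<in> pts X"
    then show "\<psi> x = \<phi> (act X (inv g) x)"
      using eq[of "act X (inv g) x"] act_inv(2)[OF X g x] act_closed[OF X] g by simp
  qed
  then show ?thesis using integral_translate[OF X assms(2) g] by simp
qed

text \<open>
  Both sides are sums over the \<open>U\<close>-orbits \<open>Q\<close> of \<open>Z\<close>. For the right-hand side, integrate
  first over the fiber above one chosen point of each \<open>U\<close>-orbit \<open>P\<close> of \<open>X\<close>: the sets
  \<open>{z \<in> Q. f z = x}\<close> partition that fiber. After exchanging the sums, an orbit \<open>Q\<close> meets the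
  fiber only for \<open>P = f(Q)\<close>, where \<open>vol_fibration\<close> applies.
\<close>
lemma integral_fibration:
  assumes Z: "Z \<in> perm_obj G T" and X: "X \<in> perm_obj G T"
    and f: "equivariant_on (carrier G) Z X f" and "smooth Z F"
  shows "integral \<mu> Z F = integral \<mu> X (\<lambda>x. integral \<mu> Z (\<lambda>z. if f z = x then F z else 0))"
proof -
  obtain U where U: "open_subgroup G T U" and inv: "invariant U Z F"
    using assms(4) by (auto simp: smooth_def)
  have fcl: "f z \<in> pts X" if "z \<in> pts Z" for z
    using f that by (auto simp: equivariant_on_def)
  have fact: "f (act Z g z) = act X g (f z)" if "g \<in> carrier G" "z \<in> pts Z" for g z
    using f that by (auto simp: equivariant_on_def)
  let ?h = "\<lambda>x z. if f z = x then F z else 0"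
  let ?W = "\<lambda>x. U \<inter> {g \<in> carrier G. act X g x = x}"
  let ?OZ = "orb U Z ` pts Z" and ?OX = "orb U X ` pts X"
  have W: "open_subgroup G T (?W x)" if "x \<in> pts X" for x
    using open_subgroup_Int[OF U stabilizer_open[OF X that]] .
  have fib: "f (act Z g z) = act X g x \<longleftrightarrow> f z = x"
    if "g \<in> carrier G" "z \<in> pts Z" "x \<in> pts X" for g z x
    using act_eq_iff[OF X that(1) fcl[OF that(2)] that(3)] fact[OF that(1,2)] by simp
  have hinv: "invariant (?W x) Z (?h x)" if x: "x \<in> pts X" for x
    unfolding invariant_def
  proof (intro ballI)
    fix g z assume "g \<in> ?W x" "z \<in> pts Z"
    then show "?h x (act Z g z) = ?h x z"
      using fib[of g z x] x invariantD[OF inv, of g z] by simp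
  qed
  have inner_inv: "invariant U X (\<lambda>x. integral \<mu> Z (?h x))"
    unfolding invariant_def
  proof (intro ballI)
    fix g x assume g: "g \<in> U" and x: "x \<in> pts X"
    have gc: "g \<in> carrier G" using g subset_carrier[OF U] by blast
    show "integral \<mu> Z (?h (act X g x)) = integral \<mu> Z (?h x)"
      by (rule integral_param_invariant[OF Z smoothI[OF W[OF x] hinv[OF x]] gc])
        (use fib[OF gc _ x] invariantD[OF inv g] in simp)
  qed
  \<comment> \<open>the fiber above \<open>x\<close> is cut by the \<open>U\<close>-orbits of \<open>Z\<close> into sets stable under the
    stabilizer of \<open>x\<close> in \<open>U\<close>\<close>
  have inner: "integral \<mu> Z (?h x) = (\<Sum>Q\<in>?OZ. F (pick Q) * vol Z {z \<in> Q. f z = x})"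
    if x: "x \<in> pts X" for x
  proof (rule integral_partition[OF Z W[OF x] finite_orbs[OF Z U]])
    show "stable (?W x) Z {z \<in> Q. f z = x}" if "Q \<in> ?OZ" for Q
    proof -
      have "stable U Z Q" using that orb_stable[OF Z U] by blast
      then show ?thesis using fact by (auto simp: stable_def subset_iff)
    qed
    show "disjoint_family_on (\<lambda>Q. {z \<in> Q. f z = x}) ?OZ"
      using orbs_disjoint[OF Z U] unfolding disjoint_family_on_def by blast
    show "?h x z = F (pick Q)" if "Q \<in> ?OZ" "z \<in> {z \<in> Q. f z = x}" for Q z
      using invariant_orb[OF Z U inv that(1), of z] that(2) by simp
    show "?h x z = 0" if "z \<in> pts Z" "\<And>Q. Q \<in> ?OZ \<Longrightarrow> z \<notin> {z \<in> Q. f z = x}" for z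
      using that orb_self[OF Z U that(1)] by auto
  qed
  have fQ: "f ` orb U Z z = orb U X (f z)" if "z \<in> pts Z" for z
    using fact that subset_carrier[OF U] by (auto simp: orb_def image_image subset_iff)
  have "integral \<mu> X (\<lambda>x. integral \<mu> Z (?h x)) =
      (\<Sum>P\<in>?OX. (\<Sum>Q\<in>?OZ. F (pick Q) * vol Z {z \<in> Q. f z = pick P}) * vol X P)"
    unfolding integral_orbits[OF X U inner_inv]
  proof (rule sum.cong[OF refl])
    fix P assume "P \<in> ?OX"
    show "integral \<mu> Z (?h (pick P)) * vol X P =
        (\<Sum>Q\<in>?OZ. F (pick Q) * vol Z {z \<in> Q. f z = pick P}) * vol X P"
      unfolding inner[OF pick_orb(2)[OF X U \<open>P \<in> ?OX\<close>]] ..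
  qed
  also have "\<dots> = (\<Sum>Q\<in>?OZ. \<Sum>P\<in>?OX. F (pick Q) * (vol Z {z \<in> Q. f z = pick P} * vol X P))"
    unfolding sum_distrib_right mult.assoc by (rule sum.swap)
  also have "\<dots> = (\<Sum>Q\<in>?OZ. F (pick Q) * vol Z Q)"
  proof (rule sum.cong[OF refl])
    fix Q assume Q: "Q \<in> ?OZ"
    then obtain z where z: "z \<in> pts Z" "Q = orb U Z z" by blast
    have "f ` Q = orb U X (f z)" unfolding z(2) by (rule fQ[OF z(1)])
    then have P: "f ` Q \<in> ?OX" using fcl[OF z(1)] by (rule image_eqI)
    \<comment> \<open>an orbit \<open>P\<close> other than \<open>f(Q)\<close> is disjoint from \<open>f(Q)\<close>\<close>
    have zero: "vol Z {z \<in> Q. f z = pick P} = 0" if "P \<in> ?OX" "P \<noteq> f ` Q" for P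
    proof -
      have "P \<inter> f ` Q = {}" by (rule orbs_disjointD[OF X U that(1) P that(2)])
      then have "pick P \<notin> f ` Q" using pick_orb(1)[OF X U that(1)] by blast
      then have *: "{z \<in> Q. f z = pick P} = {}"
        by (metis (mono_tags, lifting) Collect_empty_eq imageI)
      show ?thesis unfolding * by (rule vol_empty[OF Z])
    qed
    have "(\<Sum>P\<in>?OX. F (pick Q) * (vol Z {z \<in> Q. f z = pick P} * vol X P)) =
        (\<Sum>P\<in>{f ` Q}. F (pick Q) * (vol Z {z \<in> Q. f z = pick P} * vol X P))"
    proof (rule sum.mono_neutral_right[OF finite_orbs[OF X U]])
      show "\<forall>P\<in>?OX - {f ` Q}. F (pick Q) * (vol Z {z \<in> Q. f z = pick P} * vol X P) = 0"
      proof
        fix P assume P: "P \<in> ?OX - {f ` Q}"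
        have "vol Z {z \<in> Q. f z = pick P} = 0"
          by (rule zero[OF DiffD1[OF P]]) (use P in blast)
        then show "F (pick Q) * (vol Z {z \<in> Q. f z = pick P} * vol X P) = 0" by simp
      qed
    qed (use P in blast)
    also have "\<dots> = F (pick Q) * vol Z Q"
      using vol_fibration[OF Z X f U z(1), folded z(2), OF pick_orb(1)[OF X U P]] by simp
    finally show "(\<Sum>P\<in>?OX. F (pick Q) * (vol Z {z \<in> Q. f z = pick P} * vol X P)) =
        F (pick Q) * vol Z Q" .
  qed
  finally show ?thesis unfolding integral_orbits[OF Z U inv] by (rule sym)
qed

section \<open>Products and Fubini's theorem\<close>

lemma pts_prod [simp]: "Pair x y \<in> pts (prod_gset X Y) \<longleftrightarrow> x \<in> pts X \<and> y \<in> pts Y"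
  by (simp add: prod_gset_def prod_pts_def)

lemma pts_prodE:
  assumes "p \<in> pts (prod_gset X Y)"
  obtains x y where "p = Pair x y" "x \<in> pts X" "y \<in> pts Y"
  using assms by (auto simp: prod_gset_def prod_pts_def)

lemma act_prod [simp]:
  "\<lbrakk>x \<in> pts X; y \<in> pts Y\<rbrakk> \<Longrightarrow> act (prod_gset X Y) g (Pair x y) = Pair (act X g x) (act Y g y)"
  by (simp add: prod_gset_def prod_pts_def)

text \<open>
  Only finiteness needs an argument. Every \<open>G\<close>-orbit on \<open>X \<times> Y\<close> contains a pair whose first
  entry \<open>r\<close> is one of finitely many representatives of the \<open>G\<close>-orbits on \<open>X\<close>, and
  whose second entry represents one of the finitely many orbits on \<open>Y\<close> of the stabilizer of \<open>r\<close>.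
\<close>
lemma prod_gset_obj:
  assumes X: "X \<in> perm_obj G T" and Y: "Y \<in> perm_obj G T"
  shows "prod_gset X Y \<in> perm_obj G T"
proof (rule perm_objI)
  show "grp (prod_gset X Y) = carrier G"
    by (simp add: prod_gset_def grp_eq[OF X] grp_eq[OF Y])
  show "act (prod_gset X Y) g \<in> extensional (pts (prod_gset X Y))" for g
    by (simp add: prod_gset_def)
  show "openin T {g \<in> carrier G. act (prod_gset X Y) g p = p}" if p: "p \<in> pts (prod_gset X Y)" for p
  proof -
    obtain x y where xy: "p = Pair x y" "x \<in> pts X" "y \<in> pts Y" using p by (rule pts_prodE)
    have "{g \<in> carrier G. act (prod_gset X Y) g p = p} =
        {g \<in> carrier G. act X g x = x} \<inter> {g \<in> carrier G. act Y g y = y}"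
      using xy by auto
    then show ?thesis
      using open_subgroup_Int[OF stabilizer_open[OF X xy(2)] stabilizer_open[OF Y xy(3)]]
      by (simp add: open_subgroup_def)
  qed
  show fin: "finite (orb (carrier G) (prod_gset X Y) ` pts (prod_gset X Y))"
  proof -
    note C = open_subgroup_carrier
    let ?V = "\<lambda>x. {g \<in> carrier G. act X g x = x}"
    define R where "R = pick ` orb (carrier G) X ` pts X"
    define B where "B = (\<Union>x\<in>R. (\<lambda>y. Pair x y) ` pick ` orb (?V x) Y ` pts Y)"
    have R: "finite R" unfolding R_def by (rule finite_imageI[OF finite_orbs[OF X C]])
    have "R \<subseteq> pts X" unfolding R_def using pick_orb(2)[OF X C] by (rule image_subsetI)
    have "finite B"
      unfolding B_def
    proof (rule finite_UN_I[OF R])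
      fix x assume "x \<in> R"
      then have "x \<in> pts X" using \<open>R \<subseteq> pts X\<close> by blast
      then show "finite (Pair x ` pick ` orb (?V x) Y ` pts Y)"
        by (intro finite_imageI[OF finite_imageI] finite_orbs[OF Y stabilizer_open[OF X]])
    qed
    then have "finite (orb (carrier G) (prod_gset X Y) ` B)" by (rule finite_imageI)
    moreover have "orb (carrier G) (prod_gset X Y) p \<in> orb (carrier G) (prod_gset X Y) ` B"
      if p: "p \<in> pts (prod_gset X Y)" for p
    proof -
      obtain x y where xy: "p = Pair x y" "x \<in> pts X" "y \<in> pts Y" using p by (rule pts_prodE)
      \<comment> \<open>move \<open>p\<close> by \<open>inv g\<close> so that its first entry becomes a representative \<open>r\<close>, then by
        an element of the stabilizer of \<open>r\<close> to reach a pair in \<open>B\<close>\<close>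
      obtain r where r: "r \<in> R" "r \<in> pts X" "x \<in> orb (carrier G) X r"
      proof
        show "pick (orb (carrier G) X x) \<in> R" using xy(2) by (simp add: R_def)
        show "pick (orb (carrier G) X x) \<in> pts X"
          by (rule pick_orb(2)[OF X C imageI[OF xy(2)]])
        show "x \<in> orb (carrier G) X (pick (orb (carrier G) X x))"
          by (rule orb_pick[OF X C xy(2)])
      qed
      then obtain g where g: "g \<in> carrier G" "x = act X g r" by (auto simp: orb_def)
      define y' where "y' = act Y (inv g) y"
      have y': "y' \<in> pts Y" unfolding y'_def by (rule act_closed[OF Y inv_closed[OF g(1)] xy(3)])
      note V = stabilizer_open[OF X r(2)]
      define s where "s = pick (orb (?V r) Y y')"
      have s: "s \<in> pts Y" unfolding s_def by (rule pick_orb(2)[OF Y V imageI[OF y']])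
      have "y' \<in> orb (?V r) Y s" unfolding s_def by (rule orb_pick[OF Y V y'])
      then obtain h where h: "h \<in> carrier G" "act X h r = r" "y' = act Y h s"
        by (auto simp: orb_def)
      have "act X (g \<otimes> h) r = x" using g h(1,2) r(2) by (simp add: act_mult[OF X])
      moreover have "act Y (g \<otimes> h) s = y"
        using act_inv(2)[OF Y g(1) xy(3)] act_mult[OF Y g(1) h(1) s] by (simp add: h(3)[symmetric] y'_def)
      ultimately have k: "g \<otimes> h \<in> carrier G" "p = act (prod_gset X Y) (g \<otimes> h) (Pair r s)"
        using g(1) h(1) r(2) s xy(1) by simp_all
      have "orb (carrier G) (prod_gset X Y) p = orb (carrier G) (prod_gset X Y) (Pair r s)"
      proof -
        have "orb (carrier G) (prod_gset X Y) (Pair (act X k r) (act Y k s)) =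
            orb (carrier G) (prod_gset X Y) (Pair r s)" if kc: "k \<in> carrier G" for k
        proof -
          have "(\<lambda>l. Pair (act X (l \<otimes> k) r) (act Y (l \<otimes> k) s)) ` carrier G =
              (\<lambda>l. Pair (act X l r) (act Y l s)) ` (\<lambda>l. l \<otimes> k) ` carrier G"
            by (simp add: image_image)
          also have "(\<lambda>l. l \<otimes> k) ` carrier G = carrier G"
          proof (intro equalityI subsetI)
            fix l assume l: "l \<in> carrier G"
            then have "l = (l \<otimes> inv k) \<otimes> k" using kc by (simp add: m_assoc)
            then show "l \<in> (\<lambda>l. l \<otimes> k) ` carrier G" by (rule image_eqI) (use l kc in simp)
          qed (use kc in auto)
          finally show ?thesis
            using r(2) s kc by (simp add: orb_def act_closed[OF X] act_closed[OF Y]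
                act_mult[OF X] act_mult[OF Y])
        qed
        from this[OF k(1)] show ?thesis using k(2) r(2) s by simp
      qed
      moreover have "Pair r s \<in> B"
        unfolding B_def s_def using y' by (intro UN_I[OF r(1)] imageI)
      ultimately show ?thesis by (rule image_eqI)
    qed
    ultimately show ?thesis by (intro finite_subset[OF image_subsetI])
  qed
next
  fix g p assume g: "g \<in> carrier G" and "p \<in> pts (prod_gset X Y)"
  then obtain x y where "p = Pair x y" "x \<in> pts X" "y \<in> pts Y" by (elim pts_prodE)
  then show "act (prod_gset X Y) g p \<in> pts (prod_gset X Y)"
    using g by (simp add: act_closed[OF X] act_closed[OF Y])
next
  fix p assume "p \<in> pts (prod_gset X Y)"
  then obtain x y where "p = Pair x y" "x \<in> pts X" "y \<in> pts Y" by (elim pts_prodE)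
  then show "act (prod_gset X Y) \<one> p = p"
    by (simp add: act_one[OF X] act_one[OF Y])
next
  fix g h p assume gh: "g \<in> carrier G" "h \<in> carrier G" and "p \<in> pts (prod_gset X Y)"
  then obtain x y where "p = Pair x y" "x \<in> pts X" "y \<in> pts Y" by (elim pts_prodE)
  then show "act (prod_gset X Y) (g \<otimes> h) p = act (prod_gset X Y) g (act (prod_gset X Y) h p)"
    using gh by (simp add: act_closed[OF X] act_closed[OF Y] act_mult[OF X] act_mult[OF Y])
qed

text \<open>
  Fubini's theorem: \<open>integral_fibration\<close> for the two projections, where the integral over a fiber
  is moved to the other factor by \<open>integral_pushforward\<close>.
\<close>
lemma integral_prod:
  assumes X: "X \<in> perm_obj G T" and Y: "Y \<in> perm_obj G T" and "smooth (prod_gset X Y) F"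
  shows "integral \<mu> (prod_gset X Y) F = integral \<mu> X (\<lambda>x. integral \<mu> Y (\<lambda>y. F (Pair x y)))"
    and "integral \<mu> (prod_gset X Y) F = integral \<mu> Y (\<lambda>y. integral \<mu> X (\<lambda>x. F (Pair x y)))"
proof -
  let ?Z = "prod_gset X Y"
  have Z: "?Z \<in> perm_obj G T" by (rule prod_gset_obj[OF X Y])
  obtain U where U: "open_subgroup G T U" and inv: "invariant U ?Z F"
    using assms(3) by (auto simp: smooth_def)
  define p where "p = (\<lambda>z :: ('g, 'a) univ. case z of Pair x y \<Rightarrow> x | _ \<Rightarrow> z)"
  define q where "q = (\<lambda>z :: ('g, 'a) univ. case z of Pair x y \<Rightarrow> y | _ \<Rightarrow> z)"
  have pq [simp]: "p (Pair x y) = x" "q (Pair x y) = y" for x y by (simp_all add: p_def q_def)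
  have eq: "equivariant_on (carrier G) ?Z X p" "equivariant_on (carrier G) ?Z Y q"
    by (auto simp: equivariant_on_def elim!: pts_prodE)
  have "integral \<mu> ?Z (\<lambda>z. if p z = x then F z else 0) = integral \<mu> Y (\<lambda>y. F (Pair x y))"
    if x: "x \<in> pts X" for x
  proof -
    let ?W = "U \<inter> {g \<in> carrier G. act X g x = x}"
    have "open_subgroup G T ?W" using open_subgroup_Int[OF U stabilizer_open[OF X x]] .
    moreover have "invariant ?W ?Z (\<lambda>z. if p z = x then F z else 0)"
      unfolding invariant_def
    proof (intro ballI)
      fix g z assume g: "g \<in> ?W" and z: "z \<in> pts ?Z"
      have "p (act ?Z g z) = x \<longleftrightarrow> p z = x"
        using z g x act_eq_iff[OF X, of g] by (auto elim!: pts_prodE)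
      then show "(if p (act ?Z g z) = x then F (act ?Z g z) else 0) = (if p z = x then F z else 0)"
        using invariantD[OF inv _ z] g by simp
    qed
    ultimately have "integral \<mu> ?Z (\<lambda>z. if p z = x then F z else 0) =
        integral \<mu> Y (\<lambda>y. if p (Pair x y) = x then F (Pair x y) else 0)"
      by (rule integral_pushforward[OF Y Z, where j = "Pair x"])
        (use x in \<open>auto simp: inj_on_def equivariant_on_def elim!: pts_prodE\<close>)
    then show ?thesis by simp
  qed
  then show "integral \<mu> ?Z F = integral \<mu> X (\<lambda>x. integral \<mu> Y (\<lambda>y. F (Pair x y)))"
    unfolding integral_fibration[OF Z X eq(1) assms(3)] by (rule integral_cong[OF X])
  have "integral \<mu> ?Z (\<lambda>z. if q z = y then F z else 0) = integral \<mu> X (\<lambda>x. F (Pair x y))"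
    if y: "y \<in> pts Y" for y
  proof -
    let ?W = "U \<inter> {g \<in> carrier G. act Y g y = y}"
    have "open_subgroup G T ?W" using open_subgroup_Int[OF U stabilizer_open[OF Y y]] .
    moreover have "invariant ?W ?Z (\<lambda>z. if q z = y then F z else 0)"
      unfolding invariant_def
    proof (intro ballI)
      fix g z assume g: "g \<in> ?W" and z: "z \<in> pts ?Z"
      have "q (act ?Z g z) = y \<longleftrightarrow> q z = y"
        using z g y act_eq_iff[OF Y, of g] by (auto elim!: pts_prodE)
      then show "(if q (act ?Z g z) = y then F (act ?Z g z) else 0) = (if q z = y then F z else 0)"
        using invariantD[OF inv _ z] g by simp
    qed
    ultimately have "integral \<mu> ?Z (\<lambda>z. if q z = y then F z else 0) =
        integral \<mu> X (\<lambda>x. if q (Pair x y) = y then F (Pair x y) else 0)"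
      by (rule integral_pushforward[OF X Z, where j = "\<lambda>x. Pair x y"])
        (use y in \<open>auto simp: inj_on_def equivariant_on_def elim!: pts_prodE\<close>)
    then show ?thesis by simp
  qed
  then show "integral \<mu> ?Z F = integral \<mu> Y (\<lambda>y. integral \<mu> X (\<lambda>x. F (Pair x y)))"
    unfolding integral_fibration[OF Z Y eq(2) assms(3)] by (rule integral_cong[OF Y])
qed

section \<open>Invariant matrices\<close>

lemma perm_homD:
  assumes "A \<in> perm_hom G X Y"
  shows "source A = X" "target A = Y"
    and "y \<notin> pts Y \<Longrightarrow> entry A y x = 0" "x \<notin> pts X \<Longrightarrow> entry A y x = 0"
    and "\<lbrakk>g \<in> carrier G; y \<in> pts Y; x \<in> pts X\<rbrakk> \<Longrightarrow> entry A (act Y g y) (act X g x) = entry A y x"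
  using assms by (auto simp: perm_hom_def)

lemma perm_homI:
  assumes "source A = X" "target A = Y"
    and "\<And>y x. y \<notin> pts Y \<Longrightarrow> entry A y x = 0" "\<And>y x. x \<notin> pts X \<Longrightarrow> entry A y x = 0"
    and "\<And>g y x. \<lbrakk>g \<in> carrier G; y \<in> pts Y; x \<in> pts X\<rbrakk> \<Longrightarrow>
      entry A (act Y g y) (act X g x) = entry A y x"
  shows "A \<in> perm_hom G X Y"
  using assms by (auto simp: perm_hom_def)

lemma mat_eqI:
  fixes A B :: "('g, 'x, 'c::zero) mat"
  assumes A: "A \<in> perm_hom G X Y" and B: "B \<in> perm_hom G X Y"
    and eq: "\<And>y x. \<lbrakk>y \<in> pts Y; x \<in> pts X\<rbrakk> \<Longrightarrow> entry A y x = entry B y x"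
  shows "A = B"
proof -
  have "entry A y x = entry B y x" for y x
    using eq perm_homD(3,4)[OF A] perm_homD(3,4)[OF B] by (cases "y \<in> pts Y \<and> x \<in> pts X") auto
  then have "entry A = entry B" by blast
  then show ?thesis using perm_homD(1,2)[OF A] perm_homD(1,2)[OF B] by simp
qed

lemma smooth_column:
  assumes X: "X \<in> perm_obj G T" and A: "A \<in> perm_hom G X Y" and x: "x \<in> pts X"
  shows "smooth Y (\<lambda>y. entry A y x)"
proof (rule smoothI[OF stabilizer_open[OF X x]])
  have "entry A (act Y g y) x = entry A y x"
    if "g \<in> carrier G" "act X g x = x" "y \<in> pts Y" for g y
    using perm_homD(5)[OF A that(1,3) x] that(2) by simp
  then show "invariant {g \<in> carrier G. act X g x = x} Y (\<lambda>y. entry A y x)"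
    by (simp add: invariant_def)
qed

lemma smooth_row:
  assumes Y: "Y \<in> perm_obj G T" and A: "A \<in> perm_hom G X Y" and y: "y \<in> pts Y"
  shows "smooth X (\<lambda>x. entry A y x)"
proof (rule smoothI[OF stabilizer_open[OF Y y]])
  have "entry A y (act X g x) = entry A y x"
    if "g \<in> carrier G" "act Y g y = y" "x \<in> pts X" for g x
    using perm_homD(5)[OF A that(1) y that(3)] that(2) by simp
  then show "invariant {g \<in> carrier G. act Y g y = y} X (\<lambda>x. entry A y x)"
    by (simp add: invariant_def)
qed

lemma smooth_mult:
  assumes "smooth X \<phi>" "smooth X \<psi>"
  shows "smooth X (\<lambda>x. \<phi> x * \<psi> x)"
proof -
  obtain U where U: "open_subgroup G T U" "invariant U X \<phi>" "invariant U X \<psi>"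
    using smooth_common[OF assms] .
  then show ?thesis by (intro smoothI[OF U(1)]) (simp add: invariant_def)
qed

lemma smooth_pull_prod:
  assumes "smooth X \<phi>"
  shows "smooth (prod_gset X Y) (\<lambda>p. case p of Pair x y \<Rightarrow> \<phi> x | _ \<Rightarrow> c)"
    and "smooth (prod_gset Y X) (\<lambda>p. case p of Pair y x \<Rightarrow> \<phi> x | _ \<Rightarrow> c)"
proof -
  obtain U where U: "open_subgroup G T U" "invariant U X \<phi>" using assms by (auto simp: smooth_def)
  have "invariant U (prod_gset X Y) (\<lambda>p. case p of Pair x y \<Rightarrow> \<phi> x | _ \<Rightarrow> c)"
    unfolding invariant_def
  proof (intro ballI)
    fix g p assume "g \<in> U" "p \<in> pts (prod_gset X Y)"
    then show "(case act (prod_gset X Y) g p of Pair x y \<Rightarrow> \<phi> x | _ \<Rightarrow> c) =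
        (case p of Pair x y \<Rightarrow> \<phi> x | _ \<Rightarrow> c)"
      using U(2) by (elim pts_prodE) (simp add: invariantD)
  qed
  then show "smooth (prod_gset X Y) (\<lambda>p. case p of Pair x y \<Rightarrow> \<phi> x | _ \<Rightarrow> c)"
    by (rule smoothI[OF U(1)])
  have "invariant U (prod_gset Y X) (\<lambda>p. case p of Pair y x \<Rightarrow> \<phi> x | _ \<Rightarrow> c)"
    unfolding invariant_def
  proof (intro ballI)
    fix g p assume "g \<in> U" "p \<in> pts (prod_gset Y X)"
    then show "(case act (prod_gset Y X) g p of Pair y x \<Rightarrow> \<phi> x | _ \<Rightarrow> c) =
        (case p of Pair y x \<Rightarrow> \<phi> x | _ \<Rightarrow> c)"
      using U(2) by (elim pts_prodE) (simp add: invariantD)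
  qed
  then show "smooth (prod_gset Y X) (\<lambda>p. case p of Pair y x \<Rightarrow> \<phi> x | _ \<Rightarrow> c)"
    by (rule smoothI[OF U(1)])
qed

lemma smooth_hom:
  assumes A: "A \<in> perm_hom G X Y"
  shows "smooth (prod_gset Y X) (\<lambda>p. case p of Pair y x \<Rightarrow> entry A y x | _ \<Rightarrow> c)"
proof (rule smoothI[OF open_subgroup_carrier])
  show "invariant (carrier G) (prod_gset Y X) (\<lambda>p. case p of Pair y x \<Rightarrow> entry A y x | _ \<Rightarrow> c)"
    unfolding invariant_def
  proof (intro ballI)
    fix g p assume "g \<in> carrier G" "p \<in> pts (prod_gset Y X)"
    then show "(case act (prod_gset Y X) g p of Pair y x \<Rightarrow> entry A y x | _ \<Rightarrow> c) =
        (case p of Pair y x \<Rightarrow> entry A y x | _ \<Rightarrow> c)"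
      by (elim pts_prodE) (simp add: perm_homD(5)[OF A])
  qed
qed

lemma entry_comp:
  "A \<in> perm_hom G X Y \<Longrightarrow>
    entry (mat_comp \<mu> B A) z x = integral \<mu> Y (\<lambda>y. entry B z y * entry A y x)"
  by (simp add: mat_comp_def perm_hom_def)

lemma comp_hom:
  assumes X: "X \<in> perm_obj G T" and Y: "Y \<in> perm_obj G T" and Z: "Z \<in> perm_obj G T"
    and A: "A \<in> perm_hom G X Y" and B: "B \<in> perm_hom G Y Z"
  shows "mat_comp \<mu> B A \<in> perm_hom G X Z"
proof (rule perm_homI)
  show "source (mat_comp \<mu> B A) = X" "target (mat_comp \<mu> B A) = Z"
    using perm_homD(1)[OF A] perm_homD(2)[OF B] by (simp_all add: mat_comp_def)
  show "entry (mat_comp \<mu> B A) z x = 0" if "z \<notin> pts Z" for z x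
    using that by (simp add: entry_comp[OF A] perm_homD(3)[OF B] integral_zero)
  show "entry (mat_comp \<mu> B A) z x = 0" if "x \<notin> pts X" for z x
    using that by (simp add: entry_comp[OF A] perm_homD(4)[OF A] integral_zero)
  show "entry (mat_comp \<mu> B A) (act Z g z) (act X g x) = entry (mat_comp \<mu> B A) z x"
    if g: "g \<in> carrier G" and z: "z \<in> pts Z" and x: "x \<in> pts X" for g z x
    unfolding entry_comp[OF A]
    by (rule integral_param_invariant[OF Y
          smooth_mult[OF smooth_row[OF Z B z] smooth_column[OF X A x]] g])
      (simp add: perm_homD(5)[OF A g _ x] perm_homD(5)[OF B g z])
qed

lemma integral_scale_right:
  assumes "X \<in> perm_obj G T" "smooth X \<phi>"
  shows "integral \<mu> X (\<lambda>x. \<phi> x * c) = integral \<mu> X \<phi> * c"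
  using integral_scale[OF assms, of c] by (simp add: mult.commute)

text \<open>
  Both sides are iterated integrals of \<open>C(z,y) B(y,x) A(x,w)\<close>, in the two possible orders.
\<close>
lemma comp_assoc_mat:
  assumes W: "W \<in> perm_obj G T" and X: "X \<in> perm_obj G T" and Y: "Y \<in> perm_obj G T"
    and Z: "Z \<in> perm_obj G T"
    and A: "A \<in> perm_hom G W X" and B: "B \<in> perm_hom G X Y" and C: "C \<in> perm_hom G Y Z"
  shows "mat_comp \<mu> (mat_comp \<mu> C B) A = mat_comp \<mu> C (mat_comp \<mu> B A)"
proof (rule mat_eqI)
  note BA = comp_hom[OF W X Y A B] and CB = comp_hom[OF X Y Z B C]
  show "mat_comp \<mu> (mat_comp \<mu> C B) A \<in> perm_hom G W Z" by (rule comp_hom[OF W X Z A CB])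
  show "mat_comp \<mu> C (mat_comp \<mu> B A) \<in> perm_hom G W Z" by (rule comp_hom[OF W Y Z BA C])
  fix z w assume z: "z \<in> pts Z" and w: "w \<in> pts W"
  \<comment> \<open>the integrand as a product of three factors, each of which is smooth for its own reason\<close>
  let ?K = "\<lambda>p. (case p of Pair y x \<Rightarrow> entry C z y | _ \<Rightarrow> 0) *
    ((case p of Pair y x \<Rightarrow> entry B y x | _ \<Rightarrow> 0) * (case p of Pair y x \<Rightarrow> entry A x w | _ \<Rightarrow> 0))"
  have K: "smooth (prod_gset Y X) ?K"
    by (intro smooth_mult smooth_pull_prod smooth_hom[OF B] smooth_row[OF Z C z]
        smooth_column[OF W A w])
  have "entry (mat_comp \<mu> C (mat_comp \<mu> B A)) z w =
      integral \<mu> Y (\<lambda>y. integral \<mu> X (\<lambda>x. entry C z y * (entry B y x * entry A x w)))"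
    unfolding entry_comp[OF BA] entry_comp[OF A]
    by (rule integral_cong[OF Y], rule integral_scale[OF X, symmetric])
      (intro smooth_mult smooth_row[OF Y B] smooth_column[OF W A w])
  also have "\<dots> = integral \<mu> X (\<lambda>x. integral \<mu> Y (\<lambda>y. entry C z y * (entry B y x * entry A x w)))"
    using integral_prod[OF Y X K] by simp
  also have "\<dots> = entry (mat_comp \<mu> (mat_comp \<mu> C B) A) z w"
    unfolding entry_comp[OF A] entry_comp[OF B] mult.assoc[symmetric]
    by (rule integral_cong[OF X], rule integral_scale_right[OF Y])
      (intro smooth_mult smooth_row[OF Z C z] smooth_column[OF X B])
  finally show "entry (mat_comp \<mu> (mat_comp \<mu> C B) A) z w =
      entry (mat_comp \<mu> C (mat_comp \<mu> B A)) z w" by (rule sym)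
qed

lemma entry_tensor [simp]:
  "entry (mat_tensor A B) (Pair y y') (Pair x x') = entry A y x * entry B y' x'"
  by (simp add: mat_tensor_def)

lemma tensor_hom:
  assumes A: "A \<in> perm_hom G X Y" and B: "B \<in> perm_hom G X' Y'"
  shows "mat_tensor A B \<in> perm_hom G (prod_gset X X') (prod_gset Y Y')"
proof (rule perm_homI)
  show "source (mat_tensor A B) = prod_gset X X'" "target (mat_tensor A B) = prod_gset Y Y'"
    using perm_homD(1,2)[OF A] perm_homD(1,2)[OF B] by (simp_all add: mat_tensor_def)
  show "entry (mat_tensor A B) q p = 0" if "q \<notin> pts (prod_gset Y Y')" for q p
    using that perm_homD(3)[OF A] perm_homD(3)[OF B]
    by (auto simp: mat_tensor_def split: point.splits)
  show "entry (mat_tensor A B) q p = 0" if "p \<notin> pts (prod_gset X X')" for q p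
    using that perm_homD(4)[OF A] perm_homD(4)[OF B]
    by (auto simp: mat_tensor_def split: point.splits)
  show "entry (mat_tensor A B) (act (prod_gset Y Y') g q) (act (prod_gset X X') g p) =
      entry (mat_tensor A B) q p"
    if "g \<in> carrier G" "q \<in> pts (prod_gset Y Y')" "p \<in> pts (prod_gset X X')" for g q p
    using that by (elim pts_prodE) (simp add: perm_homD(5)[OF A] perm_homD(5)[OF B])
qed

text \<open>
  The right-hand side integrates over \<open>Y \<times> Y'\<close> a product of a function on \<open>Y\<close> and a
  function on \<open>Y'\<close>; by Fubini's theorem this is the product of the two integrals.
\<close>
lemma tensor_comp_mat:
  assumes X: "X \<in> perm_obj G T" and Y: "Y \<in> perm_obj G T" and Z: "Z \<in> perm_obj G T"
    and X': "X' \<in> perm_obj G T" and Y': "Y' \<in> perm_obj G T" and Z': "Z' \<in> perm_obj G T"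
    and A: "A \<in> perm_hom G X Y" and B: "B \<in> perm_hom G Y Z"
    and A': "A' \<in> perm_hom G X' Y'" and B': "B' \<in> perm_hom G Y' Z'"
  shows "mat_tensor (mat_comp \<mu> B A) (mat_comp \<mu> B' A') =
    mat_comp \<mu> (mat_tensor B B') (mat_tensor A A')"
proof (rule mat_eqI)
  note AA = tensor_hom[OF A A']
  show "mat_tensor (mat_comp \<mu> B A) (mat_comp \<mu> B' A') \<in>
      perm_hom G (prod_gset X X') (prod_gset Z Z')"
    by (intro tensor_hom comp_hom[OF X Y Z A B] comp_hom[OF X' Y' Z' A' B'])
  show "mat_comp \<mu> (mat_tensor B B') (mat_tensor A A') \<in> perm_hom G (prod_gset X X') (prod_gset Z Z')"
    by (rule comp_hom[OF _ _ _ AA tensor_hom[OF B B']]) (intro prod_gset_obj X X' Y Y' Z Z')+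
  fix q p assume "q \<in> pts (prod_gset Z Z')" "p \<in> pts (prod_gset X X')"
  then obtain z z' x x' where q: "q = Pair z z'" "z \<in> pts Z" "z' \<in> pts Z'"
    and p: "p = Pair x x'" "x \<in> pts X" "x' \<in> pts X'" by (elim pts_prodE) blast
  let ?f = "\<lambda>y. entry B z y * entry A y x" and ?f' = "\<lambda>y. entry B' z' y * entry A' y x'"
  have f: "smooth Y ?f" by (intro smooth_mult smooth_row[OF Z B q(2)] smooth_column[OF X A p(2)])
  have f': "smooth Y' ?f'"
    by (intro smooth_mult smooth_row[OF Z' B' q(3)] smooth_column[OF X' A' p(3)])
  let ?F = "\<lambda>p. (case p of Pair y y' \<Rightarrow> ?f y | _ \<Rightarrow> 0) * (case p of Pair y y' \<Rightarrow> ?f' y' | _ \<Rightarrow> 0)"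
  have F: "smooth (prod_gset Y Y') ?F" by (intro smooth_mult smooth_pull_prod f f')
  have "entry (mat_comp \<mu> (mat_tensor B B') (mat_tensor A A')) q p =
      integral \<mu> (prod_gset Y Y') ?F"
    unfolding entry_comp[OF AA] q(1) p(1)
    by (rule integral_cong[OF prod_gset_obj[OF Y Y']])
      (auto elim: pts_prodE simp: mult.assoc mult.left_commute)
  also have "\<dots> = integral \<mu> Y (\<lambda>y. ?f y * integral \<mu> Y' ?f')"
    unfolding integral_prod(1)[OF Y Y' F] by (simp add: integral_scale[OF Y' f'])
  also have "\<dots> = integral \<mu> Y ?f * integral \<mu> Y' ?f'"
    by (rule integral_scale_right[OF Y f])
  finally show "entry (mat_tensor (mat_comp \<mu> B A) (mat_comp \<mu> B' A')) q p =
      entry (mat_comp \<mu> (mat_tensor B B') (mat_tensor A A')) q p"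
    by (simp add: q(1) p(1) entry_comp[OF A] entry_comp[OF A'])
qed

section \<open>Matrices of equivariant maps\<close>

lemma entry_map:
  "entry (mat_of_map X Y f) y x = (if x \<in> pts X \<and> y \<in> pts Y \<and> y = f x then 1 else 0)"
  by (simp add: mat_of_map_def)

lemma equivariantD:
  assumes "equivariant_on (carrier G) X Y f"
  shows "x \<in> pts X \<Longrightarrow> f x \<in> pts Y"
    and "\<lbrakk>g \<in> carrier G; x \<in> pts X\<rbrakk> \<Longrightarrow> f (act X g x) = act Y g (f x)"
  using assms by (auto simp: equivariant_on_def)

lemma map_hom:
  assumes X: "X \<in> perm_obj G T" and Y: "Y \<in> perm_obj G T"
    and f: "equivariant_on (carrier G) X Y f"
  shows "mat_of_map X Y f \<in> perm_hom G X Y"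
proof (rule perm_homI)
  fix g y x assume g: "g \<in> carrier G" and y: "y \<in> pts Y" and x: "x \<in> pts X"
  have "act Y g y = f (act X g x) \<longleftrightarrow> y = f x"
    using act_eq_iff[OF Y g y equivariantD(1)[OF f x]] equivariantD(2)[OF f g x] by simp
  then show "entry (mat_of_map X Y f) (act Y g y) (act X g x) = entry (mat_of_map X Y f) y x"
    using x y act_closed[OF X g x] act_closed[OF Y g y] by (simp add: entry_map)
qed (simp_all add: mat_of_map_def)

text \<open>
  As a function of \<open>y\<close>, the entry of the matrix of \<open>f\<close> at \<open>(y, x)\<close> is supported at
  \<open>f x\<close>.
\<close>
lemma comp_map_right:
  assumes X: "X \<in> perm_obj G T" and Y: "Y \<in> perm_obj G T"
    and f: "equivariant_on (carrier G) X Y f" and x: "x \<in> pts X"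
  shows "entry (mat_comp \<mu> B (mat_of_map X Y f)) z x = entry B z (f x)"
proof -
  have fx: "f x \<in> pts Y" by (rule equivariantD(1)[OF f x])
  have "entry (mat_comp \<mu> B (mat_of_map X Y f)) z x =
      entry B z (f x) * entry (mat_of_map X Y f) (f x) x"
    unfolding entry_comp[OF map_hom[OF X Y f]]
    by (rule integral_point[OF Y fx]) (simp add: entry_map)
  then show ?thesis using x fx by (simp add: entry_map)
qed

text \<open>
  By injectivity the entry of the matrix of \<open>f\<close> at \<open>(f y, y')\<close>, as a function of
  \<open>y'\<close>, is supported at \<open>y\<close>. Without injectivity it would be the indicator function of a fiber.
\<close>
lemma comp_map_left:
  assumes Y: "Y \<in> perm_obj G T" and A: "A \<in> perm_hom G X Y"
    and f: "equivariant_on (carrier G) Y Z f" and inj: "inj_on f (pts Y)" and y: "y \<in> pts Y"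
  shows "entry (mat_comp \<mu> (mat_of_map Y Z f) A) (f y) x = entry A y x"
proof -
  have "entry (mat_comp \<mu> (mat_of_map Y Z f) A) (f y) x =
      entry (mat_of_map Y Z f) (f y) y * entry A y x"
    unfolding entry_comp[OF A]
  proof (rule integral_point[OF Y y])
    fix y' assume "y' \<in> pts Y" "y' \<noteq> y"
    then have "f y \<noteq> f y'" using inj_on_eq_iff[OF inj y] by auto
    then show "entry (mat_of_map Y Z f) (f y) y' * entry A y' x = 0" by (simp add: entry_map)
  qed
  then show ?thesis using y equivariantD(1)[OF f y] by (simp add: entry_map)
qed

lemma map_cong:
  assumes "\<And>x. x \<in> pts X \<Longrightarrow> f x = f' x"
  shows "mat_of_map X Y f = mat_of_map X Y f'"
  using assms by (auto simp: mat_of_map_def fun_eq_iff)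

lemma equivariant_comp:
  assumes f: "equivariant_on (carrier G) X Y f" and h: "equivariant_on (carrier G) Y Z h"
  shows "equivariant_on (carrier G) X Z (\<lambda>x. h (f x))"
  using equivariantD[OF f] equivariantD[OF h] by (simp add: equivariant_on_def)

lemma comp_map_map:
  assumes X: "X \<in> perm_obj G T" and Y: "Y \<in> perm_obj G T" and Z: "Z \<in> perm_obj G T"
    and f: "equivariant_on (carrier G) X Y f" and h: "equivariant_on (carrier G) Y Z h"
  shows "mat_comp \<mu> (mat_of_map Y Z h) (mat_of_map X Y f) = mat_of_map X Z (\<lambda>x. h (f x))"
proof (rule mat_eqI)
  show "mat_comp \<mu> (mat_of_map Y Z h) (mat_of_map X Y f) \<in> perm_hom G X Z"
    by (rule comp_hom[OF X Y Z map_hom[OF X Y f] map_hom[OF Y Z h]])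
  show "mat_of_map X Z (\<lambda>x. h (f x)) \<in> perm_hom G X Z"
    by (rule map_hom[OF X Z equivariant_comp[OF f h]])
  show "entry (mat_comp \<mu> (mat_of_map Y Z h) (mat_of_map X Y f)) z x =
      entry (mat_of_map X Z (\<lambda>x. h (f x))) z x" if "x \<in> pts X" for z x
    using that equivariantD(1)[OF f that] by (simp add: comp_map_right[OF X Y f] entry_map)
qed

definition map_pair :: "('b point \<Rightarrow> 'b point) \<Rightarrow> ('b point \<Rightarrow> 'b point) \<Rightarrow> 'b point \<Rightarrow> 'b point" where
  "map_pair f f' p = (case p of Pair x x' \<Rightarrow> Pair (f x) (f' x') | _ \<Rightarrow> p)"

lemma map_pair_Pair [simp]: "map_pair f f' (Pair x x') = Pair (f x) (f' x')"
  by (simp add: map_pair_def)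

lemma equivariant_map_pair:
  assumes f: "equivariant_on (carrier G) X Y f" and f': "equivariant_on (carrier G) X' Y' f'"
  shows "equivariant_on (carrier G) (prod_gset X X') (prod_gset Y Y') (map_pair f f')"
  unfolding equivariant_on_def
  by (auto elim!: pts_prodE simp: equivariantD[OF f] equivariantD[OF f'])

lemma tensor_map:
  "mat_tensor (mat_of_map X Y f) (mat_of_map X' Y' f') =
    mat_of_map (prod_gset X X') (prod_gset Y Y') (map_pair f f')"
  (is "?L = ?R")
proof -
  have "entry ?L q p = entry ?R q p" for q p
  proof (cases "(\<exists>y y'. q = Pair y y') \<and> (\<exists>x x'. p = Pair x x')")
    case True
    then show ?thesis by (auto simp: entry_map)
  next
    case False
    then have "q \<notin> pts (prod_gset Y Y') \<or> p \<notin> pts (prod_gset X X')" by (auto elim: pts_prodE)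
    moreover have "entry ?L q p = 0" using False by (auto simp: mat_tensor_def split: point.splits)
    ultimately show ?thesis by (auto simp: entry_map)
  qed
  then have "entry ?L = entry ?R" by blast
  then show ?thesis by (simp add: mat_tensor_def mat_of_map_def)
qed

lemma equivariant_id: "equivariant_on U X X id"
  by (simp add: equivariant_on_def)

section \<open>Unit object, coproducts and structure maps\<close>

lemma pts_point [simp]: "pts (point_gset G) = {Star}"
  by (simp add: point_gset_def)

lemma act_point [simp]: "act (point_gset G) g Star = Star"
  by (simp add: point_gset_def)

lemma point_gset_obj: "point_gset G \<in> perm_obj G T"
proof (rule perm_objI)
  show "openin T {g \<in> carrier G. act (point_gset G) g x = x}" if "x \<in> pts (point_gset G)" for x
    using that open_subgroup_carrier by (simp add: open_subgroup_def)
qed (auto simp: point_gset_def)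

definition empty_gset :: "('g, 'x) gset" where
  "empty_gset = \<lparr>pts = {}, grp = carrier G, act = (\<lambda>g. restrict id {})\<rparr>"

lemma empty_gset_obj: "empty_gset \<in> perm_obj G T"
  by (rule perm_objI) (auto simp: empty_gset_def)

lemma pts_sum [simp]:
  "InL x \<in> pts (sum_gset X Y) \<longleftrightarrow> x \<in> pts X" "InR y \<in> pts (sum_gset X Y) \<longleftrightarrow> y \<in> pts Y"
  by (auto simp: sum_gset_def)

lemma act_sum [simp]:
  "x \<in> pts X \<Longrightarrow> act (sum_gset X Y) g (InL x) = InL (act X g x)"
  "y \<in> pts Y \<Longrightarrow> act (sum_gset X Y) g (InR y) = InR (act Y g y)"
  by (simp_all add: sum_gset_def)

lemma pts_sumE:
  assumes "s \<in> pts (sum_gset X Y)"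
  obtains x where "s = InL x" "x \<in> pts X" | y where "s = InR y" "y \<in> pts Y"
  using assms by (auto simp: sum_gset_def)

lemma sum_gset_obj:
  assumes X: "X \<in> perm_obj G T" and Y: "Y \<in> perm_obj G T"
  shows "sum_gset X Y \<in> perm_obj G T"
proof (rule perm_objI)
  show "grp (sum_gset X Y) = carrier G"
    by (simp add: sum_gset_def grp_eq[OF X] grp_eq[OF Y])
  show "act (sum_gset X Y) g \<in> extensional (pts (sum_gset X Y))" for g
    by (simp add: sum_gset_def)
  show "act (sum_gset X Y) g s \<in> pts (sum_gset X Y)"
    if "g \<in> carrier G" "s \<in> pts (sum_gset X Y)" for g s
    using that(2) by (rule pts_sumE) (simp_all add: that(1) act_closed[OF X] act_closed[OF Y])
  show "act (sum_gset X Y) \<one> s = s" if "s \<in> pts (sum_gset X Y)" for s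
    using that by (rule pts_sumE) (simp_all add: act_one[OF X] act_one[OF Y])
  show "act (sum_gset X Y) (g \<otimes> h) s = act (sum_gset X Y) g (act (sum_gset X Y) h s)"
    if "g \<in> carrier G" "h \<in> carrier G" "s \<in> pts (sum_gset X Y)" for g h s
    using that(3) by (rule pts_sumE)
      (simp_all add: that(1,2) act_mult[OF X] act_mult[OF Y] act_closed[OF X] act_closed[OF Y])
  show "openin T {g \<in> carrier G. act (sum_gset X Y) g s = s}" if "s \<in> pts (sum_gset X Y)" for s
    using that by (rule pts_sumE)
      (use stabilizer_open[OF X] stabilizer_open[OF Y] in \<open>simp_all add: open_subgroup_def\<close>)
  have "orb (carrier G) (sum_gset X Y) ` pts (sum_gset X Y) \<subseteq>
      (`) InL ` orb (carrier G) X ` pts X \<union> (`) InR ` orb (carrier G) Y ` pts Y"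
  proof (rule image_subsetI)
    fix s assume "s \<in> pts (sum_gset X Y)"
    then show "orb (carrier G) (sum_gset X Y) s \<in>
        (`) InL ` orb (carrier G) X ` pts X \<union> (`) InR ` orb (carrier G) Y ` pts Y"
    proof (rule pts_sumE)
      fix x assume "s = InL x" "x \<in> pts X"
      then have "orb (carrier G) (sum_gset X Y) s = InL ` orb (carrier G) X x"
        by (simp add: orb_def image_image)
      then show ?thesis using \<open>x \<in> pts X\<close> by (intro UnI1) (simp only: imageI)
    next
      fix y assume "s = InR y" "y \<in> pts Y"
      then have "orb (carrier G) (sum_gset X Y) s = InR ` orb (carrier G) Y y"
        by (simp add: orb_def image_image)
      then show ?thesis using \<open>y \<in> pts Y\<close> by (intro UnI2) (simp only: imageI)
    qed
  qed
  then show "finite (orb (carrier G) (sum_gset X Y) ` pts (sum_gset X Y))"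
    by (rule finite_subset)
      (intro finite_UnI finite_imageI[OF finite_orbs[OF X open_subgroup_carrier]]
        finite_imageI[OF finite_orbs[OF Y open_subgroup_carrier]])
qed

fun unassoc :: "'b point \<Rightarrow> 'b point" where
  "unassoc (Pair x (Pair y z)) = Pair (Pair x y) z" | "unassoc p = p"

lemma equivariant_structure_maps:
  shows equivariant_drop_left:
      "equivariant_on (carrier G) (prod_gset (point_gset G) X) X drop_left"
    and equivariant_drop_right:
      "equivariant_on (carrier G) (prod_gset X (point_gset G)) X drop_right"
    and equivariant_reassoc:
      "equivariant_on (carrier G) (prod_gset (prod_gset X Y) Z) (prod_gset X (prod_gset Y Z)) reassoc"
    and equivariant_unassoc:
      "equivariant_on (carrier G) (prod_gset X (prod_gset Y Z)) (prod_gset (prod_gset X Y) Z) unassoc"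
    and equivariant_swap_pair:
      "equivariant_on (carrier G) (prod_gset X Y) (prod_gset Y X) swap_pair"
    and equivariant_left_unit:
      "equivariant_on (carrier G) X (prod_gset (point_gset G) X) (\<lambda>x. Pair Star x)"
    and equivariant_right_unit:
      "equivariant_on (carrier G) X (prod_gset X (point_gset G)) (\<lambda>x. Pair x Star)"
    and equivariant_InL:
      "equivariant_on (carrier G) X (sum_gset X Y) InL"
    and equivariant_InR:
      "equivariant_on (carrier G) Y (sum_gset X Y) InR"
  by (auto simp: equivariant_on_def elim!: pts_prodE)

lemma inj_structure_maps:
  shows inj_drop_left: "inj_on drop_left (pts (prod_gset (point_gset G) X))"
    and inj_drop_right: "inj_on drop_right (pts (prod_gset X (point_gset G)))"
    and inj_reassoc: "inj_on reassoc (pts (prod_gset (prod_gset X Y) Z))"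
    and inj_unassoc: "inj_on unassoc (pts (prod_gset X (prod_gset Y Z)))"
    and inj_swap_pair: "inj_on swap_pair (pts (prod_gset X Y))"
    and inj_InL: "inj_on InL A"
    and inj_InR: "inj_on InR B"
  by (auto simp: inj_on_def elim!: pts_prodE)

section \<open>Duality\<close>

definition transp :: "('g, 'x, 'c) mat \<Rightarrow> ('g, 'x, 'c) mat" where
  "transp A = \<lparr>source = target A, target = source A, entry = (\<lambda>y x. entry A x y)\<rparr>"

lemma entry_transp [simp]: "entry (transp A) y x = entry A x y"
  by (simp add: transp_def)

lemma transp_hom: "A \<in> perm_hom G X Y \<Longrightarrow> transp A \<in> perm_hom G Y X"
  by (auto simp: perm_hom_def transp_def)

text \<open>
  The indicator function of the diagonal, as a matrix with a single row. Its transpose is the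
  coevaluation.
\<close>
definition ev_mat :: "('g, ('g, 'a) univ) gset \<Rightarrow> ('g, ('g, 'a) univ, 'k) mat" where
  "ev_mat X = \<lparr>source = prod_gset X X, target = point_gset G,
    entry = (\<lambda>y p. if y = Star \<and> (\<exists>x\<in>pts X. p = Pair x x) then 1 else 0)\<rparr>"

lemma entry_ev [simp]:
  "entry (ev_mat X) Star (Pair a b) = (if a \<in> pts X \<and> a = b then 1 else 0)"
  by (auto simp: ev_mat_def)

lemma ev_hom:
  assumes X: "X \<in> perm_obj G T"
  shows "ev_mat X \<in> perm_hom G (prod_gset X X) (point_gset G)"
proof (rule perm_homI)
  fix g p and y :: "('g, 'a) univ"
  assume g: "g \<in> carrier G" and y: "y \<in> pts (point_gset G)" and "p \<in> pts (prod_gset X X)"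
  then obtain a b where p: "p = Pair a b" "a \<in> pts X" "b \<in> pts X" by (elim pts_prodE)
  then show "entry (ev_mat X) (act (point_gset G) g y) (act (prod_gset X X) g p) =
      entry (ev_mat X) y p"
    using y act_eq_iff[OF X g p(2,3)] act_closed[OF X g p(2)] by simp
qed (auto simp: ev_mat_def)

text \<open>
  Write \<open>y\<close> for the row and \<open>x\<close> for the column, and consider the contribution of
  \<open>(u, (v, w))\<close> to the product. Coevaluation requires \<open>u = v\<close> and \<open>w = x\<close>, evaluation
  requires \<open>v = w\<close>, and the identity factor requires \<open>u = y\<close>; so the integrand is supported at
  \<open>(y, (y, y))\<close>, where its value is \<open>1\<close> if \<open>x = y\<close> and \<open>0\<close> otherwise.
\<close>
lemma zigzag_left:
  assumes X: "X \<in> perm_obj G T"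
  shows "mat_comp \<mu> (mat_of_map (prod_gset X (point_gset G)) X drop_right)
    (mat_comp \<mu> (mat_tensor (mat_of_map X X id) (ev_mat X))
      (mat_comp \<mu> (mat_of_map (prod_gset (prod_gset X X) X) (prod_gset X (prod_gset X X)) reassoc)
        (mat_tensor (transp (ev_mat X)) (mat_of_map X X id)))) =
    mat_of_map (prod_gset (point_gset G) X) X drop_left"
    (is "mat_comp \<mu> ?r (mat_comp \<mu> ?e (mat_comp \<mu> ?a ?c)) = ?l")
proof (rule mat_eqI)
  note P = point_gset_obj and XX = prod_gset_obj[OF X X]
  note XP = prod_gset_obj[OF X P] and PX = prod_gset_obj[OF P X]
  note XX_X = prod_gset_obj[OF XX X] and X_XX = prod_gset_obj[OF X XX]
  note id = map_hom[OF X X equivariant_id]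
  have c: "?c \<in> perm_hom G (prod_gset (point_gset G) X) (prod_gset (prod_gset X X) X)"
    by (rule tensor_hom[OF transp_hom[OF ev_hom[OF X]] id])
  have a: "?a \<in> perm_hom G (prod_gset (prod_gset X X) X) (prod_gset X (prod_gset X X))"
    by (rule map_hom[OF XX_X X_XX equivariant_reassoc])
  have e: "?e \<in> perm_hom G (prod_gset X (prod_gset X X)) (prod_gset X (point_gset G))"
    by (rule tensor_hom[OF id ev_hom[OF X]])
  note ac = comp_hom[OF PX XX_X X_XX c a]
  note eac = comp_hom[OF PX X_XX XP ac e]
  show "mat_comp \<mu> ?r (mat_comp \<mu> ?e (mat_comp \<mu> ?a ?c)) \<in> perm_hom G (prod_gset (point_gset G) X) X"
    by (rule comp_hom[OF PX XP X eac map_hom[OF XP X equivariant_drop_right]])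
  show "?l \<in> perm_hom G (prod_gset (point_gset G) X) X" by (rule map_hom[OF PX X equivariant_drop_left])
  fix y p assume y: "y \<in> pts X" and "p \<in> pts (prod_gset (point_gset G) X)"
  then obtain x where p: "p = Pair Star x" "x \<in> pts X" by (elim pts_prodE) simp
  have mid: "entry (mat_comp \<mu> ?a ?c) (Pair u (Pair v w)) p =
      (if u = v \<and> w = x then 1 else 0)" if "u \<in> pts X" "v \<in> pts X" "w \<in> pts X" for u v w
    using comp_map_left[OF XX_X c equivariant_reassoc inj_reassoc, of "Pair (Pair u v) w" p] that p
    by (simp add: entry_map)
  have "entry (mat_comp \<mu> ?r (mat_comp \<mu> ?e (mat_comp \<mu> ?a ?c))) y p =
      entry (mat_comp \<mu> ?e (mat_comp \<mu> ?a ?c)) (Pair y Star) p"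
    using comp_map_left[OF XP eac equivariant_drop_right inj_drop_right, of "Pair y Star" p] y by simp
  also have "\<dots> = entry ?e (Pair y Star) (Pair y (Pair y y)) *
      entry (mat_comp \<mu> ?a ?c) (Pair y (Pair y y)) p"
    unfolding entry_comp[OF ac]
  proof (rule integral_point[OF X_XX])
    fix q assume q: "q \<in> pts (prod_gset X (prod_gset X X))" "q \<noteq> Pair y (Pair y y)"
    then obtain u v w where "q = Pair u (Pair v w)" "u \<in> pts X" "v \<in> pts X" "w \<in> pts X"
      by (elim pts_prodE) simp
    then show "entry ?e (Pair y Star) q * entry (mat_comp \<mu> ?a ?c) q p = 0"
      using q(2) y by (auto simp: mid entry_map)
  qed (use y in simp)
  also have "\<dots> = entry ?l y p"
    using mid[OF y y y] y p by (auto simp: entry_map)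
  finally show "entry (mat_comp \<mu> ?r (mat_comp \<mu> ?e (mat_comp \<mu> ?a ?c))) y p = entry ?l y p" .
qed

text \<open>
  As for \<open>zigzag_left\<close>, with the integrand supported at \<open>((y, y), y)\<close>.
\<close>
lemma zigzag_right:
  assumes X: "X \<in> perm_obj G T"
  shows "mat_comp \<mu> (mat_of_map (prod_gset (point_gset G) X) X drop_left)
    (mat_comp \<mu> (mat_tensor (ev_mat X) (mat_of_map X X id))
      (mat_comp \<mu> (mat_of_map (prod_gset X (prod_gset X X)) (prod_gset (prod_gset X X) X) unassoc)
        (mat_tensor (mat_of_map X X id) (transp (ev_mat X))))) =
    mat_of_map (prod_gset X (point_gset G)) X drop_right"
    (is "mat_comp \<mu> ?l (mat_comp \<mu> ?e (mat_comp \<mu> ?a ?c)) = ?r")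
proof (rule mat_eqI)
  note P = point_gset_obj and XX = prod_gset_obj[OF X X]
  note XP = prod_gset_obj[OF X P] and PX = prod_gset_obj[OF P X]
  note XX_X = prod_gset_obj[OF XX X] and X_XX = prod_gset_obj[OF X XX]
  note id = map_hom[OF X X equivariant_id]
  have c: "?c \<in> perm_hom G (prod_gset X (point_gset G)) (prod_gset X (prod_gset X X))"
    by (rule tensor_hom[OF id transp_hom[OF ev_hom[OF X]]])
  have a: "?a \<in> perm_hom G (prod_gset X (prod_gset X X)) (prod_gset (prod_gset X X) X)"
    by (rule map_hom[OF X_XX XX_X equivariant_unassoc])
  have e: "?e \<in> perm_hom G (prod_gset (prod_gset X X) X) (prod_gset (point_gset G) X)"
    by (rule tensor_hom[OF ev_hom[OF X] id])
  note ac = comp_hom[OF XP X_XX XX_X c a]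
  note eac = comp_hom[OF XP XX_X PX ac e]
  show "mat_comp \<mu> ?l (mat_comp \<mu> ?e (mat_comp \<mu> ?a ?c)) \<in> perm_hom G (prod_gset X (point_gset G)) X"
    by (rule comp_hom[OF XP PX X eac map_hom[OF PX X equivariant_drop_left]])
  show "?r \<in> perm_hom G (prod_gset X (point_gset G)) X" by (rule map_hom[OF XP X equivariant_drop_right])
  fix y p assume y: "y \<in> pts X" and "p \<in> pts (prod_gset X (point_gset G))"
  then obtain x where p: "p = Pair x Star" "x \<in> pts X" by (elim pts_prodE) simp
  have mid: "entry (mat_comp \<mu> ?a ?c) (Pair (Pair u v) w) p =
      (if v = w \<and> u = x then 1 else 0)" if "u \<in> pts X" "v \<in> pts X" "w \<in> pts X" for u v w
    using comp_map_left[OF X_XX c equivariant_unassoc inj_unassoc, of "Pair u (Pair v w)" p] that p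
    by (simp add: entry_map)
  have "entry (mat_comp \<mu> ?l (mat_comp \<mu> ?e (mat_comp \<mu> ?a ?c))) y p =
      entry (mat_comp \<mu> ?e (mat_comp \<mu> ?a ?c)) (Pair Star y) p"
    using comp_map_left[OF PX eac equivariant_drop_left inj_drop_left, of "Pair Star y" p] y by simp
  also have "\<dots> = entry ?e (Pair Star y) (Pair (Pair y y) y) *
      entry (mat_comp \<mu> ?a ?c) (Pair (Pair y y) y) p"
    unfolding entry_comp[OF ac]
  proof (rule integral_point[OF XX_X])
    fix q assume q: "q \<in> pts (prod_gset (prod_gset X X) X)" "q \<noteq> Pair (Pair y y) y"
    then obtain u v w where "q = Pair (Pair u v) w" "u \<in> pts X" "v \<in> pts X" "w \<in> pts X"
      by (elim pts_prodE) simp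
    then show "entry ?e (Pair Star y) q * entry (mat_comp \<mu> ?a ?c) q p = 0"
      using q(2) y by (auto simp: mid entry_map)
  qed (use y in simp)
  also have "\<dots> = entry ?r y p"
    using mid[OF y y y] y p by (auto simp: entry_map)
  finally show "entry (mat_comp \<mu> ?l (mat_comp \<mu> ?e (mat_comp \<mu> ?a ?c))) y p = entry ?r y p" .
qed

section \<open>The category of permutation modules\<close>

lemma Perm_simps [simp]:
  "Obj (Perm G T \<mu>) = perm_obj G T"
  "Hom (Perm G T \<mu>) = perm_hom G"
  "Comp (Perm G T \<mu>) = mat_comp \<mu>"
  "Ident (Perm G T \<mu>) X = mat_of_map X X id"
  "ZeroMor (Perm G T \<mu>) X Y = \<lparr>source = X, target = Y, entry = (\<lambda>y x. 0)\<rparr>"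
  "AddMor (Perm G T \<mu>) A B = A\<lparr>entry := (\<lambda>y x. entry A y x + entry B y x)\<rparr>"
  "ScaleMor (Perm G T \<mu>) c A = A\<lparr>entry := (\<lambda>y x. c * entry A y x)\<rparr>"
  "TensorObj (Perm G T \<mu>) = prod_gset"
  "TensorMor (Perm G T \<mu>) = mat_tensor"
  "UnitObj (Perm G T \<mu>) = point_gset G"
  "Lunit (Perm G T \<mu>) X = mat_of_map (prod_gset (point_gset G) X) X drop_left"
  "Runit (Perm G T \<mu>) X = mat_of_map (prod_gset X (point_gset G)) X drop_right"
  "Assoc (Perm G T \<mu>) X Y Z =
    mat_of_map (prod_gset (prod_gset X Y) Z) (prod_gset X (prod_gset Y Z)) reassoc"
  "Braid (Perm G T \<mu>) X Y = mat_of_map (prod_gset X Y) (prod_gset Y X) swap_pair"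
  by (simp_all add: Perm_def)

lemma comp_id_left:
  assumes X: "X \<in> perm_obj G T" and Y: "Y \<in> perm_obj G T" and A: "A \<in> perm_hom G X Y"
  shows "mat_comp \<mu> (mat_of_map Y Y id) A = A"
proof (rule mat_eqI[OF comp_hom[OF X Y Y A map_hom[OF Y Y equivariant_id]] A])
  show "entry (mat_comp \<mu> (mat_of_map Y Y id) A) y x = entry A y x" if "y \<in> pts Y" for y x
    using comp_map_left[OF Y A equivariant_id inj_on_id that] by simp
qed

lemma comp_id_right:
  assumes X: "X \<in> perm_obj G T" and Y: "Y \<in> perm_obj G T" and A: "A \<in> perm_hom G X Y"
  shows "mat_comp \<mu> A (mat_of_map X X id) = A"
proof (rule mat_eqI[OF comp_hom[OF X X Y map_hom[OF X X equivariant_id] A] A])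
  show "entry (mat_comp \<mu> A (mat_of_map X X id)) y x = entry A y x" if "x \<in> pts X" for y x
    using comp_map_right[OF X X equivariant_id that] by simp
qed

lemma category_Perm: "category (Perm G T \<mu>)"
  by (rule category.intro)
    (simp_all add: map_hom equivariant_id comp_hom comp_id_left comp_id_right comp_assoc_mat)

lemma add_hom:
  fixes A B :: "('g, 'x, 'c::{comm_ring}) mat"
  assumes "A \<in> perm_hom G X Y" "B \<in> perm_hom G X Y"
  shows "A\<lparr>entry := (\<lambda>y x. entry A y x + entry B y x)\<rparr> \<in> perm_hom G X Y"
  using assms by (auto simp: perm_hom_def)

lemma scale_hom:
  fixes A :: "('g, 'x, 'c::{comm_ring}) mat"
  assumes "A \<in> perm_hom G X Y"
  shows "A\<lparr>entry := (\<lambda>y x. c * entry A y x)\<rparr> \<in> perm_hom G X Y"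
  using assms by (auto simp: perm_hom_def)

text \<open>
  The ring may be the zero ring, so the axioms are checked from the sort of \<open>'k\<close> rather than
  obtained from a class that contains \<open>1 \<noteq> 0\<close>.
\<close>
lemma cring_scalar_ring: "cring (scalar_ring :: 'k ring)"
proof (rule cringI)
  show "abelian_group (scalar_ring :: 'k ring)"
    by (rule abelian_groupI)
      (auto simp: scalar_ring_def algebra_simps intro: exI[of _ "- x" for x])
  show "Group.comm_monoid (scalar_ring :: 'k ring)"
    by (rule comm_monoidI) (auto simp: scalar_ring_def algebra_simps)
qed (auto simp: scalar_ring_def algebra_simps)

lemma hom_module_Perm:
  "Module.module (scalar_ring :: 'k ring) (hom_module (Perm G T \<mu>) X Y)"
proof (rule moduleI[OF cring_scalar_ring])
  show "abelian_group (hom_module (Perm G T \<mu>) X Y)"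
  proof (rule abelian_groupI)
    fix A assume "A \<in> carrier (hom_module (Perm G T \<mu>) X Y)"
    then have A: "A \<in> perm_hom G X Y" by (simp add: hom_module_def)
    let ?B = "A\<lparr>entry := (\<lambda>y x. - entry A y x)\<rparr>"
    have "?B \<in> carrier (hom_module (Perm G T \<mu>) X Y)"
      using A by (simp add: hom_module_def perm_hom_def)
    moreover have "?B \<oplus>\<^bsub>hom_module (Perm G T \<mu>) X Y\<^esub> A = \<zero>\<^bsub>hom_module (Perm G T \<mu>) X Y\<^esub>"
      using A by (simp add: hom_module_def perm_hom_def)
    ultimately show "\<exists>B\<in>carrier (hom_module (Perm G T \<mu>) X Y).
        B \<oplus>\<^bsub>hom_module (Perm G T \<mu>) X Y\<^esub> A = \<zero>\<^bsub>hom_module (Perm G T \<mu>) X Y\<^esub>" by blast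
  qed (auto simp: hom_module_def perm_hom_def algebra_simps)
qed (auto simp: hom_module_def scalar_ring_def perm_hom_def algebra_simps)

lemma linear_category_Perm: "linear_category (Perm G T \<mu>)"
proof (intro linear_category.intro linear_category_axioms.intro)
  show "category (Perm G T \<mu>)" by (rule category_Perm)
  show "Module.module (scalar_ring :: 'k ring) (hom_module (Perm G T \<mu>) X Y)" for X Y
    by (rule hom_module_Perm)
next
  fix X Y Z A B B'
  assume "X \<in> Obj (Perm G T \<mu>)" "Y \<in> Obj (Perm G T \<mu>)" "Z \<in> Obj (Perm G T \<mu>)"
    "A \<in> Hom (Perm G T \<mu>) X Y" "B \<in> Hom (Perm G T \<mu>) Y Z" "B' \<in> Hom (Perm G T \<mu>) Y Z"
  then have X: "X \<in> perm_obj G T" and Y: "Y \<in> perm_obj G T" and Z: "Z \<in> perm_obj G T"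
    and A: "A \<in> perm_hom G X Y" and B: "B \<in> perm_hom G Y Z" and B': "B' \<in> perm_hom G Y Z"
    by simp_all
  have "mat_comp \<mu> (B\<lparr>entry := \<lambda>y x. entry B y x + entry B' y x\<rparr>) A =
      (mat_comp \<mu> B A)\<lparr>entry := \<lambda>y x. entry (mat_comp \<mu> B A) y x + entry (mat_comp \<mu> B' A) y x\<rparr>"
  proof (rule mat_eqI[OF comp_hom[OF X Y Z A add_hom[OF B B']]
        add_hom[OF comp_hom[OF X Y Z A B] comp_hom[OF X Y Z A B']]])
    fix z x assume z: "z \<in> pts Z" and x: "x \<in> pts X"
    show "entry (mat_comp \<mu> (B\<lparr>entry := \<lambda>y x. entry B y x + entry B' y x\<rparr>) A) z x =
        entry ((mat_comp \<mu> B A)\<lparr>entry := \<lambda>y x. entry (mat_comp \<mu> B A) y x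
          + entry (mat_comp \<mu> B' A) y x\<rparr>) z x"
      using integral_add[OF Y smooth_mult[OF smooth_row[OF Z B z] smooth_column[OF X A x]]
          smooth_mult[OF smooth_row[OF Z B' z] smooth_column[OF X A x]]]
      by (simp add: entry_comp[OF A] distrib_right)
  qed
  then show "Comp (Perm G T \<mu>) (AddMor (Perm G T \<mu>) B B') A =
      AddMor (Perm G T \<mu>) (Comp (Perm G T \<mu>) B A) (Comp (Perm G T \<mu>) B' A)" by simp
next
  fix X Y Z A A' B
  assume "X \<in> Obj (Perm G T \<mu>)" "Y \<in> Obj (Perm G T \<mu>)" "Z \<in> Obj (Perm G T \<mu>)"
    "A \<in> Hom (Perm G T \<mu>) X Y" "A' \<in> Hom (Perm G T \<mu>) X Y" "B \<in> Hom (Perm G T \<mu>) Y Z"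
  then have X: "X \<in> perm_obj G T" and Y: "Y \<in> perm_obj G T" and Z: "Z \<in> perm_obj G T"
    and A: "A \<in> perm_hom G X Y" and A': "A' \<in> perm_hom G X Y" and B: "B \<in> perm_hom G Y Z"
    by simp_all
  have "mat_comp \<mu> B (A\<lparr>entry := \<lambda>y x. entry A y x + entry A' y x\<rparr>) =
      (mat_comp \<mu> B A)\<lparr>entry := \<lambda>y x. entry (mat_comp \<mu> B A) y x + entry (mat_comp \<mu> B A') y x\<rparr>"
  proof (rule mat_eqI[OF comp_hom[OF X Y Z add_hom[OF A A'] B]
        add_hom[OF comp_hom[OF X Y Z A B] comp_hom[OF X Y Z A' B]]])
    fix z x assume z: "z \<in> pts Z" and x: "x \<in> pts X"
    show "entry (mat_comp \<mu> B (A\<lparr>entry := \<lambda>y x. entry A y x + entry A' y x\<rparr>)) z x =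
        entry ((mat_comp \<mu> B A)\<lparr>entry := \<lambda>y x. entry (mat_comp \<mu> B A) y x
          + entry (mat_comp \<mu> B A') y x\<rparr>) z x"
      using integral_add[OF Y smooth_mult[OF smooth_row[OF Z B z] smooth_column[OF X A x]]
          smooth_mult[OF smooth_row[OF Z B z] smooth_column[OF X A' x]]]
      by (simp add: entry_comp[OF A] entry_comp[OF A'] entry_comp[OF add_hom[OF A A']] distrib_left)
  qed
  then show "Comp (Perm G T \<mu>) B (AddMor (Perm G T \<mu>) A A') =
      AddMor (Perm G T \<mu>) (Comp (Perm G T \<mu>) B A) (Comp (Perm G T \<mu>) B A')" by simp
next
  fix X Y Z A B and c :: 'k
  assume "X \<in> Obj (Perm G T \<mu>)" "Y \<in> Obj (Perm G T \<mu>)" "Z \<in> Obj (Perm G T \<mu>)"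
    "A \<in> Hom (Perm G T \<mu>) X Y" "B \<in> Hom (Perm G T \<mu>) Y Z"
  then have X: "X \<in> perm_obj G T" and Y: "Y \<in> perm_obj G T" and Z: "Z \<in> perm_obj G T"
    and A: "A \<in> perm_hom G X Y" and B: "B \<in> perm_hom G Y Z"
    by simp_all
  note cBA = scale_hom[OF comp_hom[OF X Y Z A B], of c]
  have scale: "c * entry (mat_comp \<mu> B A) z x =
      integral \<mu> Y (\<lambda>y. c * (entry B z y * entry A y x))"
    if z: "z \<in> pts Z" and x: "x \<in> pts X" for z x
    unfolding entry_comp[OF A]
    by (rule integral_scale[OF Y smooth_mult[OF smooth_row[OF Z B z] smooth_column[OF X A x]],
          symmetric])
  have "mat_comp \<mu> (B\<lparr>entry := \<lambda>y x. c * entry B y x\<rparr>) A =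
      (mat_comp \<mu> B A)\<lparr>entry := \<lambda>y x. c * entry (mat_comp \<mu> B A) y x\<rparr>"
    by (rule mat_eqI[OF comp_hom[OF X Y Z A scale_hom[OF B]] cBA])
      (simp add: scale, simp add: entry_comp[OF A] mult.assoc)
  then show "Comp (Perm G T \<mu>) (ScaleMor (Perm G T \<mu>) c B) A =
      ScaleMor (Perm G T \<mu>) c (Comp (Perm G T \<mu>) B A)" by simp
  have "mat_comp \<mu> B (A\<lparr>entry := \<lambda>y x. c * entry A y x\<rparr>) =
      (mat_comp \<mu> B A)\<lparr>entry := \<lambda>y x. c * entry (mat_comp \<mu> B A) y x\<rparr>"
    by (rule mat_eqI[OF comp_hom[OF X Y Z scale_hom[OF A] B] cBA])
      (simp add: scale, simp add: entry_comp[OF scale_hom[OF A]] mult.left_commute)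
  then show "Comp (Perm G T \<mu>) B (ScaleMor (Perm G T \<mu>) c A) =
      ScaleMor (Perm G T \<mu>) c (Comp (Perm G T \<mu>) B A)" by simp
qed

text \<open>
  A matrix with no rows or no columns has no entries.
\<close>
lemma zero_object_Perm: "zero_object (Perm G T \<mu>) empty_gset"
proof -
  have unique: "\<exists>!A :: ('g, ('g, 'a) univ, 'k) mat. A \<in> perm_hom G X Y"
    if "pts X = {} \<or> pts Y = {}" for X Y :: "('g, ('g, 'a) univ) gset"
  proof (rule ex1I)
    show "\<lparr>source = X, target = Y, entry = (\<lambda>y x. 0 :: 'k)\<rparr> \<in> perm_hom G X Y"
      by (simp add: perm_hom_def)
    show "A = \<lparr>source = X, target = Y, entry = (\<lambda>y x. 0 :: 'k)\<rparr>" if A: "A \<in> perm_hom G X Y" for A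
      by (rule mat_eqI[OF A]) (use \<open>pts X = {} \<or> pts Y = {}\<close> in \<open>auto simp: perm_hom_def\<close>)
  qed
  have "pts (empty_gset :: ('g, ('g, 'a) univ) gset) = {}" by (simp add: empty_gset_def)
  then show ?thesis
    unfolding zero_object_def using unique by (simp add: empty_gset_obj)
qed

text \<open>
  In block form: \<open>i\<close> and \<open>j\<close> are the two block columns of the identity matrix of the
  disjoint union. The products with \<open>i\<close> and \<open>j\<close> only relabel entries, since the inclusions
  are injective.
\<close>
lemma biproduct_Perm:
  assumes X: "X \<in> perm_obj G T" and Y: "Y \<in> perm_obj G T"
  defines "S \<equiv> sum_gset X Y"
  defines "i \<equiv> mat_of_map X S InL" and "j \<equiv> mat_of_map Y S InR"
  shows "is_biproduct (Perm G T \<mu>) X Y S i j (transp i) (transp j)"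
proof -
  have S: "S \<in> perm_obj G T" unfolding S_def by (rule sum_gset_obj[OF X Y])
  have L: "equivariant_on (carrier G) X S InL" and R: "equivariant_on (carrier G) Y S InR"
    unfolding S_def by (rule equivariant_structure_maps)+
  have i: "i \<in> perm_hom G X S" and j: "j \<in> perm_hom G Y S"
    unfolding i_def j_def by (rule map_hom[OF X S L] map_hom[OF Y S R])+
  note p = transp_hom[OF i] and q = transp_hom[OF j]
  have entry_i: "entry i s x = (if x \<in> pts X \<and> s = InL x then 1 else 0)" for s x
    using equivariantD(1)[OF L] by (auto simp: i_def entry_map)
  have entry_j: "entry j s y = (if y \<in> pts Y \<and> s = InR y then 1 else 0)" for s y
    using equivariantD(1)[OF R] by (auto simp: j_def entry_map)
  have right_i: "entry (mat_comp \<mu> B i) z x = entry B z (InL x)" if "x \<in> pts X" for B z x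
    unfolding i_def by (rule comp_map_right[OF X S L that])
  have right_j: "entry (mat_comp \<mu> B j) z y = entry B z (InR y)" if "y \<in> pts Y" for B z y
    unfolding j_def by (rule comp_map_right[OF Y S R that])
  have zero: "\<lparr>source = V, target = W, entry = (\<lambda>y x. 0 :: 'k)\<rparr> \<in> perm_hom G V W"
    for V W :: "('g, ('g, 'a) univ) gset"
    by (simp add: perm_hom_def)
  have pi: "mat_comp \<mu> (transp i) i = mat_of_map X X id"
    by (rule mat_eqI[OF comp_hom[OF X S X i p] map_hom[OF X X equivariant_id]])
      (auto simp: right_i entry_i entry_map)
  have qj: "mat_comp \<mu> (transp j) j = mat_of_map Y Y id"
    by (rule mat_eqI[OF comp_hom[OF Y S Y j q] map_hom[OF Y Y equivariant_id]])
      (auto simp: right_j entry_j entry_map)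
  have pj: "mat_comp \<mu> (transp i) j = \<lparr>source = Y, target = X, entry = (\<lambda>y x. 0)\<rparr>"
    by (rule mat_eqI[OF comp_hom[OF Y S X j p] zero]) (auto simp: right_j entry_i)
  have qi: "mat_comp \<mu> (transp j) i = \<lparr>source = X, target = Y, entry = (\<lambda>y x. 0)\<rparr>"
    by (rule mat_eqI[OF comp_hom[OF X S Y i q] zero]) (auto simp: right_i entry_j)
  note ip = comp_hom[OF S X S p i] and jq = comp_hom[OF S Y S q j]
  have ip_L: "entry (mat_comp \<mu> i (transp i)) (InL x) s = entry i s x" if "x \<in> pts X" for x s
    using comp_map_left[OF X p L inj_InL that] by (simp add: i_def)
  have jq_R: "entry (mat_comp \<mu> j (transp j)) (InR y) s = entry j s y" if "y \<in> pts Y" for y s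
    using comp_map_left[OF Y q R inj_InR that] by (simp add: j_def)
  have ip_R: "entry (mat_comp \<mu> i (transp i)) (InR y) s = 0" for y s
    by (simp add: entry_comp[OF p] entry_i integral_zero)
  have jq_L: "entry (mat_comp \<mu> j (transp j)) (InL x) s = 0" for x s
    by (simp add: entry_comp[OF q] entry_j integral_zero)
  have "(mat_comp \<mu> i (transp i))\<lparr>entry := \<lambda>y x. entry (mat_comp \<mu> i (transp i)) y x
      + entry (mat_comp \<mu> j (transp j)) y x\<rparr> = mat_of_map S S id"
  proof (rule mat_eqI[OF add_hom[OF ip jq] map_hom[OF S S equivariant_id]])
    fix t s assume t: "t \<in> pts S" and s: "s \<in> pts S"
    from t[unfolded S_def]
    show "entry ((mat_comp \<mu> i (transp i))\<lparr>entry := \<lambda>y x. entry (mat_comp \<mu> i (transp i)) y x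
        + entry (mat_comp \<mu> j (transp j)) y x\<rparr>) t s = entry (mat_of_map S S id) t s"
      using s t by (elim pts_sumE) (auto simp: ip_L ip_R jq_L jq_R entry_i entry_j entry_map)
  qed
  then show ?thesis
    using S i j p q pi qj pj qi by (simp add: is_biproduct_def)
qed

lemma additive_Perm: "additive_linear_category (Perm G T \<mu>)"
  using zero_object_Perm biproduct_Perm
  by (intro additive_linear_category.intro linear_category_Perm
      additive_linear_category_axioms.intro) (blast, simp, blast)

section \<open>The symmetric monoidal structure\<close>

lemma map_inverse_arrows:
  assumes X: "X \<in> perm_obj G T" and Y: "Y \<in> perm_obj G T"
    and f: "equivariant_on (carrier G) X Y f" and h: "equivariant_on (carrier G) Y X h"
    and "\<And>x. x \<in> pts X \<Longrightarrow> h (f x) = x" "\<And>y. y \<in> pts Y \<Longrightarrow> f (h y) = y"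
  shows "inverse_arrows (Perm G T \<mu>) X Y (mat_of_map X Y f) (mat_of_map Y X h)"
  using map_hom[OF X Y f] map_hom[OF Y X h] comp_map_map[OF X Y X f h] comp_map_map[OF Y X Y h f]
    map_cong[of X "\<lambda>x. h (f x)" id X] map_cong[of Y "\<lambda>y. f (h y)" id Y] assms(5,6)
  by (simp add: inverse_arrows_def)

lemma iso_arrowI: "inverse_arrows C X Y f h \<Longrightarrow> iso_arrow C X Y f"
  by (auto simp: iso_arrow_def)

lemma assoc_inverse_arrows:
  assumes "X \<in> perm_obj G T" "Y \<in> perm_obj G T" "Z \<in> perm_obj G T"
  shows "inverse_arrows (Perm G T \<mu>) (prod_gset (prod_gset X Y) Z) (prod_gset X (prod_gset Y Z))
    (mat_of_map (prod_gset (prod_gset X Y) Z) (prod_gset X (prod_gset Y Z)) reassoc)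
    (mat_of_map (prod_gset X (prod_gset Y Z)) (prod_gset (prod_gset X Y) Z) unassoc)"
  by (rule map_inverse_arrows)
    (auto intro: prod_gset_obj assms equivariant_structure_maps elim!: pts_prodE)

lemma comp_map_map_map:
  assumes W: "W \<in> perm_obj G T" and X: "X \<in> perm_obj G T" and Y: "Y \<in> perm_obj G T"
    and Z: "Z \<in> perm_obj G T"
    and f: "equivariant_on (carrier G) W X f" and f': "equivariant_on (carrier G) X Y f'"
    and f'': "equivariant_on (carrier G) Y Z f''"
  shows "mat_comp \<mu> (mat_of_map Y Z f'') (mat_comp \<mu> (mat_of_map X Y f') (mat_of_map W X f)) =
    mat_of_map W Z (\<lambda>x. f'' (f' (f x)))"
  by (simp only: comp_map_map[OF W X Y f f'] comp_map_map[OF W Y Z equivariant_comp[OF f f'] f''])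

text \<open>
  The identities between structure morphisms become identities of maps by \<open>tensor_map\<close> and
  \<open>comp_map_map\<close>. In each naturality square the structure morphisms relabel the rows on one side
  and the columns on the other, and the two results are compared entry by entry.
\<close>
lemma symmetric_monoidal_Perm: "symmetric_monoidal_category (Perm G T \<mu>)"
proof (intro symmetric_monoidal_category.intro category_Perm symmetric_monoidal_category_axioms.intro,
    unfold Perm_simps)
  note P = point_gset_obj and prod = prod_gset_obj
  fix X Y Z :: "('g, ('g, 'a) univ) gset"
  assume X: "X \<in> perm_obj G T"
  show "iso_arrow (Perm G T \<mu>) (prod_gset (point_gset G) X) X
      (mat_of_map (prod_gset (point_gset G) X) X drop_left)"
    by (rule iso_arrowI, rule map_inverse_arrows[OF prod[OF P X] X equivariant_drop_left
          equivariant_left_unit]) (auto elim!: pts_prodE)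
  show "iso_arrow (Perm G T \<mu>) (prod_gset X (point_gset G)) X
      (mat_of_map (prod_gset X (point_gset G)) X drop_right)"
    by (rule iso_arrowI, rule map_inverse_arrows[OF prod[OF X P] X equivariant_drop_right
          equivariant_right_unit]) (auto elim!: pts_prodE)
  assume Y: "Y \<in> perm_obj G T"
  show "prod_gset X Y \<in> perm_obj G T" by (rule prod[OF X Y])
  show "mat_tensor (mat_of_map X X id) (mat_of_map Y Y id) =
      mat_of_map (prod_gset X Y) (prod_gset X Y) id"
    unfolding tensor_map by (rule map_cong) (auto elim!: pts_prodE)
  show "iso_arrow (Perm G T \<mu>) (prod_gset X Y) (prod_gset Y X)
      (mat_of_map (prod_gset X Y) (prod_gset Y X) swap_pair)"
    by (rule iso_arrowI, rule map_inverse_arrows[OF prod[OF X Y] prod[OF Y X] equivariant_swap_pair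
          equivariant_swap_pair])
      (auto elim!: pts_prodE)
  show "mat_comp \<mu> (mat_of_map (prod_gset Y X) (prod_gset X Y) swap_pair)
      (mat_of_map (prod_gset X Y) (prod_gset Y X) swap_pair) =
      mat_of_map (prod_gset X Y) (prod_gset X Y) id"
    unfolding comp_map_map[OF prod[OF X Y] prod[OF Y X] prod[OF X Y] equivariant_swap_pair
          equivariant_swap_pair]
    by (rule map_cong) (auto elim!: pts_prodE)
  show "mat_comp \<mu> (mat_tensor (mat_of_map X X id)
        (mat_of_map (prod_gset (point_gset G) Y) Y drop_left))
      (mat_of_map (prod_gset (prod_gset X (point_gset G)) Y)
        (prod_gset X (prod_gset (point_gset G) Y)) reassoc) =
      mat_tensor (mat_of_map (prod_gset X (point_gset G)) X drop_right) (mat_of_map Y Y id)"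
    unfolding tensor_map comp_map_map[OF prod[OF prod[OF X P] Y] prod[OF X prod[OF P Y]] prod[OF X Y]
        equivariant_reassoc equivariant_map_pair[OF equivariant_id equivariant_drop_left]]
    by (rule map_cong) (auto elim!: pts_prodE)
  {
    fix A :: "('g, ('g, 'a) univ, 'k) mat" assume A: "A \<in> perm_hom G X Y"
    have idA: "mat_tensor (mat_of_map (point_gset G) (point_gset G) id) A \<in>
        perm_hom G (prod_gset (point_gset G) X) (prod_gset (point_gset G) Y)"
      by (rule tensor_hom[OF map_hom[OF P P equivariant_id] A])
    show "mat_comp \<mu> (mat_of_map (prod_gset (point_gset G) Y) Y drop_left)
        (mat_tensor (mat_of_map (point_gset G) (point_gset G) id) A) =
        mat_comp \<mu> A (mat_of_map (prod_gset (point_gset G) X) X drop_left)" (is "?L = ?R")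
    proof (rule mat_eqI)
      show "?L \<in> perm_hom G (prod_gset (point_gset G) X) Y"
        by (rule comp_hom[OF prod[OF P X] prod[OF P Y] Y idA
            map_hom[OF prod[OF P Y] Y equivariant_drop_left]])
      show "?R \<in> perm_hom G (prod_gset (point_gset G) X) Y"
        by (rule comp_hom[OF prod[OF P X] X Y map_hom[OF prod[OF P X] X equivariant_drop_left] A])
      fix y p assume y: "y \<in> pts Y" and p: "p \<in> pts (prod_gset (point_gset G) X)"
      then obtain x where x: "p = Pair Star x" "x \<in> pts X" by (elim pts_prodE) simp
      show "entry ?L y p = entry ?R y p"
        using comp_map_left[OF prod[OF P Y] idA equivariant_drop_left inj_drop_left, of "Pair Star y" p]
          comp_map_right[OF prod[OF P X] X equivariant_drop_left p] x y
        by (simp add: entry_map)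
    qed
    have Aid: "mat_tensor A (mat_of_map (point_gset G) (point_gset G) id) \<in>
        perm_hom G (prod_gset X (point_gset G)) (prod_gset Y (point_gset G))"
      by (rule tensor_hom[OF A map_hom[OF P P equivariant_id]])
    show "mat_comp \<mu> (mat_of_map (prod_gset Y (point_gset G)) Y drop_right)
        (mat_tensor A (mat_of_map (point_gset G) (point_gset G) id)) =
        mat_comp \<mu> A (mat_of_map (prod_gset X (point_gset G)) X drop_right)" (is "?L = ?R")
    proof (rule mat_eqI)
      show "?L \<in> perm_hom G (prod_gset X (point_gset G)) Y"
        by (rule comp_hom[OF prod[OF X P] prod[OF Y P] Y Aid
            map_hom[OF prod[OF Y P] Y equivariant_drop_right]])
      show "?R \<in> perm_hom G (prod_gset X (point_gset G)) Y"
        by (rule comp_hom[OF prod[OF X P] X Y map_hom[OF prod[OF X P] X equivariant_drop_right] A])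
      fix y p assume y: "y \<in> pts Y" and p: "p \<in> pts (prod_gset X (point_gset G))"
      then obtain x where x: "p = Pair x Star" "x \<in> pts X" by (elim pts_prodE) simp
      show "entry ?L y p = entry ?R y p"
        using comp_map_left[OF prod[OF Y P] Aid equivariant_drop_right inj_drop_right, of "Pair y Star" p]
          comp_map_right[OF prod[OF X P] X equivariant_drop_right p] x y
        by (simp add: entry_map)
    qed
  }
  assume Z: "Z \<in> perm_obj G T"
  show "iso_arrow (Perm G T \<mu>) (prod_gset (prod_gset X Y) Z) (prod_gset X (prod_gset Y Z))
      (mat_of_map (prod_gset (prod_gset X Y) Z) (prod_gset X (prod_gset Y Z)) reassoc)"
    by (rule iso_arrowI[OF assoc_inverse_arrows[OF X Y Z]])
  show "mat_comp \<mu> (mat_of_map (prod_gset (prod_gset Y Z) X) (prod_gset Y (prod_gset Z X)) reassoc)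
      (mat_comp \<mu> (mat_of_map (prod_gset X (prod_gset Y Z)) (prod_gset (prod_gset Y Z) X) swap_pair)
        (mat_of_map (prod_gset (prod_gset X Y) Z) (prod_gset X (prod_gset Y Z)) reassoc)) =
      mat_comp \<mu> (mat_tensor (mat_of_map Y Y id) (mat_of_map (prod_gset X Z) (prod_gset Z X) swap_pair))
      (mat_comp \<mu> (mat_of_map (prod_gset (prod_gset Y X) Z) (prod_gset Y (prod_gset X Z)) reassoc)
        (mat_tensor (mat_of_map (prod_gset X Y) (prod_gset Y X) swap_pair) (mat_of_map Z Z id)))"
    unfolding tensor_map
      comp_map_map_map[OF prod[OF prod[OF X Y] Z] prod[OF X prod[OF Y Z]] prod[OF prod[OF Y Z] X]
        prod[OF Y prod[OF Z X]] equivariant_reassoc equivariant_swap_pair equivariant_reassoc]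
      comp_map_map_map[OF prod[OF prod[OF X Y] Z] prod[OF prod[OF Y X] Z] prod[OF Y prod[OF X Z]]
        prod[OF Y prod[OF Z X]] equivariant_map_pair[OF equivariant_swap_pair equivariant_id] equivariant_reassoc
        equivariant_map_pair[OF equivariant_id equivariant_swap_pair]]
    by (rule map_cong) (auto elim!: pts_prodE)
next
  note prod = prod_gset_obj
  fix W X Y Z :: "('g, ('g, 'a) univ) gset"
  assume W: "W \<in> perm_obj G T" and X: "X \<in> perm_obj G T" and Y: "Y \<in> perm_obj G T"
    and Z: "Z \<in> perm_obj G T"
  show "mat_comp \<mu>
      (mat_of_map (prod_gset (prod_gset W X) (prod_gset Y Z)) (prod_gset W (prod_gset X (prod_gset Y Z)))
        reassoc)
      (mat_of_map (prod_gset (prod_gset (prod_gset W X) Y) Z) (prod_gset (prod_gset W X) (prod_gset Y Z))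
        reassoc) =
      mat_comp \<mu> (mat_tensor (mat_of_map W W id)
        (mat_of_map (prod_gset (prod_gset X Y) Z) (prod_gset X (prod_gset Y Z)) reassoc))
      (mat_comp \<mu> (mat_of_map (prod_gset (prod_gset W (prod_gset X Y)) Z)
          (prod_gset W (prod_gset (prod_gset X Y) Z)) reassoc)
        (mat_tensor (mat_of_map (prod_gset (prod_gset W X) Y) (prod_gset W (prod_gset X Y)) reassoc)
          (mat_of_map Z Z id)))"
    unfolding tensor_map
      comp_map_map[OF prod[OF prod[OF prod[OF W X] Y] Z] prod[OF prod[OF W X] prod[OF Y Z]]
        prod[OF W prod[OF X prod[OF Y Z]]] equivariant_reassoc equivariant_reassoc]
      comp_map_map_map[OF prod[OF prod[OF prod[OF W X] Y] Z] prod[OF prod[OF W prod[OF X Y]] Z]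
        prod[OF W prod[OF prod[OF X Y] Z]] prod[OF W prod[OF X prod[OF Y Z]]]
        equivariant_map_pair[OF equivariant_reassoc equivariant_id] equivariant_reassoc
        equivariant_map_pair[OF equivariant_id equivariant_reassoc]]
    by (rule map_cong) (auto elim!: pts_prodE)
next
  note prod = prod_gset_obj
  fix X Y X' Y' :: "('g, ('g, 'a) univ) gset" and A B :: "('g, ('g, 'a) univ, 'k) mat"
  assume X: "X \<in> perm_obj G T" and Y: "Y \<in> perm_obj G T" and X': "X' \<in> perm_obj G T"
    and Y': "Y' \<in> perm_obj G T"
  show "mat_tensor A B \<in> perm_hom G (prod_gset X X') (prod_gset Y Y')"
    if "A \<in> perm_hom G X Y" "B \<in> perm_hom G X' Y'" by (rule tensor_hom[OF that])
  assume A: "A \<in> perm_hom G X X'" and B: "B \<in> perm_hom G Y Y'"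
  note AB = tensor_hom[OF A B] and BA = tensor_hom[OF B A]
  show "mat_comp \<mu> (mat_of_map (prod_gset X' Y') (prod_gset Y' X') swap_pair) (mat_tensor A B) =
      mat_comp \<mu> (mat_tensor B A) (mat_of_map (prod_gset X Y) (prod_gset Y X) swap_pair)"
    (is "?L = ?R")
  proof (rule mat_eqI)
    show "?L \<in> perm_hom G (prod_gset X Y) (prod_gset Y' X')"
      by (rule comp_hom[OF prod[OF X Y] prod[OF X' Y'] prod[OF Y' X'] AB
            map_hom[OF prod[OF X' Y'] prod[OF Y' X'] equivariant_swap_pair]])
    show "?R \<in> perm_hom G (prod_gset X Y) (prod_gset Y' X')"
      by (rule comp_hom[OF prod[OF X Y] prod[OF Y X] prod[OF Y' X']
            map_hom[OF prod[OF X Y] prod[OF Y X] equivariant_swap_pair] BA])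
    fix q p assume "q \<in> pts (prod_gset Y' X')" and p: "p \<in> pts (prod_gset X Y)"
    then obtain y' x' x y where q: "q = Pair y' x'" "y' \<in> pts Y'" "x' \<in> pts X'"
      and x: "p = Pair x y" by (elim pts_prodE) blast
    show "entry ?L q p = entry ?R q p"
      using comp_map_left[OF prod[OF X' Y'] AB equivariant_swap_pair inj_swap_pair, of "Pair x' y'" p]
        comp_map_right[OF prod[OF X Y] prod[OF Y X] equivariant_swap_pair p] x q
      by (simp add: mult.commute)
  qed
next
  note prod = prod_gset_obj
  fix X Y Z X' Y' Z' :: "('g, ('g, 'a) univ) gset" and A B C :: "('g, ('g, 'a) univ, 'k) mat"
  assume X: "X \<in> perm_obj G T" and Y: "Y \<in> perm_obj G T" and Z: "Z \<in> perm_obj G T"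
    and X': "X' \<in> perm_obj G T" and Y': "Y' \<in> perm_obj G T" and Z': "Z' \<in> perm_obj G T"
    and A: "A \<in> perm_hom G X X'" and B: "B \<in> perm_hom G Y Y'" and C: "C \<in> perm_hom G Z Z'"
  note AB_C = tensor_hom[OF tensor_hom[OF A B] C] and A_BC = tensor_hom[OF A tensor_hom[OF B C]]
  note XYZ = prod[OF prod[OF X Y] Z] prod[OF X prod[OF Y Z]]
  note XYZ' = prod[OF prod[OF X' Y'] Z'] prod[OF X' prod[OF Y' Z']]
  show "mat_comp \<mu> (mat_of_map (prod_gset (prod_gset X' Y') Z') (prod_gset X' (prod_gset Y' Z')) reassoc)
      (mat_tensor (mat_tensor A B) C) =
      mat_comp \<mu> (mat_tensor A (mat_tensor B C))
      (mat_of_map (prod_gset (prod_gset X Y) Z) (prod_gset X (prod_gset Y Z)) reassoc)" (is "?L = ?R")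
  proof (rule mat_eqI)
    show "?L \<in> perm_hom G (prod_gset (prod_gset X Y) Z) (prod_gset X' (prod_gset Y' Z'))"
      by (rule comp_hom[OF XYZ(1) XYZ' AB_C map_hom[OF XYZ' equivariant_reassoc]])
    show "?R \<in> perm_hom G (prod_gset (prod_gset X Y) Z) (prod_gset X' (prod_gset Y' Z'))"
      by (rule comp_hom[OF XYZ XYZ'(2) map_hom[OF XYZ equivariant_reassoc] A_BC])
    fix q p assume "q \<in> pts (prod_gset X' (prod_gset Y' Z'))"
      and p: "p \<in> pts (prod_gset (prod_gset X Y) Z)"
    then obtain x' y' z' x y z where q: "q = Pair x' (Pair y' z')"
      "x' \<in> pts X'" "y' \<in> pts Y'" "z' \<in> pts Z'"
      and x: "p = Pair (Pair x y) z" by (elim pts_prodE) blast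
    show "entry ?L q p = entry ?R q p"
      using comp_map_left[OF XYZ'(1) AB_C equivariant_reassoc inj_reassoc, of "Pair (Pair x' y') z'" p]
        comp_map_right[OF XYZ equivariant_reassoc p] x q
      by (simp add: mult.assoc)
  qed
qed (use tensor_comp_mat point_gset_obj in auto)

lemma tensor_Perm: "tensor_category (Perm G T \<mu>)"
proof (intro tensor_category.intro additive_Perm symmetric_monoidal_Perm tensor_category_axioms.intro)
qed (auto simp: mat_tensor_def perm_hom_def algebra_simps fun_eq_iff split: point.splits)

lemma dual_Perm:
  assumes X: "X \<in> perm_obj G T"
  shows "is_dual (Perm G T \<mu>) X X (ev_mat X) (transp (ev_mat X))"
  unfolding is_dual_def Perm_simps
  using X ev_hom[OF X] transp_hom[OF ev_hom[OF X]] zigzag_left[OF X] zigzag_right[OF X]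
    assoc_inverse_arrows[OF X X X] by blast

lemma rigid_Perm: "rigid_tensor_category (Perm G T \<mu>)"
  using dual_Perm by (intro rigid_tensor_category.intro tensor_Perm rigid_tensor_category_axioms.intro)
    (simp, blast)

end

theorem corollary8p7:
  fixes G :: "'g monoid" and T :: "'g topology"
    and \<mu> :: "('g, ('g, 'a) univ) gset \<Rightarrow> 'k::{comm_ring, comm_monoid_mult}"
  assumes "pro_oligomorphic_group G T"
    and "group_measure G T \<mu>"
  shows "rigid_tensor_category (Perm G T \<mu>)"
proof -
  interpret measured_group G T \<mu>
    using assms by (rule measured_group.intro)
  show ?thesis by (rule rigid_Perm)
qed

end
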